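(* Let $\Omega$ be a finite set and let $P$ and $Q$ be stochastic matrices over $\Omega$. The following are equivalent: (1) there exist a *-automorphism $\rho$ of $\ell^{\infty}(\Omega)$ and a $\rho$-similarity from $Arv(P)$ to $Arv(Q)$; (2) there exists a graded completely bounded isomorphism $\varphi:\mathcal{T}_+(P)\to\mathcal{T}_+(Q)$; (3) there exists an algebraic isomorphism $\varphi:\mathcal{T}_+(P)\to\mathcal{T}_+(Q)$. If moreover $P$ and $Q$ are essential, then these conditions are equivalent to the existence of a permutation $\sigma$ of $\Omega$ such that for all $i,j\in\Omega$, $P_{ij}>0$ if and only if $Q_{\sigma(i)\sigma(j)}>0$.
   Context: A stochastic matrix over $\Omega$ is $P:\Omega\times\Omega\to[0,\infty)$ with row sums $1$; $P^{(n)}_{ij}$ is the $(i,j)$ entry of $P^n$. $P$ is essential if there is no state $i$ for which some $j$ and $n\ge1$ satisfy $P^{(n)}_{ij}>0$ but $P^{(m)}_{ji}=0$ for all $m\ge1$. $Arv(P)$: $Arv(P)_0=\ell^\infty(\Omega)$; for $n\ge1$, $Arv(P)_n$ is the set of complex $\Omega\times\Omega$ matrices $A=[a_{ij}]$ with $a_{ij}=0$ whenever $P^{(n)}_{ij}=0$ (and $\sup_j\sum_i|a_{ij}|^2<\infty$), a W*-correspondence over $\ell^\infty(\Omega)$ with actions by multiplication by diagonal matrices and inner product $\langle A,B\rangle=\mathrm{Diag}(A^*B)$. The maps $U^P_{n,m}(A\otimes B)=(\sqrt{P^{n+m}})^{\flat}*[(\sqrt{P^n}*A)(\sqrt{P^m}*B)]$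 for $n,m\ge1$ ($*$ entrywise product, $\sqrt{\cdot}$ entrywise, $M^\flat_{ik}=M_{ik}^{-1}$ if $M_{ik}>0$, else $0$); $U_{0,n},U_{n,0}$ are the module actions. Fock correspondence $\mathcal{F}=\bigoplus_{n\ge0}Arv(P)_n$; shifts $S^{(n)}_A(B)=U_{n,m}(A\otimes B)$ for $A\in Arv(P)_n$, $B\in Arv(P)_m$; $\mathcal{T}_+(P)$ is the norm-closed subalgebra of $\mathcal{L}(\mathcal{F})$ generated by $\ell^\infty(\Omega)$ and the shifts. With gauge action $\alpha_\lambda(T)=W_\lambda TW_\lambda^*$, $W_\lambda(\oplus\xi_n)=\oplus\lambda^n\xi_n$, and $\Phi_n(T)=\int_{\mathbb{T}}\alpha_\lambda(T)\lambda^{-n}d\lambda$, an isomorphism $\varphi$ is graded if $\Phi_n\varphi\Phi_n=\varphi\Phi_n$ for all $n$. For a *-automorphism $\rho$ of $\ell^\infty(\Omega)$, a $\rho$-similarity $V:Arv(P)\to Arv(Q)$ is a family $(V_n)_{n\ge0}$ with $V_0=\rho$, each $V_n:Arv(P)_n\to Arv(Q)_n$ ($n\ge1$) a bijective bounded linear map with $V_n(a\xi b)=\rho(a)V_n(\xi)\rho(b)$, $\sup_n\max(\|V_n\|,\|V_n^{-1}\|)<\infty$, and $V_{n+m}U^P_{n,m}=U^Q_{n,m}(V_n\otimes V_m)$ for all $n,m$. *)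

theory Defs
  imports "HOL-Analysis.Analysis"
begin

definition stochastic :: "('a::finite \<Rightarrow> 'a \<Rightarrow> real) \<Rightarrow> bool" where
  "stochastic P \<longleftrightarrow> (\<forall>i j. 0 \<le> P i j) \<and> (\<forall>i. (\<Sum>j\<in>UNIV. P i j) = 1)"

fun mpow :: "('a::finite \<Rightarrow> 'a \<Rightarrow> real) \<Rightarrow> nat \<Rightarrow> 'a \<Rightarrow> 'a \<Rightarrow> real" where
  "mpow P 0 = (\<lambda>i j. if i = j then 1 else 0)"
| "mpow P (Suc n) = (\<lambda>i j. \<Sum>k\<in>UNIV. mpow P n i k * P k j)"

definition essential :: "('a::finite \<Rightarrow> 'a \<Rightarrow> real) \<Rightarrow> bool" where
  "essential P \<longleftrightarrow> \<not> (\<exists>i. \<exists>j n. n \<ge> 1 \<and> mpow P n i j > 0 \<and> (\<forall>m\<ge>1. mpow P m j i = 0))"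

(* Arv(P)_n.  For n \<ge> 1: matrices supported on supp(P^(n)) (square summability is automatic
   since Omega is finite).  For n = 0 the support condition w.r.t. P^(0) = I gives exactly the
   diagonal matrices, which is how l^\<infinity>(Omega) is encoded inside the Fock module. *)
definition arv :: "('a::finite \<Rightarrow> 'a \<Rightarrow> real) \<Rightarrow> nat \<Rightarrow> ('a \<Rightarrow> 'a \<Rightarrow> complex) set" where
  "arv P n = {A. \<forall>i j. A i j \<noteq> 0 \<longrightarrow> mpow P n i j > 0}"

(* Norm of the W*-correspondence: ||A|| = sqrt ||Diag(A^* A)||_\<infinity> *)
definition cnorm :: "('a::finite \<Rightarrow> 'a \<Rightarrow> complex) \<Rightarrow> real" where
  "cnorm A = sqrt (Max (range (\<lambda>j. \<Sum>i\<in>UNIV. (cmod (A i j))\<^sup>2)))"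

(* The maps U^P_{n,m}.  For n,m \<ge> 1 this is the formula of the paper; for n = 0 or m = 0
   (with A resp. B diagonal) it reduces to the module actions. *)
definition U :: "('a::finite \<Rightarrow> 'a \<Rightarrow> real) \<Rightarrow> nat \<Rightarrow> nat \<Rightarrow>
     ('a \<Rightarrow> 'a \<Rightarrow> complex) \<Rightarrow> ('a \<Rightarrow> 'a \<Rightarrow> complex) \<Rightarrow> ('a \<Rightarrow> 'a \<Rightarrow> complex)" where
  "U P n m A B = (\<lambda>i k. if mpow P (n + m) i k > 0 then
      (\<Sum>l\<in>UNIV. (complex_of_real (sqrt (mpow P n i l)) * A i l) *
                   (complex_of_real (sqrt (mpow P m l k)) * B l k))
        / complex_of_real (sqrt (mpow P (n + m) i k))
     else 0)"

(* Elements of the Fock correspondence F = \<oplus>_n Arv(P)_n: sequences \<xi> with \<xi> n \<in> Arv(P)_n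
   and <\<xi>,\<xi>> = \<Sum>_n Diag(\<xi>_n^* \<xi>_n) convergent. *)
type_synonym 'a fock = "nat \<Rightarrow> 'a \<Rightarrow> 'a \<Rightarrow> complex"
type_synonym 'a op = "'a fock \<Rightarrow> 'a fock"

definition inFock :: "('a::finite \<Rightarrow> 'a \<Rightarrow> real) \<Rightarrow> 'a fock \<Rightarrow> bool" where
  "inFock P \<xi> \<longleftrightarrow> (\<forall>n. \<xi> n \<in> arv P n) \<and>
      (\<forall>j. summable (\<lambda>n. \<Sum>i\<in>UNIV. (cmod (\<xi> n i j))\<^sup>2))"

definition fock_norm :: "('a::finite) fock \<Rightarrow> real" where
  "fock_norm \<xi> = sqrt (Max (range (\<lambda>j. \<Sum>n. \<Sum>i\<in>UNIV. (cmod (\<xi> n i j))\<^sup>2)))"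

definition fzero :: "('a::finite) fock" where "fzero = (\<lambda>_ _ _. 0)"

(* Operators are functions on fock, normalised to vanish outside F(P). *)
definition shift :: "('a::finite \<Rightarrow> 'a \<Rightarrow> real) \<Rightarrow> nat \<Rightarrow> ('a \<Rightarrow> 'a \<Rightarrow> complex) \<Rightarrow> 'a op" where
  "shift P n A = (\<lambda>\<xi>. if inFock P \<xi> then (\<lambda>k. if k < n then (\<lambda>_ _. 0) else U P n (k - n) A (\<xi> (k - n)))
                       else fzero)"

definition op_add :: "('a::finite) op \<Rightarrow> 'a op \<Rightarrow> 'a op" where
  "op_add S T = (\<lambda>\<xi> n i j. S \<xi> n i j + T \<xi> n i j)"

definition op_scale :: "complex \<Rightarrow> ('a::finite) op \<Rightarrow> 'a op" where
  "op_scale c T = (\<lambda>\<xi> n i j. c * T \<xi> n i j)"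

definition op_diff :: "('a::finite) op \<Rightarrow> 'a op \<Rightarrow> 'a op" where
  "op_diff S T = (\<lambda>\<xi> n i j. S \<xi> n i j - T \<xi> n i j)"

(* algebra generated by l^\<infinity>(Omega) (= shifts with n = 0) and the shifts *)
inductive_set alg :: "('a::finite \<Rightarrow> 'a \<Rightarrow> real) \<Rightarrow> 'a op set" for P where
  gen: "A \<in> arv P n \<Longrightarrow> shift P n A \<in> alg P"
| add: "S \<in> alg P \<Longrightarrow> T \<in> alg P \<Longrightarrow> op_add S T \<in> alg P"
| scale: "T \<in> alg P \<Longrightarrow> op_scale c T \<in> alg P"
| comp: "S \<in> alg P \<Longrightarrow> T \<in> alg P \<Longrightarrow> S \<circ> T \<in> alg P"

definition op_bound :: "('a::finite \<Rightarrow> 'a \<Rightarrow> real) \<Rightarrow> 'a op \<Rightarrow> real \<Rightarrow> bool" where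
  "op_bound P T D \<longleftrightarrow> (\<forall>\<xi>. inFock P \<xi> \<longrightarrow> fock_norm (T \<xi>) \<le> D * fock_norm \<xi>)"

definition Tplus :: "('a::finite \<Rightarrow> 'a \<Rightarrow> real) \<Rightarrow> 'a op set" where
  "Tplus P = {T. (\<forall>\<xi>. \<not> inFock P \<xi> \<longrightarrow> T \<xi> = fzero) \<and> (\<forall>\<xi>. inFock P \<xi> \<longrightarrow> inFock P (T \<xi>)) \<and>
                 (\<forall>e>0. \<exists>S\<in>alg P. op_bound P (op_diff T S) e)}"

(* Norm on F^k (column Hilbert module direct sum) *)
definition tuple_norm :: "nat \<Rightarrow> (nat \<Rightarrow> ('a::finite) fock) \<Rightarrow> real" where
  "tuple_norm k \<xi> = sqrt (Max (range (\<lambda>j. \<Sum>s<k. \<Sum>n. \<Sum>i\<in>UNIV. (cmod (\<xi> s n i j))\<^sup>2)))"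

(* ||[M_rs]|| \<le> D in M_k(L(F(P))) = L(F(P)^k) *)
definition mat_bound :: "('a::finite \<Rightarrow> 'a \<Rightarrow> real) \<Rightarrow> nat \<Rightarrow> (nat \<Rightarrow> nat \<Rightarrow> 'a op) \<Rightarrow> real \<Rightarrow> bool" where
  "mat_bound P k M D \<longleftrightarrow> (\<forall>\<xi>. (\<forall>s<k. inFock P (\<xi> s)) \<longrightarrow>
      tuple_norm k (\<lambda>r n i j. \<Sum>s<k. M r s (\<xi> s) n i j) \<le> D * tuple_norm k \<xi>)"

definition completely_bounded :: "('a::finite \<Rightarrow> 'a \<Rightarrow> real) \<Rightarrow> ('a \<Rightarrow> 'a \<Rightarrow> real) \<Rightarrow> ('a op \<Rightarrow> 'a op) \<Rightarrow> bool" where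
  "completely_bounded P Q \<phi> \<longleftrightarrow> (\<exists>C. \<forall>k M D. (\<forall>r<k. \<forall>s<k. M r s \<in> Tplus P) \<longrightarrow>
      mat_bound P k M D \<longrightarrow> mat_bound Q k (\<lambda>r s. \<phi> (M r s)) (C * D))"

definition alg_iso :: "('a::finite \<Rightarrow> 'a \<Rightarrow> real) \<Rightarrow> ('a \<Rightarrow> 'a \<Rightarrow> real) \<Rightarrow> ('a op \<Rightarrow> 'a op) \<Rightarrow> bool" where
  "alg_iso P Q \<phi> \<longleftrightarrow> bij_betw \<phi> (Tplus P) (Tplus Q) \<and>
     (\<forall>S\<in>Tplus P. \<forall>T\<in>Tplus P. \<phi> (op_add S T) = op_add (\<phi> S) (\<phi> T) \<and> \<phi> (S \<circ> T) = \<phi> S \<circ> \<phi> T) \<and>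
     (\<forall>T\<in>Tplus P. \<forall>c. \<phi> (op_scale c T) = op_scale c (\<phi> T))"

(* gauge unitaries W_\<lambda>, gauge action, and Fourier coefficient maps \<Phi>_n
   (integral over T w.r.t. normalised Haar measure, parametrised by t \<in> [0,1]) *)
definition gauge :: "complex \<Rightarrow> ('a::finite) fock \<Rightarrow> 'a fock" where
  "gauge z \<xi> = (\<lambda>k i j. z ^ k * \<xi> k i j)"

definition gauge_act :: "complex \<Rightarrow> ('a::finite) op \<Rightarrow> 'a op" where
  "gauge_act z T = (\<lambda>\<xi>. gauge z (T (gauge (cnj z) \<xi>)))"

definition Phi :: "int \<Rightarrow> ('a::finite) op \<Rightarrow> 'a op" where
  "Phi n T = (\<lambda>\<xi> k i j. integral {0..1::real}
      (\<lambda>t. gauge_act (cis (2 * pi * t)) T \<xi> k i j * cis (- 2 * pi * of_int n * t)))"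

definition graded :: "('a::finite \<Rightarrow> 'a \<Rightarrow> real) \<Rightarrow> ('a op \<Rightarrow> 'a op) \<Rightarrow> bool" where
  "graded P \<phi> \<longleftrightarrow> (\<forall>n::int. \<forall>T\<in>Tplus P. Phi n (\<phi> (Phi n T)) = \<phi> (Phi n T))"

definition graded_cb_iso :: "('a::finite \<Rightarrow> 'a \<Rightarrow> real) \<Rightarrow> ('a \<Rightarrow> 'a \<Rightarrow> real) \<Rightarrow> ('a op \<Rightarrow> 'a op) \<Rightarrow> bool" where
  "graded_cb_iso P Q \<phi> \<longleftrightarrow> alg_iso P Q \<phi> \<and> completely_bounded P Q \<phi> \<and>
     completely_bounded Q P (inv_into (Tplus P) \<phi>) \<and> graded P \<phi>"

definition star_aut :: "(('a::finite \<Rightarrow> complex) \<Rightarrow> ('a \<Rightarrow> complex)) \<Rightarrow> bool" where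
  "star_aut \<rho> \<longleftrightarrow> bij \<rho> \<and>
     (\<forall>f g. \<rho> (\<lambda>x. f x + g x) = (\<lambda>x. \<rho> f x + \<rho> g x)) \<and>
     (\<forall>c f. \<rho> (\<lambda>x. c * f x) = (\<lambda>x. c * \<rho> f x)) \<and>
     (\<forall>f g. \<rho> (\<lambda>x. f x * g x) = (\<lambda>x. \<rho> f x * \<rho> g x)) \<and>
     (\<forall>f. \<rho> (\<lambda>x. cnj (f x)) = (\<lambda>x. cnj (\<rho> f x)))"

(* \<rho>-similarity Arv(P) \<rightarrow> Arv(Q); V 0 = \<rho> is represented by \<rho> itself, V n for n \<ge> 1 *)
definition similarity :: "('a::finite \<Rightarrow> 'a \<Rightarrow> real) \<Rightarrow> ('a \<Rightarrow> 'a \<Rightarrow> real) \<Rightarrow>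
    (('a \<Rightarrow> complex) \<Rightarrow> ('a \<Rightarrow> complex)) \<Rightarrow> (nat \<Rightarrow> ('a \<Rightarrow> 'a \<Rightarrow> complex) \<Rightarrow> ('a \<Rightarrow> 'a \<Rightarrow> complex)) \<Rightarrow> bool" where
  "similarity P Q \<rho> V \<longleftrightarrow>
     (\<forall>n\<ge>1. bij_betw (V n) (arv P n) (arv Q n)) \<and>
     (\<forall>n\<ge>1. \<forall>A\<in>arv P n. \<forall>B\<in>arv P n. V n (\<lambda>i j. A i j + B i j) = (\<lambda>i j. V n A i j + V n B i j)) \<and>
     (\<forall>n\<ge>1. \<forall>A\<in>arv P n. \<forall>c. V n (\<lambda>i j. c * A i j) = (\<lambda>i j. c * V n A i j)) \<and>
     (\<forall>n\<ge>1. \<forall>A\<in>arv P n. \<forall>a b. V n (\<lambda>i j. a i * A i j * b j) = (\<lambda>i j. \<rho> a i * V n A i j * \<rho> b j)) \<and>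
     (\<exists>C. \<forall>n\<ge>1. \<forall>A\<in>arv P n. cnorm (V n A) \<le> C * cnorm A \<and> cnorm A \<le> C * cnorm (V n A)) \<and>
     (\<forall>n\<ge>1. \<forall>m\<ge>1. \<forall>A\<in>arv P n. \<forall>B\<in>arv P m. V (n + m) (U P n m A B) = U Q n m (V n A) (V m B))"

end

(* Writing T as the power series \<Sum>_n sqrt(P^n) * T_n z^n (entrywise root and product), where T_n is
   the n-th component of T applied to the vacuum, turns composition in T_+(P) into multiplication of
   matrices of power series whose (i,j) entry is supported on {n. P^n_ij > 0}.

   No continuity of the algebraic isomorphism \<psi> is needed: it preserves idempotents,
   inverses and divisibility.  The images e_i of the diagonal units have constant term a diagonal unit
   \<sigma>(i), and e_i T e_i consists of scalar multiples f e_i, where f is a trace.  Resolvents show that the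
   scalar f of the image of z^d E_ii is bounded by R^d on a disc of radius R', where R^-2 and R'^-2 are
   the growth rates of P^n_ii and Q^n_\<sigma>i\<sigma>i.  The vacuum can only move at absorbing states which
   no other cyclic state reaches: for a transient loop leading to an absorbing state, f is a Moebius map
   of the unit disc which also maps a larger disc onto a larger disc, so it fixes 0.  Dividing power
   series by powers of z in recurrent columns then shows that \<psi> respects the order of vanishing,
   which yields the graph isomorphism \<sigma>, and Cauchy estimates yield equality of the growth rates.

   Conversely P^n_ij is determined up to bounded factors by the graph and the growth rates, since a path
   decomposes at its exit times from communicating classes; so equal graphs and rates make the
   relabelling by \<sigma> a similarity, and conjugation by a similarity is a graded cb isomorphism.
   Essential matrices have growth rate 1 everywhere. *)

theory Submission
  imports "HOL-Complex_Analysis.Complex_Analysis" Defs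

begin

section \<open>Powers of finite stochastic matrices\<close>

text \<open>Without continuity of \<psi>, no infinite sum may be moved through it, so each statement
  about an infinite series is first turned into one factorisation inside the algebra: a resolvent
  identity in \<open>tz_bound\<close>, division by z - w in \<open>sink_inverse\<close>, division by
  a power of z in \<open>filtered\<close>. The last must stay inside a norm closure and is available
  only in recurrent columns, where positive weights are bounded away from 0
  (\<open>recurrent_lower\<close>). The images of the diagonal units are skew idempotents. They are
  controlled through leading terms: the constant term of \<open>e i\<close> is a matrix unit, so a
  corner element is governed by one entry. Bad states are handled separately. An entry of a bad
  column is its shortest monomial times an element of the corner of that state, and other columns
  that reach only bad recurrent states contain only polynomials. Bad states are recurrent, so their
  rate is 1 on both sides. The permutation attached to the inverse of \<psi> is identified with the
  inverse permutation only on singleton classes; edges and rates are therefore compared by counting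
  and by summing over all states.\<close>

definition reach :: "('a::finite \<Rightarrow> 'a \<Rightarrow> real) \<Rightarrow> 'a \<Rightarrow> 'a \<Rightarrow> bool" where
  "reach P i j \<longleftrightarrow> (\<exists>n. mpow P n i j > 0)"

definition comm :: "('a::finite \<Rightarrow> 'a \<Rightarrow> real) \<Rightarrow> 'a \<Rightarrow> 'a \<Rightarrow> bool" where
  "comm P i j \<longleftrightarrow> reach P i j \<and> reach P j i"

definition cyclic :: "('a::finite \<Rightarrow> 'a \<Rightarrow> real) \<Rightarrow> 'a \<Rightarrow> bool" where
  "cyclic P i \<longleftrightarrow> (\<exists>n\<ge>1. mpow P n i i > 0)"

definition recurrent :: "('a::finite \<Rightarrow> 'a \<Rightarrow> real) \<Rightarrow> 'a \<Rightarrow> bool" where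
  "recurrent P l \<longleftrightarrow> (\<forall>j. reach P l j \<longrightarrow> reach P j l)"

definition supp_pow :: "('a::finite \<Rightarrow> 'a \<Rightarrow> real) \<Rightarrow> nat \<Rightarrow> ('a \<times> 'a) set" where
  "supp_pow P n = {(i, j). mpow P n i j > 0}"

text \<open>An exponent at which the support relation is idempotent in the finite semigroup of
  relations on the states. One such D serves all states at once, in place of the periods of the
  individual classes.\<close>

definition idem_exp :: "('a::finite \<Rightarrow> 'a \<Rightarrow> real) \<Rightarrow> nat \<Rightarrow> bool" where
  "idem_exp P D \<longleftrightarrow> D \<ge> 1 \<and> supp_pow P (D + D) = supp_pow P D"

text \<open>This is the spectral radius of the block of P on the communicating class of i, and 0
  when i lies on no cycle. The supremum form gives the bound \<open>mpow_le_rate\<close> with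
  constant 1.\<close>

definition rate :: "('a::finite \<Rightarrow> 'a \<Rightarrow> real) \<Rightarrow> 'a \<Rightarrow> real" where
  "rate P i = (SUP n\<in>{1..}. root n (mpow P n i i))"

text \<open>The probability of having stayed in the class of x up to time n: a communicating class
  that has been left is never entered again, so being in it at time n means never having
  left.\<close>

definition cmass :: "('a::finite \<Rightarrow> 'a \<Rightarrow> real) \<Rightarrow> nat \<Rightarrow> 'a \<Rightarrow> real" where
  "cmass P n x = (\<Sum>w\<in>{w. comm P x w}. mpow P n x w)"

declare mpow.simps(2) [simp del]

lemma finite_uniform_bound:
  fixes R :: "'b::finite \<Rightarrow> real \<Rightarrow> bool"
  assumes ex: "\<And>x. \<exists>K. R x K" and mono: "\<And>x K K'. R x K \<Longrightarrow> K \<le> K' \<Longrightarrow> R x K'"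
  shows "\<exists>K\<ge>1. \<forall>x. R x K"
proof -
  obtain k where k: "\<And>x. R x (k x)" using ex by metis
  define K where "K = Max (insert 1 (range k))"
  have "K \<ge> 1" "\<And>x. k x \<le> K" unfolding K_def by (auto intro!: Max_ge simp del: Max_insert)
  then show ?thesis using k mono by blast
qed

locale stoch =
  fixes P :: "'a::finite \<Rightarrow> 'a \<Rightarrow> real"
  assumes stochastic: "stochastic P"
begin

lemma P_nonneg: "0 \<le> P i j" and P_row: "(\<Sum>j\<in>UNIV. P i j) = 1"
  using stochastic by (auto simp: stochastic_def)

lemma mpow_nonneg: "0 \<le> mpow P n i j"
  by (induction n arbitrary: j) (auto simp: mpow.simps(2) intro!: sum_nonneg mult_nonneg_nonneg P_nonneg)

lemma mpow_row: "(\<Sum>j\<in>UNIV. mpow P n i j) = 1"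
proof (induction n)
  case (Suc n)
  have "(\<Sum>j\<in>UNIV. mpow P (Suc n) i j) = (\<Sum>k\<in>UNIV. \<Sum>j\<in>UNIV. mpow P n i k * P k j)"
    unfolding mpow.simps(2) by (rule sum.swap)
  also have "\<dots> = 1" using Suc by (simp add: sum_distrib_left[symmetric] P_row)
  finally show ?case .
qed simp

lemma mpow_le_1: "mpow P n i j \<le> 1"
proof -
  have "mpow P n i j \<le> (\<Sum>j\<in>UNIV. mpow P n i j)"
    by (rule member_le_sum) (auto simp: mpow_nonneg)
  then show ?thesis by (simp add: mpow_row)
qed

lemma mpow_1 [simp]: "mpow P (Suc 0) = P"
  by (auto simp: mpow.simps(2) fun_eq_iff if_distrib[of "\<lambda>x. x * _"] cong: if_cong)

lemma mpow_add: "mpow P (n + m) i j = (\<Sum>k\<in>UNIV. mpow P n i k * mpow P m k j)"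
proof (induction m arbitrary: j)
  case 0
  show ?case by (simp add: if_distrib[of "\<lambda>x. _ * x"] cong: if_cong)
next
  case (Suc m)
  have "mpow P (n + Suc m) i j = (\<Sum>l\<in>UNIV. (\<Sum>k\<in>UNIV. mpow P n i k * mpow P m k l) * P l j)"
    using Suc by (simp add: mpow.simps(2))
  also have "\<dots> = (\<Sum>l\<in>UNIV. \<Sum>k\<in>UNIV. mpow P n i k * (mpow P m k l * P l j))"
    by (simp add: sum_distrib_right mult.assoc)
  also have "\<dots> = (\<Sum>k\<in>UNIV. \<Sum>l\<in>UNIV. mpow P n i k * (mpow P m k l * P l j))"
    by (rule sum.swap)
  finally show ?case by (simp add: sum_distrib_left mpow.simps(2))
qed

lemma mpow_add_ge: "mpow P n i k * mpow P m k j \<le> mpow P (n + m) i j"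
  unfolding mpow_add by (rule member_le_sum) (auto simp: mpow_nonneg)

lemma mpow_pos_iff: "mpow P n i j > 0 \<longleftrightarrow> mpow P n i j \<noteq> 0"
  using mpow_nonneg[of n i j] by auto

lemma mpow_pos_add: "mpow P n i k > 0 \<Longrightarrow> mpow P m k j > 0 \<Longrightarrow> mpow P (n + m) i j > 0"
  using mpow_add_ge[of n i k m j] by (meson less_le_trans mult_pos_pos)

lemma mpow_pos_split: "mpow P (n + m) i j > 0 \<Longrightarrow> \<exists>k. mpow P n i k > 0 \<and> mpow P m k j > 0"
  unfolding mpow_add using sum.neutral[of UNIV "\<lambda>k. mpow P n i k * mpow P m k j"]
  by (metis less_irrefl mpow_pos_iff mult_eq_0_iff)

lemma mpow_pos_mult: "mpow P n i i > 0 \<Longrightarrow> mpow P (k * n) i i > 0"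
  by (induction k) (auto intro: mpow_pos_add)

lemma mpow_power_le: "mpow P n i i ^ k \<le> mpow P (k * n) i i"
proof (induction k)
  case (Suc k)
  have "mpow P n i i ^ Suc k \<le> mpow P n i i * mpow P (k * n) i i"
    using Suc by (simp add: mult_left_mono mpow_nonneg)
  also have "\<dots> \<le> mpow P (Suc k * n) i i" using mpow_add_ge[of n i i "k * n" i] by simp
  finally show ?case .
qed simp

lemma reach_refl [simp]: "reach P i i"
  by (auto simp: reach_def intro!: exI[of _ 0])

lemma reach_trans: "reach P i j \<Longrightarrow> reach P j k \<Longrightarrow> reach P i k"
  unfolding reach_def by (meson mpow_pos_add)

lemma reachI: "mpow P n i j > 0 \<Longrightarrow> reach P i j"
  by (auto simp: reach_def)

lemma reach_edge: "P i j > 0 \<Longrightarrow> reach P i j"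
  using reachI[of "Suc 0"] by simp

lemma comm_refl [simp]: "comm P i i" and comm_sym: "comm P i j \<Longrightarrow> comm P j i"
  by (auto simp: comm_def)

lemma comm_trans: "comm P i j \<Longrightarrow> comm P j k \<Longrightarrow> comm P i k"
  unfolding comm_def by (meson reach_trans)

section \<open>Eventual periodicity of the supports\<close>

lemma supp_pow_add: "supp_pow P (n + m) = supp_pow P n O supp_pow P m"
  by (auto simp: supp_pow_def relcomp_unfold intro: mpow_pos_add dest: mpow_pos_split)

lemma idem_exp_exists: "\<exists>D. idem_exp P D"
proof -
  have "\<not> inj (supp_pow P)"
    using finite_imageD[of "supp_pow P" UNIV] by (metis finite infinite_UNIV_nat)
  then obtain a b where ab: "a < b" "supp_pow P a = supp_pow P b"
    unfolding inj_def by (metis linorder_neqE_nat)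
  define p where "p = b - a"
  have step: "supp_pow P (m + p) = supp_pow P m" if "m \<ge> a" for m
  proof -
    have "supp_pow P (m + p) = supp_pow P (b + (m - a))"
      using that ab by (simp add: p_def algebra_simps)
    also have "\<dots> = supp_pow P (a + (m - a))" by (simp only: supp_pow_add ab(2))
    finally show ?thesis using that by simp
  qed
  have steps: "supp_pow P (m + k * p) = supp_pow P m" if "m \<ge> a" for m k
  proof (induction k)
    case (Suc k)
    have "supp_pow P (m + Suc k * p) = supp_pow P ((m + k * p) + p)" by (simp add: algebra_simps)
    also have "\<dots> = supp_pow P m" using step[of "m + k * p"] that Suc by simp
    finally show ?case .
  qed simp
  \<comment> \<open>A multiple of the period past the preperiod; the factor \<open>Suc a\<close>
    instead of a keeps D positive when a = 0.\<close>
  define D where "D = Suc a * p"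
  have "p \<ge> 1" using ab by (simp add: p_def)
  then have "D \<ge> Suc a" unfolding D_def using mult_le_mono2[of 1 p "Suc a"] by simp
  then have "D \<ge> a" "D \<ge> 1" by auto
  then have "idem_exp P D" unfolding idem_exp_def using steps[of D "Suc a"] by (simp add: D_def)
  then show ?thesis by blast
qed

lemma idem_exp_mult: assumes "idem_exp P D" "k \<ge> 1" shows "supp_pow P (k * D) = supp_pow P D"
  using assms(2)
proof (induction k rule: dec_induct)
  case (step k)
  have "supp_pow P (Suc k * D) = supp_pow P (k * D) O supp_pow P D"
    by (simp add: supp_pow_add[symmetric] add.commute)
  then show ?case using step assms by (simp add: idem_exp_def supp_pow_add)
qed simp

lemma idem_exp_shift: assumes "idem_exp P D" "n \<ge> D"
  shows "mpow P (n + k * D) i j > 0 \<longleftrightarrow> mpow P n i j > 0"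
proof -
  have "supp_pow P (n + k * D) = supp_pow P (Suc k * D + (n - D))"
    using assms by (simp add: algebra_simps)
  also have "\<dots> = supp_pow P (D + (n - D))"
    using idem_exp_mult[OF assms(1), of "Suc k"] by (simp only: supp_pow_add)
  finally have "supp_pow P (n + k * D) = supp_pow P n" using assms by simp
  then show ?thesis unfolding supp_pow_def by blast
qed

lemma idem_exp_mult_pos: "idem_exp P D \<Longrightarrow> k \<ge> 1 \<Longrightarrow> mpow P (k * D) i j > 0 \<longleftrightarrow> mpow P D i j > 0"
  using idem_exp_mult[of D k] unfolding supp_pow_def by blast

lemma idem_exp_cyclic: assumes "idem_exp P D" "cyclic P i" shows "mpow P D i i > 0"
proof -
  obtain q where "q \<ge> 1" "mpow P q i i > 0" using assms(2) by (auto simp: cyclic_def)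
  then show ?thesis
    using mpow_pos_mult[of q i D] idem_exp_mult_pos[OF assms(1), of q i i] by (simp add: mult.commute)
qed

text \<open>Loops at w supply the missing length: w goes to x and comes back in q steps, and it
  reaches y via x in q + D steps. Adding D - 1 loops gives (q + 1) * D steps, which idempotence
  shortens to D.\<close>

lemma idem_exp_class:
  assumes D: "idem_exp P D" and xw: "comm P x w" and n: "mpow P (m + D) x y > 0" and m: "mpow P m x w > 0"
  shows "mpow P D w y > 0"
proof -
  obtain s where s: "mpow P s w x > 0" using xw by (auto simp: comm_def reach_def)
  define q where "q = s + m"
  have ww: "mpow P q w w > 0" unfolding q_def using s m by (rule mpow_pos_add)
  have "mpow P (s + (m + D)) w y > 0" using s n by (rule mpow_pos_add)
  then have "mpow P (q + D) w y > 0" by (simp add: q_def add.assoc)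
  then have "mpow P ((D - 1) * q + (q + D)) w y > 0"
    using mpow_pos_mult[OF ww] mpow_pos_add by blast
  moreover have "(D - 1) * q + (q + D) = Suc q * D"
    using D by (cases D) (auto simp: idem_exp_def algebra_simps)
  ultimately have "mpow P (Suc q * D) w y > 0" by (simp only:)
  then show ?thesis using idem_exp_mult_pos[OF D, of "Suc q" w y] by simp
qed

lemma mpow_uniform_lower: "\<exists>\<delta>>0. \<delta> \<le> 1 \<and> (\<forall>n\<le>N. \<forall>i j. mpow P n i j > 0 \<longrightarrow> \<delta> \<le> mpow P n i j)"
proof -
  define S where "S = insert 1 ({mpow P n i j | n i j. n \<le> N \<and> mpow P n i j > 0})"
  have "{mpow P n i j | n i j. n \<le> N \<and> mpow P n i j > 0} \<subseteq> (\<lambda>(n,i,j). mpow P n i j) ` ({..N} \<times> UNIV \<times> UNIV)"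
    by (clarsimp, rule image_eqI[of _ _ "(_, _, _)"]) auto
  then have fin: "finite S" unfolding S_def by (intro finite.insertI) (rule finite_subset, auto)
  show ?thesis
  proof (intro exI[of _ "Min S"] conjI allI impI)
    show "Min S > 0" using fin by (subst Min_gr_iff) (auto simp: S_def)
    show "Min S \<le> 1" using fin by (intro Min_le) (auto simp: S_def)
    show "Min S \<le> mpow P n i j" if "n \<le> N" "mpow P n i j > 0" for n i j
      using fin that by (intro Min_le) (auto simp: S_def)
  qed
qed

section \<open>Survival in a communicating class and growth rates\<close>

lemma cmass_nonneg: "0 \<le> cmass P n x"
  by (auto simp: cmass_def intro!: sum_nonneg mpow_nonneg)

lemma cmass_ge: "comm P x w \<Longrightarrow> mpow P n x w \<le> cmass P n x"
  unfolding cmass_def by (rule member_le_sum) (auto simp: mpow_nonneg)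

lemma cmass_le_1: "cmass P n x \<le> 1"
proof -
  have "cmass P n x \<le> (\<Sum>w\<in>UNIV. mpow P n x w)" unfolding cmass_def
    by (rule sum_mono2) (auto simp: mpow_nonneg)
  then show ?thesis by (simp add: mpow_row)
qed

lemma cmass_recurrent: assumes "recurrent P x" shows "cmass P n x = 1"
proof -
  have "cmass P n x = (\<Sum>w\<in>UNIV. mpow P n x w)" unfolding cmass_def
  proof (rule sum.mono_neutral_left)
    show "\<forall>i\<in>UNIV - {w. comm P x w}. mpow P n x i = 0"
      using assms by (auto simp: recurrent_def comm_def) (meson mpow_pos_iff reachI)+
  qed auto
  then show ?thesis by (simp add: mpow_row)
qed

lemma cmass_add: "cmass P (n + m) x = (\<Sum>k\<in>{k. comm P x k}. mpow P n x k * cmass P m k)"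
proof -
  have "cmass P (n + m) x = (\<Sum>w\<in>{w. comm P x w}. \<Sum>k\<in>UNIV. mpow P n x k * mpow P m k w)"
    unfolding cmass_def mpow_add ..
  also have "\<dots> = (\<Sum>w\<in>{w. comm P x w}. \<Sum>k\<in>{k. comm P x k}. mpow P n x k * mpow P m k w)"
  proof (rule sum.cong[OF refl], rule sum.mono_neutral_right)
    fix w assume w: "w \<in> {w. comm P x w}"
    show "\<forall>k\<in>UNIV - {k. comm P x k}. mpow P n x k * mpow P m k w = 0"
    proof
      fix k assume k: "k \<in> UNIV - {k. comm P x k}"
      show "mpow P n x k * mpow P m k w = 0"
      proof (rule ccontr)
        assume "mpow P n x k * mpow P m k w \<noteq> 0"
        then have "reach P x k" "reach P k w" by (auto simp: mpow_pos_iff[symmetric] intro: reachI)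
        then show False using w k by (auto simp: comm_def intro: reach_trans)
      qed
    qed
  qed auto
  also have "\<dots> = (\<Sum>k\<in>{k. comm P x k}. \<Sum>w\<in>{w. comm P x w}. mpow P n x k * mpow P m k w)"
    by (rule sum.swap)
  also have "\<dots> = (\<Sum>k\<in>{k. comm P x k}. mpow P n x k * cmass P m k)"
  proof (rule sum.cong[OF refl])
    fix k assume "k \<in> {k. comm P x k}"
    then have "{w. comm P x w} = {w. comm P k w}" by (auto intro: comm_trans comm_sym)
    then show "(\<Sum>w\<in>{w. comm P x w}. mpow P n x k * mpow P m k w) = mpow P n x k * cmass P m k"
      by (simp add: cmass_def sum_distrib_left)
  qed
  finally show ?thesis .
qed

lemma cmass_antimono: "cmass P (n + m) x \<le> cmass P n x"
  unfolding cmass_add unfolding cmass_def[of P n]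
  by (rule sum_mono) (simp add: mult_left_le cmass_le_1 mpow_nonneg)

text \<open>By \<open>idem_exp_class\<close>, y is D steps away from every state of the class that
  can be occupied D steps earlier. The final D steps therefore cost at most a constant
  factor.\<close>

lemma cmass_lower: "\<exists>\<delta>>0. \<forall>n x y. comm P x y \<longrightarrow> mpow P n x y > 0 \<longrightarrow> \<delta> * cmass P n x \<le> mpow P n x y"
proof -
  obtain D where D: "idem_exp P D" using idem_exp_exists by blast
  obtain \<delta> where \<delta>: "\<delta> > 0" "\<And>n i j. n \<le> D \<Longrightarrow> mpow P n i j > 0 \<Longrightarrow> \<delta> \<le> mpow P n i j"
    using mpow_uniform_lower[of D] by blast
  have "\<delta> * cmass P n x \<le> mpow P n x y" if xy: "comm P x y" and pos: "mpow P n x y > 0" for n x y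
  proof (cases "n \<le> D")
    case True
    then show ?thesis using \<delta>(2)[OF True pos] \<delta>(1) cmass_le_1[of n x]
      by (smt (verit) mult_left_le)
  next
    case False
    define m where "m = n - D"
    have n: "n = m + D" using False by (simp add: m_def)
    have "\<delta> * cmass P n x \<le> \<delta> * cmass P m x"
      using cmass_antimono[of m D x] \<delta>(1) by (simp add: n)
    also have "\<dots> = (\<Sum>w\<in>{w. comm P x w}. mpow P m x w * \<delta>)"
      by (simp add: cmass_def sum_distrib_left mult.commute)
    also have "\<dots> \<le> (\<Sum>w\<in>{w. comm P x w}. mpow P m x w * mpow P D w y)"
    proof (rule sum_mono)
      fix w assume w: "w \<in> {w. comm P x w}"
      show "mpow P m x w * \<delta> \<le> mpow P m x w * mpow P D w y"
      proof (cases "mpow P m x w > 0")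
        case True
        have "mpow P D w y > 0"
          using idem_exp_class[OF D _ _ True] w pos n by auto
        then show ?thesis using \<delta>(2)[of D w y] True by simp
      next
        case False
        then show ?thesis by (simp add: mpow_pos_iff)
      qed
    qed
    also have "\<dots> \<le> mpow P n x y" unfolding n mpow_add
      by (rule sum_mono2) (auto simp: mpow_nonneg)
    finally show ?thesis .
  qed
  then show ?thesis using \<delta>(1) by blast
qed

text \<open>The chain is restarted at time n: survival masses from two states x and w of one class
  differ by a bounded factor, since going from x to w first has a fixed positive
  probability.\<close>

lemma cmass_submult: "\<exists>K\<ge>1. \<forall>n m x. cmass P (n + m) x \<le> K * cmass P n x * cmass P m x"
proof -
  have "\<exists>K\<ge>1. \<forall>xw::'a\<times>'a. \<forall>m. comm P (fst xw) (snd xw) \<longrightarrow> cmass P m (snd xw) \<le> K * cmass P m (fst xw)"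
  proof (rule finite_uniform_bound)
    fix xw :: "'a \<times> 'a"
    obtain x w where xw: "xw = (x, w)" by force
    show "\<exists>K. \<forall>m. comm P (fst xw) (snd xw) \<longrightarrow> cmass P m (snd xw) \<le> K * cmass P m (fst xw)"
    proof (cases "comm P x w")
      case True
      then obtain s where s: "mpow P s x w > 0" by (auto simp: comm_def reach_def)
      have "cmass P m w \<le> (1 / mpow P s x w) * cmass P m x" for m
      proof -
        have "mpow P s x w * cmass P m w \<le> cmass P (s + m) x"
          unfolding cmass_add using True
          by (intro member_le_sum) (auto simp: mpow_nonneg cmass_nonneg)
        also have "\<dots> \<le> cmass P m x" using cmass_antimono[of m s x] by (simp add: add.commute)
        finally show ?thesis using s by (simp add: field_simps)
      qed
      then show ?thesis unfolding xw by (intro exI[of _ "1 / mpow P s x w"]) simp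
    qed (auto simp: xw)
  next
    fix xw K K' assume a: "\<forall>m. comm P (fst xw) (snd xw) \<longrightarrow> cmass P m (snd xw) \<le> K * cmass P m (fst xw)"
      and "(K::real) \<le> K'"
    then show "\<forall>m. comm P (fst xw) (snd xw) \<longrightarrow> cmass P m (snd xw) \<le> K' * cmass P m (fst xw)"
      by (meson cmass_nonneg mult_right_mono order_trans)
  qed
  then obtain K where K: "K \<ge> 1" "\<And>x w m. comm P x w \<Longrightarrow> cmass P m w \<le> K * cmass P m x" by auto
  have "cmass P (n + m) x \<le> K * cmass P n x * cmass P m x" for n m x
  proof -
    have "cmass P (n + m) x \<le> (\<Sum>k\<in>{k. comm P x k}. mpow P n x k * (K * cmass P m x))"
      unfolding cmass_add by (rule sum_mono) (auto intro!: mult_left_mono K mpow_nonneg)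
    also have "\<dots> = K * cmass P n x * cmass P m x"
      by (simp add: cmass_def[of P n] sum_distrib_right[symmetric])
    finally show ?thesis .
  qed
  then show ?thesis using K(1) by blast
qed

lemma rate_bdd: "bdd_above ((\<lambda>n. root n (mpow P n i i)) ` {1..})"
  by (rule bdd_aboveI[of _ 1]) (auto simp: mpow_le_1)

lemma mpow_le_rate: assumes "n \<ge> 1" shows "mpow P n i i \<le> rate P i ^ n"
proof -
  have "root n (mpow P n i i) \<le> rate P i"
    unfolding rate_def by (rule cSUP_upper[OF _ rate_bdd]) (use assms in auto)
  then have "root n (mpow P n i i) ^ n \<le> rate P i ^ n"
    by (intro power_mono) (use assms in \<open>auto simp: mpow_nonneg real_root_ge_zero\<close>)
  then show ?thesis using assms by (simp add: mpow_nonneg)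
qed

lemma rate_nonneg: "0 \<le> rate P i"
proof -
  have "root 1 (mpow P 1 i i) \<le> rate P i"
    unfolding rate_def by (rule cSUP_upper[OF _ rate_bdd]) auto
  then show ?thesis using mpow_nonneg[of 1 i i] by simp
qed

lemma rate_le_1: "rate P i \<le> 1"
  unfolding rate_def by (rule cSUP_least) (auto simp: mpow_le_1)

lemma rate_cyclic: "cyclic P i \<Longrightarrow> rate P i > 0"
  using mpow_le_rate rate_nonneg unfolding cyclic_def
  by (metis less_le_not_le not_less_eq_eq not_less zero_power order_le_less less_one linorder_not_le)

lemma rate_attained: assumes "0 \<le> e" "e < rate P i" shows "\<exists>n\<ge>1. e ^ n < mpow P n i i"
proof -
  obtain n where n: "n \<ge> 1" "e < root n (mpow P n i i)"
    using assms(2) less_cSUP_iff[OF _ rate_bdd, of e i] unfolding rate_def by auto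
  have "e ^ n < root n (mpow P n i i) ^ n" using n assms(1) by (intro power_strict_mono) auto
  then show ?thesis using n by (auto simp: mpow_nonneg)
qed

text \<open>Fekete's argument: K * cmass is submultiplicative in time while return probabilities are
  supermultiplicative, so comparing both at the common time n * N gives the bound for every e below
  the rate. Then e tends to the rate.\<close>

lemma rate_le_cmass: "\<exists>K\<ge>1. \<forall>n x. rate P x ^ n \<le> K * cmass P n x"
proof -
  obtain K where K: "K \<ge> 1" "\<And>n m x. cmass P (n + m) x \<le> K * cmass P n x * cmass P m x"
    using cmass_submult by blast
  have pw: "cmass P (Suc k * n) x \<le> (K * cmass P n x) ^ Suc k" for k n x
  proof (induction k)
    case 0
    then show ?case using K(1) cmass_nonneg[of n x] mult_right_mono[of 1 K "cmass P n x"] by simp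
  next
    case (Suc k)
    have "cmass P (Suc (Suc k) * n) x \<le> K * cmass P n x * cmass P (Suc k * n) x"
      using K(2)[of n "Suc k * n" x] by simp
    also have "\<dots> \<le> (K * cmass P n x) * (K * cmass P n x) ^ Suc k"
      using Suc K(1) by (intro mult_left_mono) (auto simp: cmass_nonneg)
    finally show ?case by simp
  qed
  have small: "e ^ n \<le> K * cmass P n x" if e: "0 \<le> e" "e < rate P x" for e n x
  proof -
    obtain N where N: "N \<ge> 1" "e ^ N < mpow P N x x" using rate_attained[OF e] by blast
    then obtain N' where N': "N = Suc N'" by (cases N) auto
    have "(e ^ n) ^ N = (e ^ N) ^ n" by (metis power_mult mult.commute)
    also have "\<dots> \<le> mpow P N x x ^ n" using N e by (intro power_mono) auto
    also have "\<dots> \<le> mpow P (n * N) x x" by (rule mpow_power_le)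
    also have "\<dots> \<le> cmass P (n * N) x" by (rule cmass_ge) simp
    also have "\<dots> \<le> (K * cmass P n x) ^ N" using pw[of N' n x] by (simp add: N' mult.commute)
    finally show ?thesis
      by (rule power_le_imp_le_base[of _ N', folded N']) (use K(1) cmass_nonneg[of n x] in auto)
  qed
  have "rate P x ^ n \<le> K * cmass P n x" for n x
  proof (cases "rate P x = 0")
    case True
    have "1 \<le> cmass P 0 x" using cmass_ge[of x x 0] by simp
    then have "1 \<le> K * cmass P 0 x" using K(1) by (metis mult_mono' mult_1 zero_le_one)
    then show ?thesis using True K(1) cmass_nonneg[of n x] by (cases n) auto
  next
    case False
    then have r: "rate P x > 0" using rate_nonneg[of x] by simp
    have "(\<lambda>k. (rate P x * (1 - inverse (real (Suc k)))) ^ n) \<longlonglongrightarrow> (rate P x * (1 - 0)) ^ n"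
      by (intro tendsto_intros LIMSEQ_inverse_real_of_nat)
    moreover have "(rate P x * (1 - inverse (real (Suc k)))) ^ n \<le> K * cmass P n x" for k
      by (rule small) (use r in \<open>auto simp: field_simps\<close>)
    ultimately show ?thesis by (intro LIMSEQ_le_const2) auto
  qed
  then show ?thesis using K(1) by blast
qed

lemma class_lower: "\<exists>c>0. \<forall>n x y. comm P x y \<longrightarrow> mpow P n x y > 0 \<longrightarrow> c * rate P x ^ n \<le> mpow P n x y"
proof -
  obtain \<delta> where d: "\<delta> > 0" "\<And>n x y. comm P x y \<Longrightarrow> mpow P n x y > 0 \<Longrightarrow> \<delta> * cmass P n x \<le> mpow P n x y"
    using cmass_lower by blast
  obtain K where K: "K \<ge> 1" "\<And>n x. rate P x ^ n \<le> K * cmass P n x" using rate_le_cmass by blast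
  have "\<delta> / K * rate P x ^ n \<le> mpow P n x y" if "comm P x y" "mpow P n x y > 0" for n x y
  proof -
    have "\<delta> / K * rate P x ^ n \<le> \<delta> / K * (K * cmass P n x)"
      using d(1) K by (intro mult_left_mono) auto
    then show ?thesis using d(2)[OF that] K(1) by simp
  qed
  then show ?thesis using d(1) K(1) by (intro exI[of _ "\<delta> / K"]) auto
qed

text \<open>Closing a path from x to y by a fixed return path makes it a loop at x.\<close>

lemma class_upper: "\<exists>C\<ge>1. \<forall>n x y. comm P x y \<longrightarrow> mpow P n x y \<le> C * rate P x ^ n"
proof -
  have "\<exists>C\<ge>1. \<forall>xy::'a\<times>'a. \<forall>n. comm P (fst xy) (snd xy) \<longrightarrow> mpow P n (fst xy) (snd xy) \<le> C * rate P (fst xy) ^ n"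
  proof (rule finite_uniform_bound)
    fix xy :: "'a \<times> 'a"
    obtain x y where xy: "xy = (x, y)" by force
    show "\<exists>C. \<forall>n. comm P (fst xy) (snd xy) \<longrightarrow> mpow P n (fst xy) (snd xy) \<le> C * rate P (fst xy) ^ n"
    proof (cases "comm P x y")
      case True
      then obtain s where s: "mpow P s y x > 0" by (auto simp: comm_def reach_def)
      have "mpow P n x y \<le> 1 / mpow P s y x * rate P x ^ n" for n
      proof -
        have "mpow P n x y * mpow P s y x \<le> mpow P (n + s) x x" by (rule mpow_add_ge)
        also have "\<dots> \<le> rate P x ^ (n + s)"
          using mpow_le_rate[of "n + s" x] by (cases "n + s = 0") auto
        also have "\<dots> \<le> rate P x ^ n" by (rule power_decreasing) (auto simp: rate_nonneg rate_le_1)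
        finally show ?thesis using s by (simp add: field_simps)
      qed
      then show ?thesis unfolding xy by (intro exI[of _ "1 / mpow P s y x"]) simp
    qed (auto simp: xy)
  next
    fix xy C C' assume a: "\<forall>n. comm P (fst xy) (snd xy) \<longrightarrow> mpow P n (fst xy) (snd xy) \<le> C * rate P (fst xy) ^ n"
      and "(C::real) \<le> C'"
    then show "\<forall>n. comm P (fst xy) (snd xy) \<longrightarrow> mpow P n (fst xy) (snd xy) \<le> C' * rate P (fst xy) ^ n"
      by (meson rate_nonneg zero_le_power mult_right_mono order_trans)
  qed
  then show ?thesis by auto
qed

lemma recurrent_reach: "recurrent P x \<Longrightarrow> reach P x y \<Longrightarrow> recurrent P y"
  unfolding recurrent_def by (meson reach_trans)

lemma cyclic_recurrent: assumes "recurrent P x" shows "cyclic P x"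
proof -
  have "\<exists>j. P x j > 0" using P_row[of x] P_nonneg[of x] sum_nonpos[of UNIV "P x"]
    by (metis not_le zero_less_one)
  then obtain j where j: "mpow P 1 x j > 0" by auto
  then obtain n where "mpow P n j x > 0" using assms reachI[OF j] by (auto simp: recurrent_def reach_def)
  from mpow_pos_add[OF j this] show ?thesis unfolding cyclic_def by (intro exI[of _ "1 + n"]) simp
qed

text \<open>No mass leaves a recurrent class, so the return probabilities along multiples of q stay
  above a constant, which excludes geometric decay.\<close>

lemma rate_recurrent: assumes "recurrent P x" shows "rate P x = 1"
proof (rule ccontr)
  assume "rate P x \<noteq> 1"
  then have r: "rate P x < 1" using rate_le_1[of x] by simp
  obtain \<delta> where d: "\<delta> > 0" "\<And>n x y. comm P x y \<Longrightarrow> mpow P n x y > 0 \<Longrightarrow> \<delta> * cmass P n x \<le> mpow P n x y"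
    using cmass_lower by blast
  obtain q where q: "q \<ge> 1" "mpow P q x x > 0" using cyclic_recurrent[OF assms] by (auto simp: cyclic_def)
  have "\<delta> \<le> (rate P x ^ q) ^ k" if "k \<ge> 1" for k
  proof -
    have "\<delta> \<le> mpow P (k * q) x x"
      using d(2)[OF comm_refl mpow_pos_mult[OF q(2), of k]] by (simp add: cmass_recurrent[OF assms])
    also have "\<dots> \<le> rate P x ^ (k * q)" using that q by (intro mpow_le_rate) simp
    finally show ?thesis by (metis power_mult mult.commute)
  qed
  moreover have "(\<lambda>k. (rate P x ^ q) ^ k) \<longlonglongrightarrow> 0"
    by (rule LIMSEQ_realpow_zero) (use rate_nonneg[of x] r q in \<open>auto intro: power_less_one_iff[THEN iffD2] simp: power_less_one_iff\<close>)
  ultimately have "\<delta> \<le> 0" by (intro LIMSEQ_le_const[where X="\<lambda>k. (rate P x ^ q) ^ k"]) auto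
  then show False using d(1) by simp
qed

text \<open>The state i may be transient, so no estimate inside a class applies. Instead, let W
  consist of the states of the class of k from which k is D steps away. It is closed under D steps,
  so the mass in W cannot decrease along n, n + D, n + 2 * D and so on. It is bounded below at an
  early time, hence for good.\<close>

lemma recurrent_lower: "\<exists>\<delta>>0. \<forall>n i k. recurrent P k \<longrightarrow> mpow P n i k > 0 \<longrightarrow> \<delta> \<le> mpow P n i k"
proof -
  obtain D where D: "idem_exp P D" using idem_exp_exists by blast
  obtain \<delta> where \<delta>: "\<delta> > 0" "\<delta> \<le> 1" "\<And>n i j. n \<le> D + D \<Longrightarrow> mpow P n i j > 0 \<Longrightarrow> \<delta> \<le> mpow P n i j"
    using mpow_uniform_lower[of "D + D"] by blast
  have "\<delta> * \<delta> \<le> mpow P n i k" if k: "recurrent P k" and pos: "mpow P n i k > 0" for n i k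
  proof (cases "n \<le> D + D")
    case True
    then show ?thesis using \<delta>(3)[OF True pos] \<delta>(1,2) by (smt (verit) mult_left_le)
  next
    case False
    define W where "W = {w. comm P k w \<and> mpow P D w k > 0}"
    define A where "A = (\<lambda>n. \<Sum>w\<in>W. mpow P n i w)"
    have kW: "k \<in> W" using idem_exp_cyclic[OF D cyclic_recurrent[OF k]] by (simp add: W_def)
    have W_closed: "w' \<in> W" if "w \<in> W" "mpow P D w w' > 0" for w w'
    proof -
      have kw: "comm P k w" "mpow P D w k > 0" using that by (auto simp: W_def)
      have kw': "reach P k w'" using kw that(2) by (meson comm_def reachI reach_trans)
      then have "comm P k w'" using k by (auto simp: comm_def recurrent_def)
      moreover have "mpow P D w' k > 0"
      proof (rule idem_exp_class[OF D _ _ that(2)])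
        show "comm P w w'" using \<open>comm P k w'\<close> kw(1) by (meson comm_sym comm_trans)
        show "mpow P (D + D) w k > 0" using idem_exp_mult_pos[OF D, of 2] kw(2) by (simp add: mult_2)
      qed
      ultimately show ?thesis by (simp add: W_def)
    qed
    have W_row: "(\<Sum>w'\<in>W. mpow P D w w') = 1" if "w \<in> W" for w
    proof -
      have "(\<Sum>w'\<in>W. mpow P D w w') = (\<Sum>w'\<in>UNIV. mpow P D w w')"
        using W_closed[OF that] by (intro sum.mono_neutral_left) (auto simp: mpow_pos_iff)
      then show ?thesis by (simp add: mpow_row)
    qed
    have A_mono: "A m \<le> A (m + D)" for m
    proof -
      have "A m = (\<Sum>w\<in>W. mpow P m i w * (\<Sum>w'\<in>W. mpow P D w w'))" by (simp add: A_def W_row)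
      also have "\<dots> \<le> (\<Sum>w\<in>UNIV. mpow P m i w * (\<Sum>w'\<in>W. mpow P D w w'))"
        by (rule sum_mono2) (auto intro!: mult_nonneg_nonneg sum_nonneg mpow_nonneg)
      also have "\<dots> = A (m + D)" unfolding A_def mpow_add sum_distrib_left by (rule sum.swap)
      finally show ?thesis .
    qed
    have A_mono': "A m \<le> A (m + j * D)" for m j
      by (induction j) (use A_mono order_trans in \<open>fastforce simp: algebra_simps\<close>)+
    have lower: "\<delta> * A m \<le> mpow P (m + D) i k" for m
    proof -
      have "\<delta> * A m \<le> (\<Sum>w\<in>W. mpow P m i w * mpow P D w k)" unfolding A_def sum_distrib_left
        by (rule sum_mono) (use \<delta>(3)[of D _ k] in \<open>auto simp: W_def mult.commute mpow_nonneg intro!: mult_right_mono\<close>)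
      also have "\<dots> \<le> mpow P (m + D) i k" unfolding mpow_add
        by (rule sum_mono2) (auto simp: mpow_nonneg)
      finally show ?thesis .
    qed
    \<comment> \<open>r represents n modulo D in the range from D to 2 * D, where the support is
      already periodic.\<close>
    define r where "r = D + n mod D"
    define j where "j = n div D - 1"
    have D1: "D \<ge> 1" using D by (simp add: idem_exp_def)
    have nd: "n div D \<ge> 2" using False D1 by (metis mult_2 mult.commute div_le_mono nle_le nonzero_mult_div_cancel_right not_one_le_zero)
    have jd: "n div D = Suc j" using nd by (simp add: j_def)
    have "n = n mod D + Suc j * D" unfolding jd[symmetric] by simp
    then have n: "n = r + j * D" by (simp add: r_def)
    \<comment> \<open>One of the j periods is kept for the last passage from W to k.\<close>
    have "j \<noteq> 0" using nd jd by linarith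
    then obtain j' where j': "j = Suc j'" using not0_implies_Suc by blast
    have rpos: "mpow P r i k > 0" using idem_exp_shift[OF D, of r j i k] pos unfolding n[symmetric] by (simp add: r_def)
    have "r \<le> D + D" unfolding r_def using D1 mod_less_divisor[of D n] by linarith
    then have "\<delta> \<le> mpow P r i k" using \<delta>(3) rpos by blast
    also have "\<dots> \<le> A r" unfolding A_def by (rule member_le_sum) (auto simp: kW mpow_nonneg)
    also have "\<dots> \<le> A (r + j' * D)" by (rule A_mono')
    finally have "\<delta> * \<delta> \<le> \<delta> * A (r + j' * D)" using \<delta>(1) by simp
    also have "\<dots> \<le> mpow P n i k" using lower[of "r + j' * D"] by (subst n) (simp add: j' algebra_simps)
    finally show ?thesis .
  qed
  then show ?thesis using \<delta>(1) by (intro exI[of _ "\<delta> * \<delta>"]) auto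
qed

lemma recurrent_exists: "\<exists>l. reach P i l \<and> recurrent P l"
proof (induction "card {w. reach P i w}" arbitrary: i rule: less_induct)
  case less
  show ?case
  proof (cases "recurrent P i")
    case False
    then obtain j where j: "reach P i j" "\<not> reach P j i" by (auto simp: recurrent_def)
    have "{w. reach P j w} \<subset> {w. reach P i w}" using j reach_trans by (auto)
    then have "card {w. reach P j w} < card {w. reach P i w}" by (simp add: psubset_card_mono)
    from less[OF this] show ?thesis using j reach_trans by blast
  qed (auto intro!: exI[of _ i])
qed

end

section \<open>Comparison of chains with the same graph and rates\<close>

lemma stoch_I: "stochastic P \<Longrightarrow> stoch P"
  by (simp add: stoch_def)

lemma supp_pow_eq:
  assumes "stochastic P" "stochastic Q" "\<And>i j. P i j > 0 \<longleftrightarrow> Q i j > 0"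
  shows "mpow P n i j > 0 \<longleftrightarrow> mpow Q n i j > 0"
proof -
  interpret p: stoch P by (rule stoch_I) fact
  interpret q: stoch Q by (rule stoch_I) fact
  show ?thesis
  proof (induction n arbitrary: j)
    case (Suc n)
    have "mpow P (n + 1) i j > 0 \<longleftrightarrow> (\<exists>k. mpow P n i k > 0 \<and> mpow P 1 k j > 0)"
      using p.mpow_pos_add p.mpow_pos_split by blast
    moreover have "mpow Q (n + 1) i j > 0 \<longleftrightarrow> (\<exists>k. mpow Q n i k > 0 \<and> mpow Q 1 k j > 0)"
      using q.mpow_pos_add q.mpow_pos_split by blast
    ultimately show ?case using Suc assms(3) by simp
  qed simp
qed

text \<open>A path from i to a state outside its class leaves the class exactly once; the sum runs
  over the time m and the edge from x to y of that exit.\<close>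

lemma (in stoch) exit_decomposition:
  assumes "\<not> comm P i j"
  shows "mpow P n i j = (\<Sum>m<n. \<Sum>x\<in>{x. comm P i x}. \<Sum>y\<in>{y. \<not> comm P i y}.
            mpow P m i x * P x y * mpow P (n - Suc m) y j)"
  using assms
proof (induction n arbitrary: j)
  case 0
  then have "i \<noteq> j" by auto
  then show ?case by simp
next
  case (Suc n)
  let ?C = "{x. comm P i x}" and ?N = "{y. \<not> comm P i y}"
  define F where "F = (\<lambda>n j. \<Sum>m<n. \<Sum>x\<in>?C. \<Sum>y\<in>?N. mpow P m i x * P x y * mpow P (n - Suc m) y j)"
  \<comment> \<open>A class cannot be re-entered, which is why the sum vanishes when the end point
    lies in the class.\<close>
  have ret: "P x y * mpow P t y k = 0" if "x \<in> ?C" "y \<in> ?N" "k \<in> ?C" for x y t k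
  proof (rule ccontr)
    assume "P x y * mpow P t y k \<noteq> 0"
    then have "mpow P 1 x y > 0" "mpow P t y k > 0" using P_nonneg[of x y] mpow_pos_iff[of t y k] by auto
    then have "reach P x y" "reach P y k" by (auto intro: reachI reach_edge)
    then show False using that by (auto simp: comm_def intro: reach_trans)
  qed
  have F0: "F n k = 0" if "k \<in> ?C" for k
    unfolding F_def by (intro sum.neutral ballI) (use ret that in \<open>auto simp: mult.assoc\<close>)
  have "F (Suc n) j = (\<Sum>x\<in>?C. \<Sum>y\<in>?N. mpow P n i x * P x y * (if y = j then 1 else 0))
       + (\<Sum>m<n. \<Sum>x\<in>?C. \<Sum>y\<in>?N. mpow P m i x * P x y * mpow P (Suc (n - Suc m)) y j)"
    unfolding F_def by (simp add: Suc_diff_Suc)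
  also have "(\<Sum>x\<in>?C. \<Sum>y\<in>?N. mpow P n i x * P x y * (if y = j then 1 else 0)) = (\<Sum>x\<in>?C. mpow P n i x * P x j)"
    using Suc.prems by (simp add: if_distrib[of "\<lambda>x. _ * x"] sum.delta cong: if_cong)
  also have "(\<Sum>m<n. \<Sum>x\<in>?C. \<Sum>y\<in>?N. mpow P m i x * P x y * mpow P (Suc (n - Suc m)) y j)
     = (\<Sum>k\<in>UNIV. F n k * P k j)"
  proof -
    have "(\<Sum>k\<in>UNIV. F n k * P k j) = (\<Sum>k\<in>UNIV. \<Sum>m<n. \<Sum>x\<in>?C. \<Sum>y\<in>?N.
              mpow P m i x * P x y * mpow P (n - Suc m) y k * P k j)"
      unfolding F_def by (simp add: sum_distrib_right)
    also have "\<dots> = (\<Sum>m<n. \<Sum>k\<in>UNIV. \<Sum>x\<in>?C. \<Sum>y\<in>?N. mpow P m i x * P x y * mpow P (n - Suc m) y k * P k j)"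
      by (rule sum.swap)
    also have "\<dots> = (\<Sum>m<n. \<Sum>x\<in>?C. \<Sum>k\<in>UNIV. \<Sum>y\<in>?N. mpow P m i x * P x y * mpow P (n - Suc m) y k * P k j)"
      by (rule sum.cong[OF refl], rule sum.swap)
    also have "\<dots> = (\<Sum>m<n. \<Sum>x\<in>?C. \<Sum>y\<in>?N. \<Sum>k\<in>UNIV. mpow P m i x * P x y * mpow P (n - Suc m) y k * P k j)"
      by (rule sum.cong[OF refl], rule sum.cong[OF refl], rule sum.swap)
    finally show ?thesis by (simp add: sum_distrib_left mult.assoc mpow.simps(2))
  qed
  also have "(\<Sum>k\<in>UNIV. F n k * P k j) = (\<Sum>k\<in>?N. F n k * P k j)"
    using F0 by (intro sum.mono_neutral_right) auto
  also have "\<dots> = (\<Sum>k\<in>?N. mpow P n i k * P k j)"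
    using Suc.IH by (intro sum.cong) (auto simp: F_def)
  also have "(\<Sum>x\<in>?C. mpow P n i x * P x j) + (\<Sum>k\<in>?N. mpow P n i k * P k j) = mpow P (Suc n) i j"
  proof -
    have "UNIV = ?C \<union> ?N" by auto
    then show ?thesis by (simp add: mpow.simps(2) sum.union_disjoint[symmetric] disjoint_iff)
  qed
  finally show ?case by (simp add: F_def)
qed

text \<open>Inside a class both powers are comparable to the n-th power of the rate, by
  \<open>class_upper\<close> and \<open>class_lower\<close>. A path that leaves the class factors at
  its exit, and the remainder starts at a state that reaches fewer states; hence the
  induction.\<close>

lemma mpow_comparison:
  assumes P: "stochastic P" and Q: "stochastic Q" and iso: "\<And>i j. P i j > 0 \<longleftrightarrow> Q i j > 0"
    and rate: "\<And>i. rate P i = rate Q i"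
  shows "\<exists>C\<ge>1. \<forall>n i j. mpow P n i j \<le> C * mpow Q n i j"
proof -
  interpret p: stoch P by (rule stoch_I) fact
  interpret q: stoch Q by (rule stoch_I) fact
  note pos = supp_pow_eq[OF P Q iso]
  have reach: "reach P = reach Q" by (auto simp: reach_def pos fun_eq_iff)
  have comm: "comm P = comm Q" by (auto simp: comm_def reach fun_eq_iff)
  obtain C1 where C1: "C1 \<ge> 1" "\<And>n x y. comm P x y \<Longrightarrow> mpow P n x y \<le> C1 * rate P x ^ n"
    using p.class_upper by blast
  obtain c2 where c2: "c2 > 0" "\<And>n x y. comm P x y \<Longrightarrow> mpow Q n x y > 0 \<Longrightarrow> c2 * rate P x ^ n \<le> mpow Q n x y"
    using q.class_lower unfolding rate comm by blast
  define C0 where "C0 = C1 / c2"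
  have C0: "C0 > 0" using C1 c2 by (simp add: C0_def)
  have cls: "mpow P n x y \<le> C0 * mpow Q n x y" if "comm P x y" for n x y
  proof (cases "mpow Q n x y > 0")
    case True
    have "mpow P n x y \<le> C1 * rate P x ^ n" using C1 that by blast
    also have "\<dots> = C0 * (c2 * rate P x ^ n)" using c2 by (simp add: C0_def)
    also have "\<dots> \<le> C0 * mpow Q n x y" using c2(2)[OF that True] C0 by simp
    finally show ?thesis .
  next
    case False
    then show ?thesis using pos[of n x y] p.mpow_nonneg[of n x y] q.mpow_nonneg[of n x y] by simp
  qed
  have "\<exists>C1\<ge>1. \<forall>xy::'a\<times>'a. P (fst xy) (snd xy) \<le> C1 * Q (fst xy) (snd xy)"
  proof (rule finite_uniform_bound)
    fix xy :: "'a \<times> 'a"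
    show "\<exists>K. P (fst xy) (snd xy) \<le> K * Q (fst xy) (snd xy)"
    proof (cases "Q (fst xy) (snd xy) > 0")
      case True
      then show ?thesis by (intro exI[of _ "P (fst xy) (snd xy) / Q (fst xy) (snd xy)"]) simp
    next
      case False
      then have "\<not> P (fst xy) (snd xy) > 0" using iso by blast
      then show ?thesis by (intro exI[of _ 0]) simp
    qed
  qed (meson mult_right_mono order_trans q.P_nonneg)
  \<comment> \<open>This \<open>C1\<close> replaces the earlier one: it compares single
    edges.\<close>
  then obtain C1 where C1: "C1 \<ge> 1" "\<And>x y. P x y \<le> C1 * Q x y" by auto
  have ex: "\<exists>C\<ge>1. \<forall>n j. mpow P n i j \<le> C * mpow Q n i j" for i
  proof (induction "card {w. reach P i w}" arbitrary: i rule: less_induct)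
    case less
    have "\<exists>K\<ge>1. \<forall>y. \<forall>n j. reach P i y \<longrightarrow> \<not> comm P i y \<longrightarrow> mpow P n y j \<le> K * mpow Q n y j"
    proof (rule finite_uniform_bound)
      fix y
      show "\<exists>K. \<forall>n j. reach P i y \<longrightarrow> \<not> comm P i y \<longrightarrow> mpow P n y j \<le> K * mpow Q n y j"
      proof (cases "reach P i y \<and> \<not> comm P i y")
        case True
        then have "{w. reach P y w} \<subset> {w. reach P i w}"
          using p.reach_trans by (auto simp: comm_def)
        then have "card {w. reach P y w} < card {w. reach P i w}" by (simp add: psubset_card_mono)
        from less[OF this] show ?thesis by blast
      qed auto
    qed (meson mult_right_mono order_trans q.mpow_nonneg)
    then obtain K where K: "K \<ge> 1" "\<And>y n j. reach P i y \<Longrightarrow> \<not> comm P i y \<Longrightarrow> mpow P n y j \<le> K * mpow Q n y j"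
      by blast
    \<comment> \<open>One factor for the part inside the class, one for the exit edge, one for the
      remainder.\<close>
    have out: "mpow P n i j \<le> (C0 * C1 * K) * mpow Q n i j" if "\<not> comm P i j" for n j
    proof -
      have "mpow P m i x * P x y * mpow P t y j \<le> (C0 * C1 * K) * (mpow Q m i x * Q x y * mpow Q t y j)"
        if "comm P i x" "\<not> comm P i y" for m x y t
      proof (cases "P x y = 0")
        case False
        then have "mpow P 1 x y > 0" using p.P_nonneg[of x y] by simp
        then have "reach P i y" using that(1) p.reachI p.reach_trans unfolding comm_def by blast
        then have "mpow P m i x * P x y * mpow P t y j \<le> (C0 * mpow Q m i x) * (C1 * Q x y) * (K * mpow Q t y j)"
          using K(2)[OF _ that(2)] cls[OF that(1)] C0 C1 p.mpow_nonneg p.P_nonneg q.mpow_nonneg q.P_nonneg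
          by (intro mult_mono) auto
        then show ?thesis by (simp add: algebra_simps)
      qed (use C0 C1(1) K(1) q.mpow_nonneg q.P_nonneg in \<open>auto intro!: mult_nonneg_nonneg\<close>)
      then show ?thesis
        unfolding p.exit_decomposition[OF that] q.exit_decomposition[OF that[unfolded comm]] comm sum_distrib_left
        by (intro sum_mono) auto
    qed
    define C where "C = max 1 (max C0 (C0 * C1 * K))"
    have "mpow P n i j \<le> C * mpow Q n i j" for n j
    proof -
      have "mpow P n i j \<le> C0 * mpow Q n i j \<or> mpow P n i j \<le> (C0 * C1 * K) * mpow Q n i j"
        using cls out by blast
      moreover have "C0 * mpow Q n i j \<le> C * mpow Q n i j" "(C0 * C1 * K) * mpow Q n i j \<le> C * mpow Q n i j"
        using q.mpow_nonneg by (auto intro!: mult_right_mono simp: C_def)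
      ultimately show ?thesis by linarith
    qed
    then show ?case by (intro exI[of _ C]) (auto simp: C_def)
  qed
  have "\<exists>C\<ge>1. \<forall>i. \<forall>n j. mpow P n i j \<le> C * mpow Q n i j"
    by (rule finite_uniform_bound) (use ex in \<open>blast, meson mult_right_mono order_trans q.mpow_nonneg\<close>)
  then show ?thesis by blast
qed

section \<open>Algebras of matrices of power series\<close>

unbundle no vec_syntax

type_synonym 'a fpsmat = "'a \<Rightarrow> 'a \<Rightarrow> complex fps"

definition mm :: "('a::finite) fpsmat \<Rightarrow> 'a fpsmat \<Rightarrow> 'a fpsmat" where
  "mm X Y = (\<lambda>i j. \<Sum>k\<in>UNIV. X i k * Y k j)"

definition un :: "'a \<Rightarrow> 'a \<Rightarrow> complex fps \<Rightarrow> 'a fpsmat" where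
  "un i j f = (\<lambda>a b. if a = i \<and> b = j then f else 0)"

definition madd :: "('a::finite) fpsmat \<Rightarrow> 'a fpsmat \<Rightarrow> 'a fpsmat" where
  "madd X Y = (\<lambda>i j. X i j + Y i j)"

definition mscale :: "complex \<Rightarrow> ('a::finite) fpsmat \<Rightarrow> 'a fpsmat" where
  "mscale c X = (\<lambda>i j. fps_const c * X i j)"

definition mtrace :: "('a::finite) fpsmat \<Rightarrow> complex fps" where
  "mtrace X = (\<Sum>k\<in>UNIV. X k k)"

definition ordge :: "nat \<Rightarrow> 'a fpsmat \<Rightarrow> bool" where
  "ordge n X \<longleftrightarrow> (\<forall>i j. \<forall>m<n. X i j $ m = 0)"

lemma mm_assoc: "mm (mm X Y) Z = mm X (mm Y Z)"
proof (intro ext)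
  fix i j
  have "mm (mm X Y) Z i j = (\<Sum>k\<in>UNIV. \<Sum>l\<in>UNIV. X i l * (Y l k * Z k j))"
    by (simp add: mm_def sum_distrib_right mult.assoc)
  also have "\<dots> = (\<Sum>l\<in>UNIV. \<Sum>k\<in>UNIV. X i l * (Y l k * Z k j))" by (rule sum.swap)
  finally show "mm (mm X Y) Z i j = mm X (mm Y Z) i j" by (simp add: mm_def sum_distrib_left)
qed

lemma mm_madd_left: "mm (madd X Y) Z = madd (mm X Z) (mm Y Z)"
  by (simp add: mm_def madd_def fun_eq_iff distrib_right sum.distrib)

lemma mm_mscale_left: "mm (mscale c X) Y = mscale c (mm X Y)"
  by (simp add: mm_def mscale_def fun_eq_iff sum_distrib_left mult.assoc)

lemma mtrace_madd: "mtrace (madd X Y) = mtrace X + mtrace Y"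
  by (simp add: mtrace_def madd_def sum.distrib)

lemma mtrace_mscale: "mtrace (mscale c X) = fps_const c * mtrace X"
  by (simp add: mtrace_def mscale_def sum_distrib_left)

lemma mm_un_left: "mm (un i j f) X = (\<lambda>a b. if a = i then f * X j b else 0)"
proof (intro ext)
  fix a b
  have "mm (un i j f) X a b = (\<Sum>k\<in>UNIV. if k = j then (if a = i then f * X j b else 0) else 0)"
    unfolding mm_def un_def by (rule sum.cong) auto
  then show "mm (un i j f) X a b = (if a = i then f * X j b else 0)" by simp
qed

lemma mm_un_right: "mm X (un i j f) = (\<lambda>a b. if b = j then X a i * f else 0)"
proof (intro ext)
  fix a b
  have "mm X (un i j f) a b = (\<Sum>k\<in>UNIV. if k = i then (if b = j then X a i * f else 0) else 0)"
    unfolding mm_def un_def by (rule sum.cong) auto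
  then show "mm X (un i j f) a b = (if b = j then X a i * f else 0)" by simp
qed

lemma mm_un_un: "mm (un i j f) (un k l g) = (if j = k then un i l (f * g) else (\<lambda>_ _. 0))"
  unfolding mm_un_left by (auto simp: un_def fun_eq_iff)

lemma mm_un_both: "mm (un i k f) (mm X (un l j g)) = un i j (f * X k l * g)"
  unfolding mm_un_left mm_un_right by (auto simp: un_def fun_eq_iff)

lemma mm_zero [simp]: "mm (\<lambda>_ _. 0) X = (\<lambda>_ _. 0)" "mm X (\<lambda>_ _. 0) = (\<lambda>_ _. 0)"
  by (auto simp: mm_def)

lemma un_same [simp]: "un i j f i j = f"
  by (simp add: un_def)

lemma madd_un: "madd (un i j f) (un i j g) = un i j (f + g)"
  by (auto simp: madd_def un_def fun_eq_iff)

lemma mscale_un: "mscale c (un i j f) = un i j (fps_const c * f)"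
  by (auto simp: mscale_def un_def fun_eq_iff)

lemma fps_mult_low:
  fixes f g :: "complex fps"
  assumes "\<And>m. m < a \<Longrightarrow> f $ m = 0" "\<And>m. m < b \<Longrightarrow> g $ m = 0"
  shows "n < a + b \<Longrightarrow> (f * g) $ n = 0" and "(f * g) $ (a + b) = f $ a * g $ b"
proof -
  show "(f * g) $ n = 0" if "n < a + b"
    unfolding fps_mult_nth
  proof (rule sum.neutral, rule ballI)
    fix i assume "i \<in> {0..n}"
    then have "i < a \<or> n - i < b" using that by auto
    then show "f $ i * g $ (n - i) = 0" using assms by auto
  qed
  have "(f * g) $ (a + b) = (\<Sum>i\<in>{a}. f $ i * g $ (a + b - i))"
    unfolding fps_mult_nth
  proof (rule sum.mono_neutral_right)
    show "\<forall>i\<in>{0..a + b} - {a}. f $ i * g $ (a + b - i) = 0"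
    proof
      fix i assume "i \<in> {0..a + b} - {a}"
      then have "i < a \<or> a + b - i < b" by auto
      then show "f $ i * g $ (a + b - i) = 0" using assms by auto
    qed
  qed auto
  then show "(f * g) $ (a + b) = f $ a * g $ b" by simp
qed

lemma ordge_mm: assumes "ordge a X" "ordge b Y"
  shows "ordge (a + b) (mm X Y)"
    and "mm X Y i j $ (a + b) = (\<Sum>k\<in>UNIV. X i k $ a * Y k j $ b)"
  using assms fps_mult_low[of a "X _ _" b "Y _ _"]
  by (auto simp: ordge_def mm_def fps_sum_nth)

lemma ordge_madd: "ordge n X \<Longrightarrow> ordge n Y \<Longrightarrow> ordge n (madd X Y)"
  by (auto simp: ordge_def madd_def)

lemma ordge_mscale: "ordge n X \<Longrightarrow> ordge n (mscale c X)"
  by (auto simp: ordge_def mscale_def)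

lemma ordge_mono: "ordge n X \<Longrightarrow> m \<le> n \<Longrightarrow> ordge m X"
  by (auto simp: ordge_def)

lemma ordge_0 [simp]: "ordge 0 X" "ordge n (\<lambda>_ _. 0)"
  by (auto simp: ordge_def)

lemma ordge_all_zero: "(\<And>n. ordge n X) \<Longrightarrow> X = (\<lambda>_ _. 0)"
  by (auto simp: ordge_def fun_eq_iff fps_eq_iff)

lemma ordge_un: "ordge n (un i j f) \<longleftrightarrow> (\<forall>m<n. f $ m = 0)"
  by (auto simp: ordge_def un_def)

text \<open>The properties of the image of \<open>\<T>\<^sub>+(P)\<close> under \<open>T \<mapsto> \<Sum>\<^sub>n \<surd>P\<^sup>n * T\<^sub>n z\<^sup>n\<close> from which
  the matrix can be recovered.  The last one is division by a power of \<open>z\<close> (combined with a change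
  of row) in recurrent columns.\<close>

locale series_alg = stoch P for P :: "'a::finite \<Rightarrow> 'a \<Rightarrow> real" +
  fixes M :: "'a fpsmat set"
  assumes M_growth: "X \<in> M \<Longrightarrow> \<exists>K. \<forall>i j n. cmod (X i j $ n) \<le> K * sqrt (mpow P n i j)"
    and M_madd: "X \<in> M \<Longrightarrow> Y \<in> M \<Longrightarrow> madd X Y \<in> M"
    and M_mscale: "X \<in> M \<Longrightarrow> mscale c X \<in> M"
    and M_mm: "X \<in> M \<Longrightarrow> Y \<in> M \<Longrightarrow> mm X Y \<in> M"
    and M_series: "(\<And>n. f $ n \<noteq> 0 \<Longrightarrow> mpow P n i j > 0) \<Longrightarrow>
        summable (\<lambda>n. cmod (f $ n) / sqrt (mpow P n i j)) \<Longrightarrow> un i j f \<in> M"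
    and M_div: "un i l (fps_X ^ K * G) \<in> M \<Longrightarrow> recurrent P l \<Longrightarrow> (\<And>n. G $ n \<noteq> 0 \<Longrightarrow> mpow P n k l > 0) \<Longrightarrow>
        finite {n. mpow P (n + K) i l > 0 \<and> mpow P n k l = 0} \<Longrightarrow> un k l G \<in> M"
begin

lemma M_supp: "X \<in> M \<Longrightarrow> X i j $ n \<noteq> 0 \<Longrightarrow> mpow P n i j > 0"
  using M_growth[of X] mpow_nonneg[of n i j]
  by (metis less_eq_real_def mult_zero_right norm_le_zero_iff real_sqrt_zero)

lemma M_supp0: "X \<in> M \<Longrightarrow> i \<noteq> j \<Longrightarrow> X i j $ 0 = 0"
  using M_supp[of X i j 0] by auto

lemma M_reach: "X \<in> M \<Longrightarrow> X i j \<noteq> 0 \<Longrightarrow> reach P i j"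
  using M_supp[of X i j] by (metis fps_nonzero_nth reachI)

lemma M_poly: assumes "finite {n. f $ n \<noteq> 0}" "\<And>n. f $ n \<noteq> 0 \<Longrightarrow> mpow P n i j > 0"
  shows "un i j f \<in> M"
  by (rule M_series[OF assms(2)], assumption, rule summable_finite[OF assms(1)]) auto

lemma M_monom: "mpow P n i j > 0 \<Longrightarrow> un i j (fps_X ^ n) \<in> M"
  by (rule M_poly) (auto simp: fps_X_power_nth split: if_splits)

lemma M_unit: "un i i 1 \<in> M"
  using M_monom[of 0 i i] by simp

lemma M_edge: "P i j > 0 \<Longrightarrow> un i j fps_X \<in> M"
  using M_monom[of "Suc 0" i j] by simp

lemma M_corner: "X \<in> M \<Longrightarrow> un i j (X i j) \<in> M"
  using M_mm[OF M_unit[of i] M_mm[OF _ M_unit[of j]], of X] by (simp add: mm_un_both)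

lemma M_zero: "(\<lambda>_ _. 0) \<in> M"
  using M_mscale[OF M_unit[of undefined], of 0] by (simp add: mscale_def)

lemma M_sum: "finite I \<Longrightarrow> (\<And>x. x \<in> I \<Longrightarrow> F x \<in> M) \<Longrightarrow> (\<lambda>a b. \<Sum>x\<in>I. F x a b) \<in> M"
proof (induction I rule: finite_induct)
  case (insert x I)
  then have "madd (F x) (\<lambda>a b. \<Sum>x\<in>I. F x a b) \<in> M" by (intro M_madd) auto
  then show ?case using insert by (simp add: madd_def)
qed (simp add: M_zero)

lemma M_cutoff: "un i j h \<in> M \<Longrightarrow> un i j (fps_cutoff n h) \<in> M"
  using M_supp[of "un i j h" i j]
  by (intro M_poly) (auto simp: fps_cutoff_def intro: finite_subset[of _ "{..<n}"] split: if_splits)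

end

lemma power_dominated:
  assumes "c > (0::real)" "0 \<le> v" "0 \<le> u" "\<And>k. c * u ^ k \<le> v ^ k" shows "u \<le> v"
proof (rule ccontr)
  assume "\<not> u \<le> v"
  then have uv: "v < u" "u > 0" using assms by auto
  have "(\<lambda>k. (v / u) ^ k) \<longlonglongrightarrow> 0" using uv assms by (intro LIMSEQ_realpow_zero) auto
  moreover have "c \<le> (v / u) ^ k" for k
    using assms(4)[of k] uv by (simp add: power_divide field_simps)
  ultimately have "c \<le> 0" by (intro LIMSEQ_le_const[where X="\<lambda>k. (v / u) ^ k"]) auto
  then show False using assms by simp
qed

text \<open>Loops at y, joined to x by fixed paths, are loops at x; the fixed factor disappears in
  the k-th root (\<open>power_dominated\<close>).\<close>

lemma (in stoch) rate_comm_le: assumes "comm P x y" shows "rate P y \<le> rate P x"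
proof (rule ccontr)
  assume "\<not> rate P y \<le> rate P x"
  then obtain n where n: "n \<ge> 1" "rate P x ^ n < mpow P n y y"
    using rate_attained[of "rate P x" y] rate_nonneg[of x] by auto
  obtain s t where st: "mpow P s x y > 0" "mpow P t y x > 0" using assms by (auto simp: comm_def reach_def)
  have "mpow P s x y * mpow P t y x * mpow P n y y ^ k \<le> (rate P x ^ n) ^ k" for k
  proof (cases "k = 0")
    case True
    then show ?thesis using mult_le_one[OF mpow_le_1[of s x y] mpow_nonneg mpow_le_1[of t y x]] by simp
  next
    case False
    have "mpow P s x y * mpow P t y x * mpow P n y y ^ k \<le> mpow P s x y * mpow P t y x * mpow P (k * n) y y"
      using mpow_power_le mpow_nonneg by (intro mult_left_mono) auto
    also have "\<dots> = mpow P s x y * (mpow P (k * n) y y * mpow P t y x)" by simp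
    also have "\<dots> \<le> mpow P s x y * mpow P (k * n + t) y x"
      using mpow_add_ge mpow_nonneg by (intro mult_left_mono) auto
    also have "\<dots> \<le> mpow P (s + (k * n + t)) x x" by (rule mpow_add_ge)
    also have "\<dots> \<le> rate P x ^ (s + (k * n + t))" using n False by (intro mpow_le_rate) (auto simp: Suc_le_eq)
    also have "\<dots> \<le> rate P x ^ (k * n)" by (rule power_decreasing) (auto simp: rate_nonneg rate_le_1)
    finally show ?thesis by (metis power_mult mult.commute)
  qed
  then have "mpow P n y y \<le> rate P x ^ n"
    by (rule power_dominated[rotated 3]) (use st in \<open>auto simp: mpow_nonneg rate_nonneg\<close>)
  then show False using n by simp
qed

lemma (in stoch) rate_comm: "comm P x y \<Longrightarrow> rate P x = rate P y"
  by (meson antisym comm_sym rate_comm_le)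

section \<open>Images of the diagonal units and their corners\<close>

locale series_iso = p: series_alg P M + q: series_alg Q N
  for P :: "'a::finite \<Rightarrow> 'a \<Rightarrow> real" and M and Q :: "'a \<Rightarrow> 'a \<Rightarrow> real" and N +
  fixes \<psi> :: "'a fpsmat \<Rightarrow> 'a fpsmat"
  assumes bij: "bij_betw \<psi> M N"
    and \<psi>_madd: "X \<in> M \<Longrightarrow> Y \<in> M \<Longrightarrow> \<psi> (madd X Y) = madd (\<psi> X) (\<psi> Y)"
    and \<psi>_mscale: "X \<in> M \<Longrightarrow> \<psi> (mscale c X) = mscale c (\<psi> X)"
    and \<psi>_mm: "X \<in> M \<Longrightarrow> Y \<in> M \<Longrightarrow> \<psi> (mm X Y) = mm (\<psi> X) (\<psi> Y)"
begin

lemma \<psi>_in: "X \<in> M \<Longrightarrow> \<psi> X \<in> N"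
  using bij by (rule bij_betwE[rule_format])

lemma \<psi>_inj: "X \<in> M \<Longrightarrow> Y \<in> M \<Longrightarrow> \<psi> X = \<psi> Y \<longleftrightarrow> X = Y"
  using bij by (auto simp: bij_betw_def inj_on_eq_iff)

lemma \<psi>_surj: "Y \<in> N \<Longrightarrow> \<exists>X\<in>M. \<psi> X = Y"
  using bij by (auto simp: bij_betw_def)

text \<open>Makes every result of this locale available for the inverse, wherever an estimate or an
  inclusion is proved in one direction only.\<close>

lemma inverse_iso: "series_iso Q N P M (inv_into M \<psi>)"
proof -
  let ?i = "inv_into M \<psi>"
  have i: "?i Y \<in> M" "\<psi> (?i Y) = Y" if "Y \<in> N" for Y
    using that bij by (auto simp: bij_betw_def inv_into_into f_inv_into_f)
  have eq: "?i Y = X" if "X \<in> M" "\<psi> X = Y" for X Y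
    using that bij by (auto simp: bij_betw_def)
  show ?thesis
  proof unfold_locales
    show "bij_betw ?i N M" by (rule bij_betw_inv_into[OF bij])
  qed (auto intro!: eq p.M_madd p.M_mscale p.M_mm simp: \<psi>_madd \<psi>_mscale \<psi>_mm i)
qed

lemma \<psi>_zero: "\<psi> (\<lambda>_ _. 0) = (\<lambda>_ _. 0)"
proof -
  have "\<psi> (mscale 0 (\<lambda>_ _. 0)) = mscale 0 (\<psi> (\<lambda>_ _. 0))" by (rule \<psi>_mscale[OF p.M_zero])
  then show ?thesis by (simp add: mscale_def)
qed

lemma \<psi>_eq_zero: "X \<in> M \<Longrightarrow> \<psi> X = (\<lambda>_ _. 0) \<longleftrightarrow> X = (\<lambda>_ _. 0)"
  using \<psi>_inj[OF _ p.M_zero] \<psi>_zero by simp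

lemma \<psi>_sum: "finite I \<Longrightarrow> (\<And>x. x \<in> I \<Longrightarrow> F x \<in> M) \<Longrightarrow>
   \<psi> (\<lambda>a b. \<Sum>x\<in>I. F x a b) = (\<lambda>a b. \<Sum>x\<in>I. \<psi> (F x) a b)"
proof (induction I rule: finite_induct)
  case (insert x I)
  have "\<psi> (madd (F x) (\<lambda>a b. \<Sum>x\<in>I. F x a b)) = madd (\<psi> (F x)) (\<psi> (\<lambda>a b. \<Sum>x\<in>I. F x a b))"
    using insert by (intro \<psi>_madd p.M_sum) auto
  then show ?case using insert by (simp add: madd_def)
qed (simp add: \<psi>_zero)

definition e :: "'a \<Rightarrow> 'a fpsmat" where "e i = \<psi> (un i i 1)"

lemma e_in: "e i \<in> N"
  by (simp add: e_def \<psi>_in p.M_unit)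

lemma e_mult: "mm (e i) (e j) = (if i = j then e i else (\<lambda>_ _. 0))"
  unfolding e_def by (simp add: \<psi>_mm[symmetric] p.M_unit mm_un_un \<psi>_zero)

text \<open>Since the zeroth power of Q is the identity, constant terms are diagonal, and those of
  the \<open>e i\<close> are orthogonal idempotents. None is zero, because an idempotent of positive
  order has infinite order. There are as many of them as states, which leaves one state for
  each.\<close>

lemma e_const_exists: "\<exists>s. bij s \<and> (\<forall>i a b. e i a b $ 0 = (if a = s i \<and> b = s i then 1 else 0))"
proof -
  have off: "e i a b $ 0 = 0" if "a \<noteq> b" for i a b using q.M_supp0[OF e_in that] .
  have prod: "e i k k $ 0 * e j k k $ 0 = (if i = j then e i k k $ 0 else 0)" for i j k
  proof -
    have "mm (e i) (e j) k k $ (0 + 0) = (\<Sum>l\<in>UNIV. e i k l $ 0 * e j l k $ 0)"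
      by (rule ordge_mm) auto
    also have "\<dots> = (\<Sum>l\<in>UNIV. if l = k then e i k k $ 0 * e j k k $ 0 else 0)"
      by (rule sum.cong) (auto simp: off)
    finally have "e i k k $ 0 * e j k k $ 0 = mm (e i) (e j) k k $ 0" by simp
    then show ?thesis by (simp add: e_mult)
  qed
  have ex: "\<exists>k. e i k k $ 0 = 1" for i
  proof (rule ccontr)
    assume no: "\<nexists>k. e i k k $ 0 = 1"
    have "e i k k $ 0 = 0" for k using prod[of i k i] no by auto
    then have 1: "ordge 1 (e i)" using off by (force simp: ordge_def)
    have "ordge n (e i)" for n
    proof (induction n)
      case (Suc n)
      have "ordge (1 + n) (mm (e i) (e i))" by (rule ordge_mm[OF 1 Suc])
      then show ?case by (simp add: e_mult)
    qed simp
    then have "e i = (\<lambda>_ _. 0)" by (rule ordge_all_zero)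
    then have "un i i 1 = (\<lambda>_ _. 0)" unfolding e_def by (simp add: \<psi>_eq_zero p.M_unit)
    then show False by (metis un_same zero_neq_one)
  qed
  then obtain s where s: "\<And>i. e i (s i) (s i) $ 0 = 1" by metis
  have "inj s"
  proof (rule injI)
    fix i j assume "s i = s j"
    then show "i = j" using prod[of i "s i" j] s[of i] s[of j] by (auto split: if_splits)
  qed
  then have bij: "bij s" by (simp add: bij_def finite_UNIV_inj_surj)
  have "e i a b $ 0 = (if a = s i \<and> b = s i then 1 else 0)" for i a b
  proof (cases "a = b")
    case True
    obtain j where j: "a = s j" using bij by (metis bij_pointE)
    show ?thesis
    proof (cases "i = j")
      case False
      then have "a \<noteq> s i" using j \<open>inj s\<close> by (auto simp: inj_eq)
      moreover have "e i a a $ 0 = 0" using prod[of i a j] s[of j] j False by simp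
      ultimately show ?thesis using True by simp
    qed (use s j True in auto)
  qed (auto simp: off)
  then show ?thesis using bij by blast
qed

definition sg :: "'a \<Rightarrow> 'a" where
  "sg = (SOME s. bij s \<and> (\<forall>i a b. e i a b $ 0 = (if a = s i \<and> b = s i then 1 else 0)))"

lemma bij_sg: "bij sg" and e_const: "e i a b $ 0 = (if a = sg i \<and> b = sg i then 1 else 0)"
  using someI_ex[OF e_const_exists] unfolding sg_def[symmetric] by blast+

lemma sg_eq_iff [simp]: "sg i = sg j \<longleftrightarrow> i = j"
  using bij_sg by (auto simp: bij_def inj_eq)

text \<open>Only the constant term of \<open>e i\<close> is a matrix unit, so an element of this
  corner may have nonzero entries away from position (sg i, sg j).\<close>

definition incorner :: "'a \<Rightarrow> 'a \<Rightarrow> 'a fpsmat \<Rightarrow> bool" where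
  "incorner i j X \<longleftrightarrow> mm (e i) X = X \<and> mm X (e j) = X"

lemma incorner_\<psi>: "un i j f \<in> M \<Longrightarrow> incorner i j (\<psi> (un i j f))"
  unfolding incorner_def e_def by (simp add: \<psi>_mm[symmetric] p.M_unit mm_un_un)

lemma incorner_compress: "incorner i j (mm (e i) (mm Y (e j)))"
proof -
  have "mm (e i) (mm (e i) Z) = mm (e i) Z" "mm (mm Z (e j)) (e j) = mm Z (e j)" for Z
    using e_mult[of i i] e_mult[of j j] by (metis mm_assoc)+
  then show ?thesis unfolding incorner_def by (metis mm_assoc)
qed

text \<open>When X is multiplied by \<open>e i\<close> or \<open>e j\<close>, its lowest coefficient
  meets only their constant terms, which are matrix units.\<close>

lemma corner_lead: assumes "incorner i j X" "ordge a X" "X x y $ a \<noteq> 0" shows "x = sg i" "y = sg j"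
proof -
  have "X x y $ a = mm (e i) X x y $ (0 + a)" using assms(1) by (simp add: incorner_def)
  also have "\<dots> = (\<Sum>k\<in>UNIV. e i x k $ 0 * X k y $ a)" by (rule ordge_mm) (auto simp: assms)
  finally show "x = sg i" using assms(3) by (auto simp: e_const split: if_splits intro: ccontr)
  have "X x y $ a = mm X (e j) x y $ (a + 0)" using assms(1) by (simp add: incorner_def)
  also have "\<dots> = (\<Sum>k\<in>UNIV. X x k $ a * e j k y $ 0)" by (rule ordge_mm) (auto simp: assms)
  finally show "y = sg j" using assms(3) by (auto simp: e_const split: if_splits intro: ccontr)
qed

lemma corner_ord: assumes "incorner i j X" "\<And>m. m < n \<Longrightarrow> X (sg i) (sg j) $ m = 0" shows "ordge n X"
proof -
  have "ordge k X" if "k \<le> n" for k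
    using that
  proof (induction k)
    case (Suc k)
    then have o: "ordge k X" and k: "X (sg i) (sg j) $ k = 0" using assms(2) by auto
    have "X x y $ k = 0" for x y using corner_lead[OF assms(1) o, of x y] k by auto
    then show ?case using o by (auto simp: ordge_def less_Suc_eq)
  qed simp
  then show ?thesis by simp
qed

text \<open>The entry at (sg i, sg j) carries the order of a corner element, so it determines the
  whole element.\<close>

lemma corner_zero: "incorner i j X \<Longrightarrow> X (sg i) (sg j) = 0 \<Longrightarrow> X = (\<lambda>_ _. 0)"
  by (rule ordge_all_zero, rule corner_ord) auto

lemma corner_order_exists:
  assumes "incorner i j X" "X \<noteq> (\<lambda>_ _. 0)"
  obtains m where "ordge m X" "X (sg i) (sg j) $ m \<noteq> 0"
proof -
  have "X (sg i) (sg j) \<noteq> 0" using corner_zero assms by blast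
  then have ex: "\<exists>m. X (sg i) (sg j) $ m \<noteq> 0" by (auto simp: fps_eq_iff)
  define m where "m = (LEAST m. X (sg i) (sg j) $ m \<noteq> 0)"
  have "X (sg i) (sg j) $ m \<noteq> 0" unfolding m_def using ex by (rule LeastI_ex)
  moreover have "ordge m X" using assms(1)
    by (rule corner_ord) (use not_less_Least in \<open>auto simp: m_def\<close>)
  ultimately show ?thesis using that by blast
qed

text \<open>The lowest coefficients sit at a single position, so they multiply like scalars and
  orders add in corners.\<close>

lemma corner_lead_mm:
  assumes "incorner i j X" "ordge a X" "incorner j l Y" "ordge b Y"
  shows "mm X Y (sg i) (sg l) $ (a + b) = X (sg i) (sg j) $ a * Y (sg j) (sg l) $ b"
proof -
  have "mm X Y (sg i) (sg l) $ (a + b) = (\<Sum>k\<in>UNIV. X (sg i) k $ a * Y k (sg l) $ b)"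
    by (rule ordge_mm[OF assms(2,4)])
  also have "\<dots> = (\<Sum>k\<in>UNIV. if k = sg j then X (sg i) (sg j) $ a * Y (sg j) (sg l) $ b else 0)"
    by (rule sum.cong) (use corner_lead[OF assms(1,2)] in auto)
  finally show ?thesis by simp
qed

lemma e_diag_nz: "e i (sg i) (sg i) \<noteq> 0"
  using e_const[of i "sg i" "sg i"] by auto

text \<open>The difference of the two sides is again fixed by \<open>e i\<close> from left and
  right, and its entry at (sg i, sg i) vanishes, so \<open>corner_zero\<close> applies.\<close>

lemma corner_prop: assumes "incorner i i X"
  shows "e i (sg i) (sg i) * X a b = X (sg i) (sg i) * e i a b"
proof -
  define B where "B = (\<lambda>a b. e i (sg i) (sg i) * X a b - X (sg i) (sg i) * e i a b)"
  have "mm (e i) B a b = e i (sg i) (sg i) * mm (e i) X a b - X (sg i) (sg i) * mm (e i) (e i) a b" for a b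
    by (simp add: mm_def B_def sum_distrib_left right_diff_distrib sum_subtractf mult.left_commute)
  moreover have "mm B (e i) a b = e i (sg i) (sg i) * mm X (e i) a b - X (sg i) (sg i) * mm (e i) (e i) a b" for a b
    by (simp add: mm_def B_def sum_distrib_left left_diff_distrib sum_subtractf mult.assoc)
  ultimately have "incorner i i B" using assms unfolding incorner_def by (auto simp: fun_eq_iff e_mult B_def)
  moreover have "B (sg i) (sg i) = 0" by (simp add: B_def mult.commute)
  ultimately have "B = (\<lambda>_ _. 0)" by (rule corner_zero)
  then show ?thesis by (simp add: B_def fun_eq_iff)
qed

text \<open>Compressing the matrix unit at sg i by \<open>e i\<close> gives a column of
  \<open>e i\<close> times a row of it; by \<open>corner_prop\<close> this product is proportional
  to \<open>e i\<close>. So \<open>e i\<close> has rank one, from which its trace is found to be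
  1.\<close>

lemma e_rank_one: "e i a (sg i) * e i (sg i) b = e i (sg i) (sg i) * e i a b"
proof -
  define Y where "Y = mm (e i) (mm (un (sg i) (sg i) 1) (e i))"
  have Y: "Y a b = e i a (sg i) * e i (sg i) b" for a b
  proof -
    have "Y a b = (\<Sum>k\<in>UNIV. if k = sg i then e i a (sg i) * e i (sg i) b else 0)"
      unfolding Y_def mm_un_left unfolding mm_def by (rule sum.cong) auto
    then show ?thesis by simp
  qed
  have "incorner i i Y" unfolding Y_def by (rule incorner_compress)
  from corner_prop[OF this, of a b] show ?thesis unfolding Y using e_diag_nz[of i] by (simp add: mult.assoc)
qed

lemma mtrace_e: "mtrace (e i) = 1"
proof -
  have "e i (sg i) (sg i) * mtrace (e i) = (\<Sum>a\<in>UNIV. e i (sg i) a * e i a (sg i))"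
    unfolding mtrace_def sum_distrib_left
    by (rule sum.cong) (use e_rank_one[of i] in \<open>simp_all add: mult.commute\<close>)
  also have "\<dots> = mm (e i) (e i) (sg i) (sg i)" by (simp add: mm_def)
  finally show ?thesis using e_diag_nz[of i] by (simp add: e_mult)
qed

text \<open>Together with \<open>mtrace_mm\<close> this identifies the corner with an algebra of
  scalar power series.\<close>

lemma corner_mtrace: assumes "incorner i i X" shows "X a b = mtrace X * e i a b"
proof -
  have "e i (sg i) (sg i) * mtrace X = X (sg i) (sg i) * mtrace (e i)"
    by (simp add: mtrace_def sum_distrib_left corner_prop[OF assms])
  then have "e i (sg i) (sg i) * X a b = e i (sg i) (sg i) * (mtrace X * e i a b)"
    using corner_prop[OF assms, of a b] by (simp add: mtrace_e mult.assoc)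
  then show ?thesis using e_diag_nz[of i] by simp
qed

lemma mtrace_mm: assumes "incorner i i X" "incorner i i Y" shows "mtrace (mm X Y) = mtrace X * mtrace Y"
proof -
  have "mm X Y a b = mtrace X * mtrace Y * mm (e i) (e i) a b" for a b
    unfolding mm_def sum_distrib_left
    by (rule sum.cong) (simp_all add: corner_mtrace[OF assms(1), of a] corner_mtrace[OF assms(2), of _ b])
  then have "mtrace (mm X Y) = mtrace X * mtrace Y * mtrace (e i)"
    by (simp add: mtrace_def sum_distrib_left e_mult)
  then show ?thesis by (simp add: mtrace_e)
qed

text \<open>By rank one, a nonzero entry at (a, b) forces nonzero entries at (a, sg i) and (sg i,
  b).\<close>

lemma e_supp: "e i a b \<noteq> 0 \<Longrightarrow> reach Q a (sg i) \<and> reach Q (sg i) b"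
  using e_rank_one[of i a b] e_diag_nz[of i] q.M_reach[OF e_in]
  by (metis mult_eq_0_iff)

lemma corner_mtrace_0: "incorner i i X \<Longrightarrow> X (sg i) (sg i) $ 0 = mtrace X $ 0"
  using corner_mtrace[of i X "sg i" "sg i"] e_const[of i "sg i" "sg i"] by simp

text \<open>A nonzero diagonal entry of a corner element lies in the class of sg i, where all
  weights grow at the same rate.\<close>

lemma mtrace_growth: assumes "X \<in> N" "incorner i i X"
  shows "\<exists>K. \<forall>n. cmod (mtrace X $ n) \<le> K * sqrt (rate Q (sg i)) ^ n"
proof -
  obtain K where K: "\<And>a b n. cmod (X a b $ n) \<le> K * sqrt (mpow Q n a b)"
    using q.M_growth[OF assms(1)] by blast
  obtain C where C: "C \<ge> 1" "\<And>n x y. comm Q x y \<Longrightarrow> mpow Q n x y \<le> C * rate Q x ^ n"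
    using q.class_upper by blast
  have K0: "K \<ge> 0" using order_trans[OF norm_ge_zero K[of undefined undefined 0]] by simp
  have b: "cmod (X a a $ n) \<le> K * sqrt C * sqrt (rate Q (sg i)) ^ n" for a n
  proof (cases "X a a = 0")
    case False
    then have "e i a a \<noteq> 0" using corner_mtrace[OF assms(2), of a a] by auto
    then have "comm Q (sg i) a" using e_supp by (auto simp: comm_def)
    then have r: "rate Q a = rate Q (sg i)" by (rule q.rate_comm[symmetric])
    have "cmod (X a a $ n) \<le> K * sqrt (C * rate Q a ^ n)"
      by (rule order_trans[OF K mult_left_mono[OF _ K0]]) (simp add: C)
    then show ?thesis by (simp add: r real_sqrt_mult real_sqrt_power mult.assoc)
  qed (use K0 C q.rate_nonneg in auto)
  have "cmod (mtrace X $ n) \<le> (\<Sum>a\<in>(UNIV::'a set). K * sqrt C * sqrt (rate Q (sg i)) ^ n)" for n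
    unfolding mtrace_def fps_sum_nth by (rule sum_norm_le) (rule b)
  then show ?thesis by (intro exI[of _ "real (card (UNIV::'a set)) * (K * sqrt C)"]) (simp add: mult.assoc)
qed

end

lemma conv_radius_growth:
  fixes f :: "complex fps"
  assumes b: "\<And>n. cmod (f $ n) \<le> K * \<rho> ^ n" and "\<rho> \<ge> 0" "cmod z * \<rho> < 1"
  shows "ereal (cmod z) < fps_conv_radius f"
proof -
  obtain w :: real where w: "w > cmod z" "w * \<rho> < 1"
  proof (cases "\<rho> = 0")
    case False
    then have "cmod z < 1 / \<rho>" using assms by (simp add: field_simps)
    then obtain w where "cmod z < w" "w < 1 / \<rho>" using dense by blast
    then show ?thesis using that[of w] False assms by (simp add: field_simps)
  qed (use that[of "cmod z + 1"] in auto)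
  have w0: "w > 0" using w(1) norm_ge_zero[of z] by linarith
  have "ereal (cmod (complex_of_real w)) \<le> conv_radius (fps_nth f)"
  proof (rule conv_radius_geI, rule summable_comparison_test)
    show "\<exists>N. \<forall>n\<ge>N. norm (f $ n * complex_of_real w ^ n) \<le> K * (w * \<rho>) ^ n"
    proof (intro exI[of _ 0] allI impI)
      fix n
      have "norm (f $ n * complex_of_real w ^ n) = cmod (f $ n) * w ^ n"
        using w0 by (simp add: norm_mult norm_power)
      also have "\<dots> \<le> K * \<rho> ^ n * w ^ n" using b w0 by (intro mult_right_mono) auto
      finally show "norm (f $ n * complex_of_real w ^ n) \<le> K * (w * \<rho>) ^ n"
        by (simp add: power_mult_distrib mult_ac)
    qed
    show "summable (\<lambda>n. K * (w * \<rho>) ^ n)"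
      using w w0 assms(2) by (intro summable_mult summable_geometric) auto
  qed
  then show ?thesis using w(1) w0 unfolding fps_conv_radius_def
    using less_le_trans[of "ereal (cmod z)" "ereal w"] by simp
qed

section \<open>The scalar transform of a corner\<close>

context series_iso
begin

text \<open>Evaluating \<open>tz i f\<close> at a point of the disc where it converges is a
  character of the corner of M at i, the pull-back of a point evaluation.\<close>

definition tz :: "'a \<Rightarrow> complex fps \<Rightarrow> complex fps" where "tz i f = mtrace (\<psi> (un i i f))"

lemma tz_conv: assumes "un i i f \<in> M" "(cmod z)\<^sup>2 * rate Q (sg i) < 1"
  shows "ereal (cmod z) < fps_conv_radius (tz i f)"
proof -
  obtain K where "\<And>n. cmod (tz i f $ n) \<le> K * sqrt (rate Q (sg i)) ^ n"
    unfolding tz_def using mtrace_growth[OF \<psi>_in incorner_\<psi>] assms(1) by blast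
  moreover have "sqrt ((cmod z)\<^sup>2 * rate Q (sg i)) < sqrt 1" using assms(2) by (simp only: real_sqrt_less_iff)
  then have "cmod z * sqrt (rate Q (sg i)) < 1" by (simp add: real_sqrt_mult)
  ultimately show ?thesis by (intro conv_radius_growth) (auto simp: q.rate_nonneg)
qed

lemma tz_mult: "un i i f \<in> M \<Longrightarrow> un i i g \<in> M \<Longrightarrow> tz i (f * g) = tz i f * tz i g"
  unfolding tz_def using mtrace_mm[OF incorner_\<psi> incorner_\<psi>, of i f g]
  by (simp add: \<psi>_mm[symmetric] mm_un_un)

lemma tz_1: "tz i 1 = 1"
  using mtrace_e[of i] by (simp add: tz_def e_def)

lemma tz_add: "un i i f \<in> M \<Longrightarrow> un i i g \<in> M \<Longrightarrow> tz i (f + g) = tz i f + tz i g"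
  unfolding tz_def madd_un[symmetric] by (simp add: \<psi>_madd mtrace_madd)

lemma tz_scale: "un i i f \<in> M \<Longrightarrow> tz i (fps_const c * f) = fps_const c * tz i f"
  unfolding tz_def mscale_un[symmetric] by (simp add: \<psi>_mscale mtrace_mscale)

text \<open>For \<open>|c|\<close> larger than the spectral radius of \<open>z\<^sup>d\<close> in the corner at \<open>i\<close>, the resolvent
  \<open>(c - z\<^sup>d)\<^sup>-\<^sup>1\<close> belongs to the algebra, so the image of \<open>z\<^sup>d\<close> omits the value \<open>c\<close>.\<close>

lemma tz_bound:
  assumes d: "d \<ge> 1" "mpow P d i i > 0" and z: "(cmod z)\<^sup>2 * rate Q (sg i) < 1"
  shows "(cmod (eval_fps (tz i (fps_X ^ d)) z))\<^sup>2 * rate P i ^ d \<le> 1"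
proof (rule ccontr)
  assume neg: "\<not> ?thesis"
  define c where "c = eval_fps (tz i (fps_X ^ d)) z"
  have c: "(cmod c)\<^sup>2 * rate P i ^ d > 1" using neg by (simp add: c_def)
  then have c0: "c \<noteq> 0" by auto
  \<comment> \<open>The geometric series for 1 / (c - z^d), spelled out by the exponent m.\<close>
  define w where "w = Abs_fps (\<lambda>m. if d dvd m then inverse c ^ Suc (m div d) else 0)"
  have rec: "(fps_const c - fps_X ^ d) * w = 1"
  proof (rule fps_ext)
    fix m
    have 1: "((fps_const c - fps_X ^ d) * w) $ m = c * w $ m - (if m < d then 0 else w $ (m - d))"
      by (simp add: left_diff_distrib fps_X_power_mult_nth)
    show "((fps_const c - fps_X ^ d) * w) $ m = 1 $ m"
    proof (cases "m < d")
      case True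
      then have "d dvd m \<longleftrightarrow> m = 0" using d by (auto dest: dvd_imp_le)
      then show ?thesis unfolding 1 using True c0 by (auto simp: w_def)
    next
      case False
      then have "m div d = Suc ((m - d) div d)" using d by (metis le_div_geq less_eq_Suc_le One_nat_def not_less)
      moreover have "d dvd (m - d) \<longleftrightarrow> d dvd m" using False by (metis dvd_minus_self not_less)
      ultimately show ?thesis unfolding 1 using False c0 d by (auto simp: w_def)
    qed
  qed
  have r: "rate P i > 0" using d by (intro p.rate_cyclic) (auto simp: cyclic_def)
  obtain c1 where c1: "c1 > 0" "\<And>n x y. comm P x y \<Longrightarrow> mpow P n x y > 0 \<Longrightarrow> c1 * rate P x ^ n \<le> mpow P n x y"
    using p.class_lower by blast
  \<comment> \<open>The ratio of consecutive bounds for the weighted coefficients of w; it is below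
    1 by the assumption on c.\<close>
  define u where "u = 1 / (cmod c * sqrt (rate P i ^ d))"
  have "sqrt 1 < sqrt ((cmod c)\<^sup>2 * rate P i ^ d)" using c by (simp only: real_sqrt_less_iff)
  then have "1 < cmod c * sqrt (rate P i ^ d)" by (simp add: real_sqrt_mult)
  then have u: "0 < u" "u < 1" unfolding u_def by (auto simp: divide_less_eq)
  \<comment> \<open>The d-th root makes the bound geometric in the exponent m itself.\<close>
  define v where "v = root d u"
  have v: "0 < v" "v < 1" "v ^ d = u" using u d by (auto simp: v_def)
  have w_bound: "cmod (w $ m) / sqrt (mpow P m i i) \<le> (1 / (cmod c * sqrt c1)) * v ^ m" for m
  proof (cases "d dvd m")
    case True
    then obtain n where m: "m = n * d" by (metis dvdE mult.commute)
    have pos: "mpow P m i i > 0" unfolding m by (rule p.mpow_pos_mult[OF d(2)])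
    have "cmod (w $ m) = 1 / cmod c ^ Suc n"
      using d by (simp add: w_def m norm_mult norm_power norm_inverse divide_inverse power_inverse del: power_Suc)
    moreover have "sqrt c1 * sqrt (rate P i ^ d) ^ n \<le> sqrt (mpow P m i i)"
    proof -
      have "sqrt (c1 * rate P i ^ m) \<le> sqrt (mpow P m i i)" using c1(2)[OF p.comm_refl pos] by simp
      then show ?thesis by (simp add: m real_sqrt_mult real_sqrt_power mult.commute[of n] power_mult)
    qed
    moreover have "sqrt c1 * sqrt (rate P i ^ d) ^ n > 0" using c1(1) r by simp
    ultimately have "cmod (w $ m) / sqrt (mpow P m i i) \<le> (1 / cmod c ^ Suc n) / (sqrt c1 * sqrt (rate P i ^ d) ^ n)"
      using c0 pos by (simp only: divide_divide_eq_left) (intro divide_left_mono mult_left_mono mult_pos_pos, use c1(1) r in auto)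
    also have "\<dots> = (1 / (cmod c * sqrt c1)) * u ^ n"
      by (simp add: u_def power_divide power_mult_distrib)
    also have "u ^ n = v ^ m" by (simp add: m v(3)[symmetric] power_mult[symmetric] mult.commute)
    finally show ?thesis .
  next
    case False
    then show ?thesis using v c1(1) by (simp add: w_def)
  qed
  have w_supp: "mpow P n i i > 0" if "w $ n \<noteq> 0" for n
    using that p.mpow_pos_mult[OF d(2), of "n div d"] by (auto simp: w_def split: if_splits)
  have w_in: "un i i w \<in> M"
  proof (rule p.M_series[OF w_supp], assumption, rule summable_comparison_test)
    show "\<exists>N. \<forall>n\<ge>N. norm (cmod (w $ n) / sqrt (mpow P n i i)) \<le> (1 / (cmod c * sqrt c1)) * v ^ n"
      using w_bound p.mpow_nonneg by auto
    show "summable (\<lambda>n. (1 / (cmod c * sqrt c1)) * v ^ n)"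
      using v by (intro summable_mult summable_geometric) auto
  qed
  have Xd: "un i i (fps_X ^ d) \<in> M" by (rule p.M_monom[OF d(2)])
  have uc: "un i i (fps_const a) \<in> M" for a
    using p.M_mscale[OF p.M_unit[of i], of a] by (simp add: mscale_un)
  have tc: "tz i (fps_const a) = fps_const a" for a using tz_scale[OF p.M_unit, of i a] by (simp add: tz_1)
  have eq: "fps_const c - fps_X ^ d = fps_const c + fps_const (-1) * fps_X ^ d"
    by (simp add: fps_const_neg[symmetric] del: fps_const_neg)
  have nX: "un i i (fps_const (-1) * fps_X ^ d) \<in> M" using p.M_mscale[OF Xd, of "-1"] by (simp add: mscale_un)
  have cX: "un i i (fps_const c - fps_X ^ d) \<in> M"
    unfolding eq madd_un[symmetric] by (rule p.M_madd[OF uc nX])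
  have "tz i (fps_const c - fps_X ^ d) = fps_const c + fps_const (-1) * tz i (fps_X ^ d)"
    unfolding eq by (simp only: tz_add[OF uc nX] tz_scale[OF Xd] tc)
  then have t1: "(fps_const c + fps_const (-1) * tz i (fps_X ^ d)) * tz i w = 1"
    using tz_mult[OF cX w_in] rec tz_1 by simp
  have conv: "ereal (cmod z) < fps_conv_radius (tz i (fps_X ^ d))" "ereal (cmod z) < fps_conv_radius (tz i w)"
    using tz_conv[OF Xd z] tz_conv[OF w_in z] by auto
  have conv2: "ereal (cmod z) < fps_conv_radius (fps_const (-1) * tz i (fps_X ^ d))"
    using conv(1) by (subst fps_conv_radius_cmult_left) auto
  have conv3: "ereal (cmod z) < fps_conv_radius (fps_const c + fps_const (-1) * tz i (fps_X ^ d))"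
    using conv2 fps_conv_radius_add[of "fps_const c" "fps_const (-1) * tz i (fps_X ^ d)"] by (simp add: min_def split: if_splits)
  \<comment> \<open>The first factor vanishes at z by the choice of c, yet the product of the series
    is 1.\<close>
  have "eval_fps ((fps_const c + fps_const (-1) * tz i (fps_X ^ d)) * tz i w) z
      = (c - eval_fps (tz i (fps_X ^ d)) z) * eval_fps (tz i w) z"
    using conv conv2 conv3 by (simp add: eval_fps_mult eval_fps_add)
  then show False unfolding t1 by (simp add: c_def)
qed

text \<open>The monomial z^s * E_il intertwines f * E_ii and f * E_ll. Its image is nonzero, and a
  nonzero entry of the image can be cancelled in the ring of power series.\<close>

lemma tz_link: assumes "reach P i l" "un i i f \<in> M" "un l l f \<in> M" shows "tz i f = tz l f"
proof -
  obtain s where s: "mpow P s i l > 0" using assms(1) by (auto simp: reach_def)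
  define Y where "Y = \<psi> (un i l (fps_X ^ s))"
  have X: "un i l (fps_X ^ s) \<in> M" by (rule p.M_monom[OF s])
  have Y0: "Y \<noteq> (\<lambda>_ _. 0)" unfolding Y_def \<psi>_eq_zero[OF X]
    by (metis un_same fps_X_neq_zero power_not_zero)
  then obtain a b where ab: "Y a b \<noteq> 0" by (auto simp: fun_eq_iff)
  have "mm (\<psi> (un i i f)) Y = mm Y (\<psi> (un l l f))"
    unfolding Y_def using assms X by (simp add: \<psi>_mm[symmetric] mm_un_un mult.commute)
  moreover have "mm (\<psi> (un i i f)) Y a b = tz i f * Y a b"
  proof -
    have "mm (\<psi> (un i i f)) Y a b = tz i f * mm (e i) Y a b"
      unfolding mm_def sum_distrib_left tz_def
      by (rule sum.cong) (simp_all add: corner_mtrace[OF incorner_\<psi>[OF assms(2)], of a])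
    then show ?thesis using incorner_\<psi>[OF X] by (simp add: incorner_def Y_def)
  qed
  moreover have "mm Y (\<psi> (un l l f)) a b = tz l f * Y a b"
  proof -
    have "mm Y (\<psi> (un l l f)) a b = tz l f * mm Y (e l) a b"
      unfolding mm_def sum_distrib_left tz_def
      by (rule sum.cong) (simp_all add: corner_mtrace[OF incorner_\<psi>[OF assms(3)], of _ b])
    then show ?thesis using incorner_\<psi>[OF X] by (simp add: incorner_def Y_def)
  qed
  ultimately show ?thesis using ab by simp
qed

end

section \<open>Preservation of the vacuum\<close>

text \<open>f continues a Moebius map with zero b to a larger disc. Its modulus on the ray through b
  is explicit, with a possible pole at 1 / |b|; boundedness keeps the pole out of the disc, and
  letting r tend to S gives the inequality.\<close>

lemma moebius_bound:
  assumes f: "f holomorphic_on ball 0 S" and S: "S > 1" and T: "\<And>z. cmod z < S \<Longrightarrow> cmod (f z) \<le> T"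
    and b: "cmod b < 1" and \<beta>: "cmod \<beta> = 1"
    and eq: "\<And>z. cmod z < 1 \<Longrightarrow> (1 - cnj b * z) * f z = \<beta> * (z - b)"
  shows "S - cmod b \<le> T * (1 - S * cmod b)"
proof -
  define A where "A = cmod b"
  define u where "u = (if b = 0 then 1 else b / cmod b)"
  have u: "cmod u = 1" "b = A * u" by (auto simp: u_def A_def norm_divide)
  have eqS: "(1 - cnj b * z) * f z = \<beta> * (z - b)" if "cmod z < S" for z
  proof (rule analytic_continuation_open[of "ball 0 1" "ball 0 S" "\<lambda>z. (1 - cnj b * z) * f z" "\<lambda>z. \<beta> * (z - b)"])
    show "(\<lambda>z. (1 - cnj b * z) * f z) holomorphic_on ball 0 S" by (intro holomorphic_intros f)
    show "(\<lambda>z. \<beta> * (z - b)) holomorphic_on ball 0 S" by (intro holomorphic_intros)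
  qed (use eq that S in \<open>auto simp: subset_ball\<close>)
  have T0: "0 \<le> T" using order_trans[OF norm_ge_zero T[of 0]] S by simp
  have A: "0 \<le> A" "A < 1" using b by (auto simp: A_def)
  have main: "\<bar>1 - r * A\<bar> * cmod (f (of_real r * u)) = \<bar>r - A\<bar>" if r: "0 \<le> r" "r < S" for r :: real
  proof -
    have z: "cmod (of_real r * u) < S" using r u by (simp add: norm_mult)
    have cu: "cnj u * u = 1" using u(1) by (metis complex_norm_square mult.commute of_real_1 power_one)
    have cb: "cnj b * (of_real r * u) = of_real (r * A)"
      unfolding u(2) using cu by (simp add: mult_ac)
    have "of_real r * u - b = (of_real r - of_real A) * u"
      by (subst u(2)) (simp add: left_diff_distrib)
    then have "(1 - of_real (r * A)) * f (of_real r * u) = \<beta> * ((of_real r - of_real A) * u)"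
      using eqS[OF z] unfolding cb by simp
    then have "cmod (of_real (1 - r * A)) * cmod (f (of_real r * u)) = cmod \<beta> * (cmod (of_real (r - A)) * cmod u)"
      by (metis norm_mult of_real_diff of_real_1)
    then show ?thesis using u \<beta> by (simp only: norm_of_real mult_1 mult_1_right)
  qed
  \<comment> \<open>Otherwise the left side of \<open>main\<close> would vanish at r = 1 / A inside
    the disc, while the right side does not.\<close>
  have SA: "S * A \<le> 1"
  proof (rule ccontr)
    assume "\<not> S * A \<le> 1"
    then have "A \<noteq> 0" by auto
    then have pos: "A > 0" "1 / A < S" using A S \<open>\<not> S * A \<le> 1\<close> by (auto simp: divide_less_eq)
    from main[of "1 / A"] have "1 / A = A" using pos by simp
    moreover have "1 / A > 1" using pos A by simp
    ultimately show False using A by simp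
  qed
  \<comment> \<open>Solved for r, so that nothing is divided by 1 - r * A, which may tend to
    0.\<close>
  have "r \<le> (A + T) / (1 + T * A)" if "r < S" for r
  proof (cases "r \<ge> 0")
    case True
    have rA: "r * A \<le> 1" using that A SA by (meson less_imp_le mult_right_mono order_trans)
    have z: "cmod (of_real r * u) < S" using True that u by (simp add: norm_mult)
    have "r - A \<le> \<bar>1 - r * A\<bar> * cmod (f (of_real r * u))" using main[OF True that] by simp
    also have "\<dots> \<le> (1 - r * A) * T" using rA T[OF z] by (simp add: mult_left_mono)
    finally have "r * (1 + T * A) \<le> A + T" by (simp add: algebra_simps)
    then show ?thesis using T0 A by (simp add: pos_le_divide_eq add_pos_nonneg)
  next
    case False
    moreover have "0 \<le> (A + T) / (1 + T * A)" using A T0 by simp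
    ultimately show ?thesis by linarith
  qed
  then have "S \<le> (A + T) / (1 + T * A)" by (rule dense_le)
  then have "S * (1 + T * A) \<le> A + T" using T0 A by (simp add: pos_le_divide_eq add_pos_nonneg)
  then show ?thesis by (simp add: A_def algebra_simps)
qed

text \<open>The left inverse makes t injective, hence an open map, and an open subset of the closed
  disc lies in its interior.\<close>

lemma inj_unit_ball_strict:
  assumes "t holomorphic_on ball 0 1" "\<And>z. cmod z < 1 \<Longrightarrow> cmod (t z) \<le> 1" "\<And>z. cmod z < 1 \<Longrightarrow> h (t z) = z"
    and "cmod z < 1"
  shows "cmod (t z) < 1"
proof -
  have "inj_on t (ball 0 1)" using assms(3) by (auto intro!: inj_on_inverseI[of _ h])
  then have "open (t ` ball 0 1)" using assms(1) by (intro open_mapping_thm3) auto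
  moreover have "t ` ball 0 1 \<subseteq> cball 0 1" using assms(2) by auto
  ultimately have "t ` ball 0 1 \<subseteq> interior (cball 0 1)" by (rule interior_maximal[rotated])
  then show ?thesis using assms(4) by (force simp: subset_iff)
qed

text \<open>By the Schwarz lemma \<open>t\<close> is a Moebius map \<open>\<alpha> (z - a) / (1 - cnj a * z)\<close>; comparing the maximal
  moduli of \<open>t\<close> and \<open>h\<close> on the two larger circles forces \<open>a = 0\<close>.\<close>

lemma disc_pair_fixes_centre:
  assumes t: "t holomorphic_on ball 0 S'" "\<And>z. cmod z < S' \<Longrightarrow> cmod (t z) \<le> S"
    and h: "h holomorphic_on ball 0 S" "\<And>z. cmod z < S \<Longrightarrow> cmod (h z) \<le> S'"
    and S: "S > 1" "S' > 1"
    and le1: "\<And>z. cmod z < 1 \<Longrightarrow> cmod (t z) \<le> 1" "\<And>z. cmod z < 1 \<Longrightarrow> cmod (h z) \<le> 1"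
    and inv: "\<And>z. cmod z < 1 \<Longrightarrow> h (t z) = z" "\<And>z. cmod z < 1 \<Longrightarrow> t (h z) = z"
  shows "t 0 = 0"
proof -
  have t1: "t holomorphic_on ball 0 1" and h1: "h holomorphic_on ball 0 1"
    using t(1) h(1) S by (auto elim!: holomorphic_on_subset)
  have tl: "cmod (t z) < 1" if "cmod z < 1" for z
    by (rule inj_unit_ball_strict[OF t1 le1(1) inv(1) that])
  have hl: "cmod (h z) < 1" if "cmod z < 1" for z
    by (rule inj_unit_ball_strict[OF h1 le1(2) inv(2) that])
  define a where "a = h 0"
  have a: "cmod a < 1" "cmod (-a) < 1" using hl[of 0] by (auto simp: a_def)
  define m m' where "m = Moebius_function 0 a" and "m' = Moebius_function 0 (-a)"
  have m: "cmod (m z) < 1" "cmod (m' z) < 1" "m (m' z) = z" "m' (m z) = z" if "cmod z < 1" for z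
    using that a Moebius_function_norm_lt_1 Moebius_function_compose[of "-a" a z] Moebius_function_compose[of a "-a" z]
    by (auto simp: m_def m'_def)
  have mh: "m holomorphic_on ball 0 1" "m' holomorphic_on ball 0 1"
    using a Moebius_function_holomorphic by (auto simp: m_def m'_def)
  have m0: "m a = 0" "m' 0 = a" by (auto simp: m_def m'_def Moebius_function_eq_zero Moebius_function_of_zero)
  \<comment> \<open>The Moebius map \<open>m'\<close> moves the zero a of t to the origin, so the
    Schwarz lemma applies to k and to its left inverse \<open>k'\<close>.\<close>
  define k k' where "k = t \<circ> m'" and "k' = m \<circ> h"
  have kh: "k holomorphic_on ball 0 1" "k' holomorphic_on ball 0 1"
    unfolding k_def k'_def using t1 h1 mh m hl
    by (auto intro!: holomorphic_on_compose_gen[of _ _ _ "ball 0 1"])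
  have k0: "k 0 = 0" "k' 0 = 0" using inv(2)[of 0] m0 by (auto simp: k_def k'_def a_def)
  have kl: "cmod (k z) < 1" "cmod (k' z) < 1" if "cmod z < 1" for z
    using that tl hl m by (auto simp: k_def k'_def)
  have kk: "k' (k z) = z" if "cmod z < 1" for z
    using that inv m by (auto simp: k_def k'_def)
  \<comment> \<open>Any nonzero point would do: equality in the Schwarz lemma at one such point
    makes k a rotation.\<close>
  have half: "cmod (1 / 2) < 1" by simp
  have "cmod (k (1 / 2)) \<le> cmod (1 / 2)" by (rule Schwarz_Lemma(1)[OF kh(1) k0(1) kl(1) half])
  moreover have "cmod (k' (k (1 / 2))) \<le> cmod (k (1 / 2))"
    by (rule Schwarz_Lemma(1)[OF kh(2) k0(2) kl(2) kl(1)[OF half]])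
  ultimately have "cmod (k (1 / 2)) = cmod (1 / 2)" using kk[OF half] by simp
  then obtain \<alpha> where \<alpha>: "\<And>z. cmod z < 1 \<Longrightarrow> k z = \<alpha> * z" "cmod \<alpha> = 1"
    using Schwarz_Lemma(3)[OF kh(1) k0(1) kl(1) half] half by (metis zero_neq_one divide_eq_0_iff zero_neq_numeral)
  have nz: "1 - cnj w * z \<noteq> 0" if "cmod z < 1" "cmod w < 1" for z w
  proof
    assume "1 - cnj w * z = 0"
    then have "cmod (cnj w * z) = 1" by (metis right_minus_eq norm_one)
    moreover have "cmod (cnj w * z) < 1" using that norm_mult_less[of "cnj w" 1 z 1] by simp
    ultimately show False by simp
  qed
  have teq: "(1 - cnj a * z) * t z = \<alpha> * (z - a)" if z: "cmod z < 1" for z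
  proof -
    have "t z = k (m z)" using m(4)[OF z] by (simp add: k_def)
    also have "\<dots> = \<alpha> * m z" using m(1)[OF z] \<alpha> by simp
    finally show ?thesis using nz[OF z a(1)] by (simp add: m_def Moebius_function_simple)
  qed
  have \<alpha>0: "\<alpha> \<noteq> 0" using \<alpha>(2) by auto
  define b where "b = - (\<alpha> * a)"
  have b: "cmod b < 1" "cmod b = cmod a" using a \<alpha>(2) by (auto simp: b_def norm_mult)
  have cnja: "cnj \<alpha> = 1 / \<alpha>" using \<alpha>(2) \<alpha>0
    by (metis complex_norm_square eq_divide_eq mult.commute of_real_1 power_one)
  have heq: "(1 - cnj b * z) * h z = (1 / \<alpha>) * (z - b)" if z: "cmod z < 1" for z
  proof -
    have "z = t (h z)" using inv(2)[OF z] by simp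
    then have "(1 - cnj a * h z) * z = \<alpha> * (h z - a)" using teq[OF hl[OF z]] by simp
    then show ?thesis using \<alpha>0 by (simp add: b_def cnja field_simps)
  qed
  have "S' - cmod a \<le> S * (1 - S' * cmod a)"
    by (rule moebius_bound[OF t(1) S(2) t(2) a(1) \<alpha>(2) teq])
  moreover have "S - cmod b \<le> S' * (1 - S * cmod b)"
    by (rule moebius_bound[OF h(1) S(1) h(2) b(1) _ heq]) (use \<alpha>(2) in \<open>auto simp: norm_divide\<close>)
  \<comment> \<open>This is half the sum of the two bounds, in which S + S' cancels.\<close>
  ultimately have "cmod a * (S * S') \<le> cmod a" using b by (simp add: algebra_simps)
  moreover have "S * S' > 1" using S by (simp add: less_1_mult)
  ultimately have "\<not> cmod a > 0" by (metis mult_strict_left_mono mult_1_right not_le)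
  then have "a = 0" by simp
  then show ?thesis using teq[of 0] by simp
qed

definition sink :: "('a::finite \<Rightarrow> 'a \<Rightarrow> real) \<Rightarrow> 'a \<Rightarrow> bool" where
  "sink P l \<longleftrightarrow> (\<forall>j. reach P l j \<longrightarrow> j = l)"

definition singleton_class :: "('a::finite \<Rightarrow> 'a \<Rightarrow> real) \<Rightarrow> 'a \<Rightarrow> bool" where
  "singleton_class P i \<longleftrightarrow> (\<forall>k. comm P i k \<longrightarrow> k = i)"

text \<open>At these states an isomorphism may move the vacuum character by a Moebius transformation.\<close>

definition bad :: "('a::finite \<Rightarrow> 'a \<Rightarrow> real) \<Rightarrow> 'a \<Rightarrow> bool" where
  "bad P l \<longleftrightarrow> sink P l \<and> (\<forall>i. reach P i l \<longrightarrow> cyclic P i \<longrightarrow> i = l)"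

context stoch
begin

lemma sink_recurrent: "sink P l \<Longrightarrow> recurrent P l"
  by (auto simp: sink_def recurrent_def)

lemma sink_mpow: assumes "sink P l" shows "mpow P n l l = 1"
proof -
  have "mpow P n l k = 0" if "k \<noteq> l" for k
    using assms that mpow_pos_iff[of n l k] by (auto simp: sink_def reach_def)
  then have "(\<Sum>k\<in>UNIV. mpow P n l k) = (\<Sum>k\<in>UNIV. if k = l then mpow P n l l else 0)"
    by (intro sum.cong) auto
  then show ?thesis using mpow_row[of n l] by simp
qed

lemma sink_singleton: "sink P l \<Longrightarrow> singleton_class P l"
  by (auto simp: sink_def singleton_class_def comm_def)

lemma recurrent_singleton_sink: "recurrent P l \<Longrightarrow> singleton_class P l \<Longrightarrow> sink P l"
  by (auto simp: sink_def singleton_class_def comm_def recurrent_def)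

lemma singleton_loop: assumes "cyclic P i" "singleton_class P i" shows "P i i > 0"
proof -
  obtain n where n: "mpow P (1 + n) i i > 0" using assms(1) by (auto simp: cyclic_def le_iff_add)
  then obtain k where k: "mpow P 1 i k > 0" "mpow P n k i > 0" using mpow_pos_split by blast
  then have "comm P i k" by (auto simp: comm_def intro: reachI reach_edge)
  then show ?thesis using k assms(2) by (auto simp: singleton_class_def)
qed

lemma loop_cyclic: "P i i > 0 \<Longrightarrow> cyclic P i"
  unfolding cyclic_def by (intro exI[of _ "Suc 0"]) simp

text \<open>In a singleton class only the loop returns, so the return probabilities are the powers
  of \<open>P i i\<close>, which is less than 1 because the state has an exit.\<close>

lemma singleton_rate_less: assumes "singleton_class P i" "reach P i l" "l \<noteq> i" shows "rate P i < 1"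
proof -
  have "\<exists>k. k \<noteq> i \<and> P i k > 0"
  proof (rule ccontr)
    assume no: "\<nexists>k. k \<noteq> i \<and> P i k > 0"
    have "k = i" if "mpow P n i k > 0" for n k
      using that
    proof (induction n)
      case 0
      then show ?case by (simp split: if_splits)
    next
      case (Suc n)
      then obtain k' where "mpow P 1 i k' > 0" "mpow P n k' k > 0" using mpow_pos_split[of 1 n i k] by auto
      moreover from this have "k' = i" using no by auto
      ultimately show ?case using Suc.IH by simp
    qed
    then show False using assms by (auto simp: reach_def)
  qed
  then obtain k where k: "k \<noteq> i" "P i k > 0" by blast
  have "P i i + P i k = (\<Sum>j\<in>{i, k}. P i j)" using k by simp
  also have "\<dots> \<le> (\<Sum>j\<in>UNIV. P i j)" by (rule sum_mono2) (auto simp: P_nonneg)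
  finally have lt: "P i i < 1" using k by (simp add: P_row)
  have pw: "mpow P n i i = P i i ^ n" for n
  proof (induction n)
    case (Suc n)
    have "mpow P n i k * P k i = 0" if "k \<noteq> i" for k
    proof (rule ccontr)
      assume "mpow P n i k * P k i \<noteq> 0"
      then have "mpow P n i k > 0" "P k i > 0" using mpow_pos_iff P_nonneg[of k i] by auto
      then have "comm P i k" by (auto simp: comm_def intro: reachI reach_edge)
      then show False using assms(1) that by (auto simp: singleton_class_def)
    qed
    then have "mpow P (Suc n) i i = (\<Sum>k\<in>UNIV. if k = i then mpow P n i i * P i i else 0)"
      unfolding mpow.simps(2) by (intro sum.cong) auto
    then show ?case using Suc by simp
  qed simp
  have "rate P i \<le> P i i"
    unfolding rate_def by (rule cSUP_least) (auto simp: pw real_root_power_cancel P_nonneg)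
  then show ?thesis using lt by simp
qed

end

text \<open>Polynomial division by z - w extended to series: the n-th coefficient of the quotient is
  the tail of f beyond n, evaluated at w. Convergence of f beyond the unit circle makes these
  coefficients summable even for |w| = 1.\<close>

lemma fps_div_linear:
  fixes f :: "complex fps" and w :: complex
  assumes b: "\<And>n. cmod (f $ n) \<le> K * \<rho> ^ n" and \<rho>: "0 \<le> \<rho>" "\<rho> < 1" and w: "cmod w \<le> 1"
  obtains q where "(fps_X - fps_const w) * q = f - fps_const (eval_fps f w)" "summable (\<lambda>n. cmod (q $ n))"
proof -
  have K: "K \<ge> 0" using order_trans[OF norm_ge_zero b[of 0]] by simp
  have tb: "cmod (f $ (m + n) * w ^ m) \<le> K * \<rho> ^ n * \<rho> ^ m" for m n
  proof -
    have "cmod (f $ (m + n) * w ^ m) \<le> cmod (f $ (m + n)) * 1"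
      unfolding norm_mult norm_power using w by (intro mult_left_mono power_le_one) auto
    also have "\<dots> \<le> K * \<rho> ^ n * \<rho> ^ m" using b[of "m + n"] by (simp add: power_add mult_ac)
    finally show ?thesis .
  qed
  have sm: "summable (\<lambda>m. f $ (m + n) * w ^ m)" for n
  proof (rule summable_comparison_test)
    show "\<exists>N. \<forall>m\<ge>N. norm (f $ (m + n) * w ^ m) \<le> K * \<rho> ^ n * \<rho> ^ m" using tb by blast
    show "summable (\<lambda>m. K * \<rho> ^ n * \<rho> ^ m)" using \<rho> by (intro summable_mult summable_geometric) auto
  qed
  define q where "q = Abs_fps (\<lambda>n. \<Sum>m. f $ (m + Suc n) * w ^ m)"
  have step: "(\<Sum>m. f $ (m + n) * w ^ m) = f $ n + w * (\<Sum>m. f $ (m + Suc n) * w ^ m)" for n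
  proof -
    have "(\<Sum>m. f $ (m + n) * w ^ m) = f $ n + (\<Sum>m. f $ (Suc m + n) * w ^ Suc m)"
      using suminf_split_head[OF sm[of n]] by simp
    also have "(\<Sum>m. f $ (Suc m + n) * w ^ Suc m) = (\<Sum>m. w * (f $ (m + Suc n) * w ^ m))"
      by (simp add: mult_ac)
    also have "\<dots> = w * (\<Sum>m. f $ (m + Suc n) * w ^ m)" by (rule suminf_mult[OF sm])
    finally show ?thesis .
  qed
  have "(fps_X - fps_const w) * q = f - fps_const (eval_fps f w)"
  proof (rule fps_ext)
    fix n
    show "((fps_X - fps_const w) * q) $ n = (f - fps_const (eval_fps f w)) $ n"
    proof (cases n)
      case 0
      then show ?thesis using step[of 0] by (simp add: left_diff_distrib q_def eval_fps_def)
    next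
      case (Suc k)
      then show ?thesis using step[of "Suc k"] by (simp add: left_diff_distrib q_def)
    qed
  qed
  moreover have "summable (\<lambda>n. cmod (q $ n))"
  proof (rule summable_comparison_test)
    show "\<exists>N. \<forall>n\<ge>N. norm (cmod (q $ n)) \<le> (K * \<rho> / (1 - \<rho>)) * \<rho> ^ n"
    proof (intro exI allI impI)
      fix n
      have g: "summable (\<lambda>m. K * \<rho> ^ Suc n * \<rho> ^ m)" using \<rho> by (intro summable_mult summable_geometric) auto
      have "cmod (q $ n) \<le> (\<Sum>m. K * \<rho> ^ Suc n * \<rho> ^ m)" unfolding q_def fps_nth_Abs_fps
        by (rule norm_suminf_le[OF tb g])
      also have "\<dots> = K * \<rho> ^ Suc n * (1 / (1 - \<rho>))" using \<rho> by (subst suminf_mult) (auto simp: suminf_geometric summable_geometric)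
      finally show "norm (cmod (q $ n)) \<le> (K * \<rho> / (1 - \<rho>)) * \<rho> ^ n" by simp
    qed
    show "summable (\<lambda>n. (K * \<rho> / (1 - \<rho>)) * \<rho> ^ n)" using \<rho> by (intro summable_mult summable_geometric) auto
  qed
  ultimately show ?thesis using that by blast
qed

section \<open>Transport of reachability, and inverse pairs at absorbing states\<close>

context series_iso
begin

lemma \<psi>_compress: assumes "X \<in> M" shows "\<psi> (un i j (X i j)) = mm (e i) (mm (\<psi> X) (e j))"
proof -
  have "un i j (X i j) = mm (un i i 1) (mm X (un j j 1))" by (simp add: mm_un_both)
  then show ?thesis using assms by (simp add: \<psi>_mm p.M_mm p.M_unit e_def)
qed

lemma compress_lead: assumes "ordge n Y" shows "mm (e i) (mm Y (e j)) (sg i) (sg j) $ n = Y (sg i) (sg j) $ n"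
proof -
  have o: "ordge (n + 0) (mm Y (e j))" by (rule ordge_mm[OF assms]) simp
  have "mm (e i) (mm Y (e j)) (sg i) (sg j) $ (0 + n) = (\<Sum>k\<in>UNIV. e i (sg i) k $ 0 * mm Y (e j) k (sg j) $ n)"
    by (rule ordge_mm) (use o in auto)
  also have "\<dots> = (\<Sum>k\<in>UNIV. if k = sg i then mm Y (e j) (sg i) (sg j) $ n else 0)"
    by (rule sum.cong) (auto simp: e_const)
  also have "\<dots> = mm Y (e j) (sg i) (sg j) $ (n + 0)" by simp
  also have "\<dots> = (\<Sum>k\<in>UNIV. Y (sg i) k $ n * e j k (sg j) $ 0)" by (rule ordge_mm[OF assms]) simp
  also have "\<dots> = (\<Sum>k\<in>UNIV. if k = sg j then Y (sg i) (sg j) $ n else 0)"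
    by (rule sum.cong) (auto simp: e_const)
  finally show ?thesis by simp
qed

text \<open>A monomial at (sg i, sg j) need not be the image of a corner element. Compressing its
  preimage to the entry (i, j) changes the image only in higher order.\<close>

lemma preimage_monom:
  assumes "mpow Q n (sg i) (sg j) > 0"
  obtains X where "X \<in> M" "\<psi> (un i j (X i j)) (sg i) (sg j) $ n = 1" "ordge n (\<psi> (un i j (X i j)))"
proof -
  let ?Y = "un (sg i) (sg j) (fps_X ^ n) :: 'a fpsmat"
  obtain X where X: "X \<in> M" "\<psi> X = ?Y" using \<psi>_surj[OF q.M_monom[OF assms]] by blast
  have Y: "ordge n ?Y" by (auto simp: ordge_un fps_X_power_nth)
  have "\<psi> (un i j (X i j)) (sg i) (sg j) $ n = 1"
    unfolding \<psi>_compress[OF X(1)] X(2) compress_lead[OF Y] by (simp add: fps_X_power_nth)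
  moreover have "ordge (0 + (n + 0)) (\<psi> (un i j (X i j)))"
    unfolding \<psi>_compress[OF X(1)] X(2) by (intro ordge_mm Y) auto
  ultimately show ?thesis using that X(1) by simp
qed

lemma monom_order:
  assumes "mpow P n i j > 0"
  obtains m where "ordge m (\<psi> (un i j (fps_X ^ n)))" "\<psi> (un i j (fps_X ^ n)) (sg i) (sg j) $ m \<noteq> 0"
proof (rule corner_order_exists)
  show "incorner i j (\<psi> (un i j (fps_X ^ n)))" by (rule incorner_\<psi>[OF p.M_monom[OF assms]])
  show "\<psi> (un i j (fps_X ^ n)) \<noteq> (\<lambda>_ _. 0)"
    unfolding \<psi>_eq_zero[OF p.M_monom[OF assms]] by (metis un_same fps_X_neq_zero power_not_zero)
qed

lemma reach_iff: "reach P i j \<longleftrightarrow> reach Q (sg i) (sg j)"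
proof
  assume "reach P i j"
  then obtain n where n: "mpow P n i j > 0" by (auto simp: reach_def)
  show "reach Q (sg i) (sg j)"
  proof (rule monom_order[OF n])
    fix m assume "\<psi> (un i j (fps_X ^ n)) (sg i) (sg j) $ m \<noteq> 0"
    from q.M_supp[OF \<psi>_in[OF p.M_monom[OF n]] this] show "reach Q (sg i) (sg j)" by (rule q.reachI)
  qed
next
  assume "reach Q (sg i) (sg j)"
  then obtain n where "mpow Q n (sg i) (sg j) > 0" by (auto simp: reach_def)
  then obtain X where X: "X \<in> M" "\<psi> (un i j (X i j)) (sg i) (sg j) $ n = 1" by (rule preimage_monom)
  have "X i j \<noteq> 0"
  proof
    assume "X i j = 0"
    then have "un i j (X i j) = (\<lambda>_ _. 0)" by (auto simp: un_def fun_eq_iff)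
    then show False using X \<psi>_zero by simp
  qed
  then show "reach P i j" using p.M_reach X by blast
qed

lemma comm_iff: "comm P i j \<longleftrightarrow> comm Q (sg i) (sg j)"
  by (simp add: comm_def reach_iff)

lemma uc: "un i i (fps_const c) \<in> M" and \<psi>_uc: "\<psi> (un i i (fps_const c)) = mscale c (e i)"
  using p.M_mscale[OF p.M_unit[of i], of c] \<psi>_mscale[OF p.M_unit[of i], of c]
  by (auto simp: mscale_un e_def)

text \<open>A state is cyclic exactly when its corner contains more than constants. In one direction
  the constant term is subtracted from the image of a monomial; in the other, a constant preimage
  would have a multiple of \<open>e i\<close> as image, which cannot have positive order unless it
  is 0.\<close>

lemma cyclic_iff: "cyclic P i \<longleftrightarrow> cyclic Q (sg i)"
proof
  assume "cyclic P i"
  then obtain n where n: "n \<ge> 1" "mpow P n i i > 0" by (auto simp: cyclic_def)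
  define c where "c = \<psi> (un i i (fps_X ^ n)) (sg i) (sg i) $ 0"
  define X where "X = un i i (fps_X ^ n + fps_const (-c))"
  have X: "X \<in> M" unfolding X_def madd_un[symmetric] by (intro p.M_madd p.M_monom n uc)
  have \<psi>X: "\<psi> X = madd (\<psi> (un i i (fps_X ^ n))) (mscale (-c) (e i))"
    unfolding X_def madd_un[symmetric] by (simp only: \<psi>_madd[OF p.M_monom[OF n(2)] uc] \<psi>_uc)
  have z: "\<psi> X (sg i) (sg i) $ 0 = 0" unfolding \<psi>X by (simp add: madd_def mscale_def e_const c_def)
  have "X \<noteq> (\<lambda>_ _. 0)"
  proof
    assume "X = (\<lambda>_ _. 0)"
    then have "X i i $ n = 0" by simp
    then show False using n(1) by (simp add: X_def fps_X_power_nth)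
  qed
  then have "\<psi> X \<noteq> (\<lambda>_ _. 0)" using \<psi>_eq_zero[OF X] by simp
  moreover have "incorner i i (\<psi> X)" using X unfolding X_def by (rule incorner_\<psi>)
  ultimately obtain m where m: "\<psi> X (sg i) (sg i) $ m \<noteq> 0" using corner_order_exists by blast
  then have "m \<ge> 1" using z by (cases m) auto
  then show "cyclic Q (sg i)" using q.M_supp[OF \<psi>_in[OF X] m] by (auto simp: cyclic_def)
next
  assume "cyclic Q (sg i)"
  then obtain n where n: "n \<ge> 1" "mpow Q n (sg i) (sg i) > 0" by (auto simp: cyclic_def)
  obtain X where X: "X \<in> M" "\<psi> (un i i (X i i)) (sg i) (sg i) $ n = 1" "ordge n (\<psi> (un i i (X i i)))"
    using preimage_monom[OF n(2)] by blast
  have "\<exists>m\<ge>1. X i i $ m \<noteq> 0"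
  proof (rule ccontr)
    assume "\<not> ?thesis"
    then have "X i i $ m = fps_const (X i i $ 0) $ m" for m by (cases m) auto
    then have "X i i = fps_const (X i i $ 0)" by (rule fps_ext)
    then have eq: "\<psi> (un i i (X i i)) = mscale (X i i $ 0) (e i)" using \<psi>_uc by metis
    then have "X i i $ 0 = \<psi> (un i i (X i i)) (sg i) (sg i) $ 0" by (simp add: mscale_def e_const)
    also have "\<dots> = 0" using X(3) n(1) by (simp add: ordge_def)
    finally show False using eq X(2) by (simp add: mscale_def)
  qed
  then show "cyclic P i" using p.M_supp[OF X(1)] by (auto simp: cyclic_def)
qed

lemma sg_surj: obtains i where "j = sg i"
  using bij_sg by (metis bij_pointE)

lemma recurrent_iff: "recurrent P i \<longleftrightarrow> recurrent Q (sg i)"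
  unfolding recurrent_def reach_iff by (metis sg_surj)

lemma sink_iff: "sink P i \<longleftrightarrow> sink Q (sg i)"
  unfolding sink_def reach_iff by (metis sg_surj sg_eq_iff)

lemma singleton_iff: "singleton_class P i \<longleftrightarrow> singleton_class Q (sg i)"
  unfolding singleton_class_def comm_iff by (metis sg_surj sg_eq_iff)

lemma bad_iff: "bad P i \<longleftrightarrow> bad Q (sg i)"
  unfolding bad_def sink_iff[symmetric] by (metis cyclic_iff reach_iff sg_surj sg_eq_iff)

text \<open>An off-diagonal contribution to the square of \<open>e i\<close> at (sg i, sg i) would
  need another state communicating with sg i. So this entry is a nonzero idempotent power
  series.\<close>

lemma singleton_e: assumes "singleton_class P i" shows "e i (sg i) (sg i) = 1"
proof -
  have "e i (sg i) a * e i a (sg i) = 0" if "a \<noteq> sg i" for a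
  proof (rule ccontr)
    assume "e i (sg i) a * e i a (sg i) \<noteq> 0"
    then have "comm Q (sg i) a" using e_supp[of i "sg i" a] e_supp[of i a "sg i"] by (auto simp: comm_def)
    then show False using assms that unfolding singleton_iff by (auto simp: singleton_class_def)
  qed
  then have "mm (e i) (e i) (sg i) (sg i) = (\<Sum>a\<in>UNIV. if a = sg i then e i (sg i) (sg i) * e i (sg i) (sg i) else 0)"
    unfolding mm_def by (intro sum.cong) auto
  then have "e i (sg i) (sg i) * e i (sg i) (sg i) = e i (sg i) (sg i)" by (simp add: e_mult)
  then show ?thesis using e_diag_nz[of i] by simp
qed

lemma inv_in: "Y \<in> N \<Longrightarrow> inv_into M \<psi> Y \<in> M" and \<psi>_inv: "Y \<in> N \<Longrightarrow> \<psi> (inv_into M \<psi> Y) = Y"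
  and inv_\<psi>: "X \<in> M \<Longrightarrow> inv_into M \<psi> (\<psi> X) = X"
  using bij by (auto simp: bij_betw_def inv_into_into f_inv_into_f)

text \<open>By \<open>singleton_e\<close>, the matrix unit at sg i is unchanged when
  \<open>e i\<close> is inserted between two copies of it. Pulling this identity back and comparing
  constant terms locates the idempotent of the inverse at i.\<close>

lemma inv_sg: assumes "singleton_class P i"
  shows "series_iso.sg (inv_into M \<psi>) (sg i) = i"
proof -
  interpret inv: series_iso Q N P M "inv_into M \<psi>" by (rule inverse_iso)
  let ?s = "sg i"
  have "un ?s ?s 1 = mm (un ?s ?s 1) (mm (e i) (un ?s ?s 1))"
    by (simp add: mm_un_both singleton_e[OF assms])
  then have "inv.e ?s = inv_into M \<psi> (mm (un ?s ?s 1) (mm (e i) (un ?s ?s 1)))"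
    unfolding inv.e_def by simp
  also have "\<dots> = mm (inv.e ?s) (mm (un i i 1) (inv.e ?s))"
    using e_in q.M_unit q.M_mm by (simp add: inv.\<psi>_mm inv.e_def[symmetric]) (simp add: e_def inv_\<psi> p.M_unit)
  finally have eq: "inv.e ?s = mm (inv.e ?s) (mm (un i i 1) (inv.e ?s))" .
  let ?t = "inv.sg ?s"
  have "inv.e ?s ?t ?t = inv.e ?s ?t i * inv.e ?s i ?t"
  proof -
    have "mm (inv.e ?s) (mm (un i i 1) (inv.e ?s)) ?t ?t = (\<Sum>k\<in>UNIV. if k = i then inv.e ?s ?t i * inv.e ?s i ?t else 0)"
      unfolding mm_un_left unfolding mm_def by (rule sum.cong) auto
    then show ?thesis using eq by simp
  qed
  then have "1 = inv.e ?s ?t i $ 0 * inv.e ?s i ?t $ 0"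
    using inv.e_const[of ?s ?t ?t] by simp
  then show ?thesis using inv.e_const[of ?s ?t i] by (auto split: if_splits)
qed

lemma inv_inv: "X \<in> M \<Longrightarrow> inv_into N (inv_into M \<psi>) X = \<psi> X"
proof -
  interpret inv: series_iso Q N P M "inv_into M \<psi>" by (rule inverse_iso)
  show "X \<in> M \<Longrightarrow> inv_into N (inv_into M \<psi>) X = \<psi> X"
    by (metis inv.inv_\<psi> inv_\<psi> \<psi>_in)
qed

text \<open>Dividing \<open>\<eta> - \<eta>(\<tau>(z))\<close> by \<open>z - \<tau>(z)\<close> inside the algebra turns the identity
  \<open>\<psi> \<circ> \<psi>\<^sup>-\<^sup>1 = id\<close> into the composition law \<open>\<eta> \<circ> \<tau> = id\<close>, without any continuity of \<open>\<psi>\<close>.\<close>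

lemma sink_inverse:
  assumes l: "sink P l" and i: "singleton_class P i" "cyclic P i" "reach P i l" "l \<noteq> i" and z: "cmod z < 1"
  shows "eval_fps (series_iso.tz (inv_into M \<psi>) (sg l) fps_X) (eval_fps (tz l fps_X) z) = z"
proof -
  interpret inv: series_iso Q N P M "inv_into M \<psi>" by (rule inverse_iso)
  have sl: "singleton_class P l" by (rule p.sink_singleton[OF l])
  have il: "inv.sg (sg l) = l" "inv.sg (sg i) = i" using inv_sg[OF sl] inv_sg[OF i(1)] by auto
  have Pl: "mpow P n l l = 1" for n by (rule p.sink_mpow[OF l])
  have lQ: "sink Q (sg l)" using l by (simp add: sink_iff)
  have Ql: "mpow Q n (sg l) (sg l) = 1" for n by (rule q.sink_mpow[OF lQ])
  have rl: "rate P l = 1" "rate Q (sg l) = 1"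
    using p.rate_recurrent[OF p.sink_recurrent[OF l]] q.rate_recurrent[OF q.sink_recurrent[OF lQ]] by auto
  have Xl: "un l l fps_X \<in> M" using Pl[of "Suc 0"] by (intro p.M_edge) simp
  have XQl: "un (sg l) (sg l) fps_X \<in> N" using Ql[of "Suc 0"] by (intro q.M_edge) simp
  have XQi: "un (sg i) (sg i) fps_X \<in> N"
    using q.singleton_loop[of "sg i"] i by (intro q.M_edge) (simp add: cyclic_iff singleton_iff)
  define \<eta> where "\<eta> = inv.tz (sg l) fps_X"
  define w where "w = eval_fps (tz l fps_X) z"
  have w: "cmod w \<le> 1"
  proof -
    have "(cmod z)\<^sup>2 * rate Q (sg l) < 1" using z by (simp add: rl power_less_one_iff abs_square_less_1)
    from tz_bound[of 1 l z, OF _ _ this] have "(cmod w)\<^sup>2 \<le> 1" using Pl[of 1] by (simp add: w_def rl del: One_nat_def)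
    then show ?thesis by (simp add: abs_square_le_1 power_le_one_iff)
  qed
  \<comment> \<open>Here i is used: computed in the corner of i, the coefficients of \<eta> decay
    geometrically because \<open>rate P i\<close> is below 1. So \<eta> converges on a neighbourhood
    of the closed unit disc, which contains w.\<close>
  have \<eta>i: "\<eta> = inv.tz (sg i) fps_X"
    unfolding \<eta>_def by (rule inv.tz_link[symmetric, OF _ XQi XQl]) (use i(3) in \<open>simp add: reach_iff\<close>)
  obtain K where K: "\<And>n. cmod (\<eta> $ n) \<le> K * sqrt (rate P i) ^ n"
    using inv.mtrace_growth[OF inv.\<psi>_in[OF XQi] inv.incorner_\<psi>[OF XQi]] unfolding \<eta>i inv.tz_def il by blast
  have r: "0 \<le> sqrt (rate P i)" "sqrt (rate P i) < 1"
    using p.rate_nonneg[of i] p.singleton_rate_less[OF i(1,3,4)] by auto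
  obtain g where g: "(fps_X - fps_const w) * g = \<eta> - fps_const (eval_fps \<eta> w)" "summable (\<lambda>n. cmod (g $ n))"
    using fps_div_linear[OF K r w] by blast
  \<comment> \<open>All weights at an absorbing state are 1, so summable coefficients
    suffice.\<close>
  have gM: "un l l g \<in> M" by (rule p.M_series) (auto simp: Pl g(2))
  \<comment> \<open>\<eta> is the (l, l) entry of the preimage of the monomial z at sg l, since the
    idempotent of the inverse has entry 1 there.\<close>
  have \<eta>M: "un l l \<eta> \<in> M" and t\<eta>: "tz l \<eta> = fps_X"
  proof -
    define Y where "Y = inv_into M \<psi> (un (sg l) (sg l) fps_X)"
    have Y: "Y \<in> M" "\<psi> Y = un (sg l) (sg l) fps_X" unfolding Y_def using XQl by (auto simp: inv_in \<psi>_inv)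
    have "Y l l = inv.tz (sg l) fps_X * inv.e (sg l) l l"
      unfolding Y_def inv.tz_def using inv.corner_mtrace[OF inv.incorner_\<psi>[OF XQl]] .
    also have "inv.e (sg l) l l = 1"
      using inv.singleton_e[of "sg l"] sl unfolding singleton_iff[of l] il by simp
    finally have Yl: "Y l l = \<eta>" by (simp add: \<eta>_def)
    show \<eta>M: "un l l \<eta> \<in> M" using p.M_corner[OF Y(1), of l l] by (simp add: Yl)
    have "\<psi> (un l l \<eta>) = mm (e l) (mm (\<psi> Y) (e l))" using \<psi>_compress[OF Y(1), of l l] by (simp add: Yl)
    then have "\<psi> (un l l \<eta>) (sg l) (sg l) = fps_X"
    proof -
      have "mm (e l) (mm (un (sg l) (sg l) fps_X) (e l)) (sg l) (sg l)
          = (\<Sum>k\<in>UNIV. if k = sg l then e l (sg l) (sg l) * (fps_X * e l (sg l) (sg l)) else 0)"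
        unfolding mm_un_left unfolding mm_def by (rule sum.cong) auto
      then show ?thesis using \<open>\<psi> (un l l \<eta>) = _\<close> Y(2) singleton_e[OF sl] by simp
    qed
    then show "tz l \<eta> = fps_X"
      using corner_mtrace[OF incorner_\<psi>[OF \<eta>M], of "sg l" "sg l"] singleton_e[OF sl] by (simp add: tz_def)
  qed
  have tc: "tz l (fps_const a) = fps_const a" for a using tz_scale[OF p.M_unit, of l a] by (simp add: tz_1)
  have "tz l ((fps_X + fps_const (-w)) * g) = (tz l fps_X + fps_const (-w)) * tz l g"
  proof -
    have "un l l (fps_X + fps_const (-w)) \<in> M" unfolding madd_un[symmetric] by (rule p.M_madd[OF Xl uc])
    then show ?thesis by (simp only: tz_mult[OF _ gM] tz_add[OF Xl uc] tc)
  qed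
  moreover have "tz l (\<eta> + fps_const (- eval_fps \<eta> w)) = fps_X + fps_const (- eval_fps \<eta> w)"
    by (simp only: tz_add[OF \<eta>M uc] tc t\<eta>)
  moreover have "(fps_X + fps_const (-w)) * g = \<eta> + fps_const (- eval_fps \<eta> w)"
    using g(1) by (simp add: fps_const_neg[symmetric] del: fps_const_neg)
  ultimately have eq: "(tz l fps_X + fps_const (-w)) * tz l g = fps_X + fps_const (- eval_fps \<eta> w)" by simp
  have zl: "(cmod z)\<^sup>2 * rate Q (sg l) < 1" using z by (simp add: rl power_less_one_iff abs_square_less_1)
  have conv: "ereal (cmod z) < fps_conv_radius (tz l fps_X)" "ereal (cmod z) < fps_conv_radius (tz l g)"
    using tz_conv[OF Xl zl] tz_conv[OF gM zl] by auto
  have conv2: "ereal (cmod z) < fps_conv_radius (tz l fps_X + fps_const (-w))"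
    using conv(1) fps_conv_radius_add[of "tz l fps_X" "fps_const (-w)"] by (simp add: min_def split: if_splits)
  \<comment> \<open>At z the factor \<open>tz l fps_X - w\<close> vanishes by the definition of
    w.\<close>
  have "(w + (-w)) * eval_fps (tz l g) z = eval_fps ((tz l fps_X + fps_const (-w)) * tz l g) z"
    using conv conv2 by (simp add: eval_fps_mult eval_fps_add w_def)
  also have "\<dots> = z - eval_fps \<eta> w" unfolding eq by (subst eval_fps_add) auto
  finally show ?thesis by (simp add: \<eta>_def w_def)
qed

text \<open>By \<open>tz_link\<close> one series t serves two corners: that of l bounds it by 1 on
  the unit disc, that of i bounds it by S on the disc of radius S'. The inverse behaves in the same
  way with S and S' exchanged, so \<open>disc_pair_fixes_centre\<close> applies.\<close>

lemma sink_pair_vacuum: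
  assumes l: "sink P l" and i: "singleton_class P i" "cyclic P i" "reach P i l" "l \<noteq> i"
  shows "tz l fps_X $ 0 = 0"
proof -
  interpret inv: series_iso Q N P M "inv_into M \<psi>" by (rule inverse_iso)
  interpret inv2: series_iso P M Q N "inv_into N (inv_into M \<psi>)" by (rule inv.inverse_iso)
  have sl: "singleton_class P l" by (rule p.sink_singleton[OF l])
  have il: "inv.sg (sg l) = l" "inv.sg (sg i) = i" using inv_sg[OF sl] inv_sg[OF i(1)] by auto
  have lQ: "sink Q (sg l)" using l by (simp add: sink_iff)
  have iQ: "singleton_class Q (sg i)" "cyclic Q (sg i)" "reach Q (sg i) (sg l)" "sg l \<noteq> sg i"
    using i by (auto simp: singleton_iff cyclic_iff reach_iff)
  have rl: "rate P l = 1" "rate Q (sg l) = 1"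
    using p.rate_recurrent[OF p.sink_recurrent[OF l]] q.rate_recurrent[OF q.sink_recurrent[OF lQ]] by auto
  have PX: "P l l > 0" "P i i > 0" "Q (sg l) (sg l) > 0" "Q (sg i) (sg i) > 0"
    using p.sink_mpow[OF l, of "Suc 0"] q.sink_mpow[OF lQ, of "Suc 0"] p.singleton_loop[OF i(2,1)] q.singleton_loop[OF iQ(2,1)]
    by auto
  note X = PX(1,2)[THEN p.M_edge] PX(3,4)[THEN q.M_edge]
  have ti: "tz i fps_X = tz l fps_X" by (rule tz_link[OF i(3) X(2,1)])
  have hi: "inv.tz (sg i) fps_X = inv.tz (sg l) fps_X" by (rule inv.tz_link[OF iQ(3) X(4,3)])
  define t h where "t = eval_fps (tz l fps_X)" and "h = eval_fps (inv.tz (sg l) fps_X)"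
  define rP rQ where "rP = rate P i" and "rQ = rate Q (sg i)"
  have r: "0 < rP" "rP < 1" "0 < rQ" "rQ < 1"
    unfolding rP_def rQ_def using p.rate_cyclic[OF i(2)] q.rate_cyclic[OF iQ(2)]
      p.singleton_rate_less[OF i(1,3,4)] q.singleton_rate_less[OF iQ(1,3,4)] by auto
  define S S' where "S = 1 / sqrt rP" and "S' = 1 / sqrt rQ"
  have S: "S > 1" "S' > 1" using r by (auto simp: S_def S'_def)
  have lt: "(cmod z)\<^sup>2 * x < 1" if "cmod z < 1 / sqrt x" "x > 0" for z :: complex and x
  proof -
    have "cmod z * sqrt x < 1" using that by (simp add: field_simps)
    then have "(cmod z * sqrt x)\<^sup>2 < 1" using that by (intro power_less_one_iff[THEN iffD2]) (auto simp: power_less_one_iff abs_square_less_1)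
    then show ?thesis using that by (simp add: power_mult_distrib)
  qed
  have le: "cmod y \<le> 1 / sqrt x" if "(cmod y)\<^sup>2 * x \<le> 1" "x > 0" for y :: complex and x
  proof -
    have "sqrt ((cmod y)\<^sup>2 * x) \<le> sqrt 1" using that(1) by (simp only: real_sqrt_le_iff)
    then show ?thesis using that(2) by (simp add: real_sqrt_mult field_simps)
  qed
  have tb: "cmod (t z) \<le> S" "ereal (cmod z) < fps_conv_radius (tz l fps_X)" if "cmod z < S'" for z
  proof -
    have 1: "(cmod z)\<^sup>2 * rate Q (sg i) < 1" using lt[of z rQ] that r by (simp add: S'_def rQ_def)
    from tz_bound[of 1 i z, OF _ _ 1] PX(2) have "(cmod (t z))\<^sup>2 * rP \<le> 1" by (simp add: t_def ti rP_def)
    then show "cmod (t z) \<le> S" using le[of "t z" rP] r by (simp add: S_def)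
    show "ereal (cmod z) < fps_conv_radius (tz l fps_X)" using tz_conv[OF X(2) 1] by (simp add: ti)
  qed
  have hb: "cmod (h z) \<le> S'" "ereal (cmod z) < fps_conv_radius (inv.tz (sg l) fps_X)" if "cmod z < S" for z
  proof -
    have 1: "(cmod z)\<^sup>2 * rate P (inv.sg (sg i)) < 1" using lt[of z rP] that r by (simp add: S_def rP_def il)
    from inv.tz_bound[of 1 "sg i" z, OF _ _ 1] PX(4) have "(cmod (h z))\<^sup>2 * rQ \<le> 1" by (simp add: h_def hi rQ_def)
    then show "cmod (h z) \<le> S'" using le[of "h z" rQ] r by (simp add: S'_def)
    show "ereal (cmod z) < fps_conv_radius (inv.tz (sg l) fps_X)" using inv.tz_conv[OF X(4) 1] by (simp add: hi)
  qed
  have "t 0 = 0"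
  proof (rule disc_pair_fixes_centre[of t S' S h])
    show "t holomorphic_on ball 0 S'" unfolding t_def
      by (intro holomorphic_on_eval_fps) (use tb(2) in auto)
    show "h holomorphic_on ball 0 S" unfolding h_def
      by (intro holomorphic_on_eval_fps) (use hb(2) in auto)
    show "cmod (t z) \<le> 1" if "cmod z < 1" for z
      using tz_bound[of 1 l z] that PX(1) le[of "t z" 1] lt[of z 1] by (simp add: t_def rl)
    show "cmod (h z) \<le> 1" if "cmod z < 1" for z
      using inv.tz_bound[of 1 "sg l" z] that PX(3) le[of "h z" 1] lt[of z 1] by (simp add: h_def rl il)
    show "h (t z) = z" if "cmod z < 1" for z
      using sink_inverse[OF l i that] by (simp add: h_def t_def)
    show "t (h z) = z" if "cmod z < 1" for z
    proof -
      have "inv2.tz l fps_X = tz l fps_X" unfolding inv2.tz_def tz_def by (simp add: inv_inv[OF X(1)])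
      then show ?thesis using inv.sink_inverse[OF lQ iQ that] by (simp add: h_def t_def il)
    qed
  qed (use S tb(1) hb(1) in auto)
  then show ?thesis by (simp add: t_def eval_fps_at_0)
qed

text \<open>Evaluation at 0 on the corner at sg j pulls back to evaluation at 0 on the monomials of
  the corner at j: the vacuum is kept there.\<close>

definition good :: "'a \<Rightarrow> bool" where
  "good j \<longleftrightarrow> (\<forall>s\<ge>1. mpow P s j j > 0 \<longrightarrow> tz j (fps_X ^ s) $ 0 = 0)"

lemma tz_power: assumes "un j j f \<in> M" shows "un j j (f ^ k) \<in> M \<and> tz j (f ^ k) = tz j f ^ k"
proof (induction k)
  case (Suc k)
  have "mm (un j j f) (un j j (f ^ k)) \<in> M" using Suc assms by (intro p.M_mm) auto
  then show ?case using Suc assms by (simp add: mm_un_un tz_mult)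
qed (simp add: tz_1 p.M_unit)

text \<open>Any two monomials of positive degree in the corner have a common power, so their scalars
  vanish at 0 together.\<close>

lemma goodI: assumes s0: "s0 \<ge> 1" "mpow P s0 j j > 0" "tz j (fps_X ^ s0) $ 0 = 0" shows "good j"
  unfolding good_def
proof (intro allI impI)
  fix s assume s: "s \<ge> (1::nat)" "mpow P s j j > 0"
  have "tz j (fps_X ^ s) ^ s0 = tz j (fps_X ^ (s * s0))"
    using tz_power[OF p.M_monom[OF s(2)], of s0] by (simp add: power_mult)
  also have "\<dots> = tz j (fps_X ^ s0) ^ s"
    using tz_power[OF p.M_monom[OF s0(2)], of s] by (simp add: power_mult[symmetric] mult.commute)
  finally have "(tz j (fps_X ^ s) $ 0) ^ s0 = (tz j (fps_X ^ s0) $ 0) ^ s" by (metis fps_power_zeroth)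
  then show "tz j (fps_X ^ s) $ 0 = 0" using s0 s by (simp add: power_0_left)
qed

text \<open>An idempotent exponent D is a cycle length at both states at once, and
  \<open>tz_link\<close> identifies the two scalars of z^D.\<close>

lemma good_link: assumes "cyclic P i" "cyclic P l" "reach P i l" shows "good i \<longleftrightarrow> good l"
proof -
  obtain D where D: "idem_exp P D" using p.idem_exp_exists by blast
  have D1: "D \<ge> 1" using D by (simp add: idem_exp_def)
  note pos = p.idem_exp_cyclic[OF D assms(1)] p.idem_exp_cyclic[OF D assms(2)]
  have "tz i (fps_X ^ D) = tz l (fps_X ^ D)" by (rule tz_link[OF assms(3) p.M_monom[OF pos(1)] p.M_monom[OF pos(2)]])
  then show ?thesis using D1 pos goodI[of D i] goodI[of D l] unfolding good_def by metis
qed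

lemma offdiag_const: assumes "un i j f \<in> M" "i \<noteq> j" shows "ordge 1 (\<psi> (un i j f))"
proof (rule corner_ord)
  show "incorner i j (\<psi> (un i j f))" by (rule incorner_\<psi>[OF assms(1)])
  show "\<psi> (un i j f) (sg i) (sg j) $ m = 0" if "m < 1" for m
    using q.M_supp0[OF \<psi>_in[OF assms(1)], of "sg i" "sg j"] assms(2) that by simp
qed

text \<open>A loop at j through another state k factors through two off-diagonal corners, and images
  of off-diagonal elements have no constant term.\<close>

lemma good_class: assumes "comm P j k" "k \<noteq> j" shows "good j"
proof -
  obtain a b where ab: "mpow P a j k > 0" "mpow P b k j > 0" using assms(1) by (auto simp: comm_def reach_def)
  have "a \<noteq> 0" using ab(1) assms(2) by (cases "a = 0") auto
  have X: "un j k (fps_X ^ a) \<in> M" "un k j (fps_X ^ b) \<in> M" using ab by (auto intro: p.M_monom)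
  have "\<psi> (un j j (fps_X ^ (a + b))) = mm (\<psi> (un j k (fps_X ^ a))) (\<psi> (un k j (fps_X ^ b)))"
    using X by (simp add: \<psi>_mm[symmetric] mm_un_un power_add)
  moreover have "ordge (1 + 1) (mm (\<psi> (un j k (fps_X ^ a))) (\<psi> (un k j (fps_X ^ b))))"
    using X assms(2) by (intro ordge_mm offdiag_const) auto
  ultimately have "tz j (fps_X ^ (a + b)) $ 0 = 0" by (simp add: tz_def mtrace_def ordge_def fps_sum_nth)
  then show ?thesis using p.mpow_pos_add[OF ab] \<open>a \<noteq> 0\<close> by (intro goodI[of "a + b"]) auto
qed

lemma good_sink_pair:
  assumes "sink P l" "singleton_class P i" "cyclic P i" "reach P i l" "l \<noteq> i"
  shows "good l"
  using sink_pair_vacuum[OF assms] p.sink_mpow[OF assms(1), of 1] by (intro goodI[of 1]) auto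

text \<open>The sources are classes with several states (\<open>good_class\<close>) and absorbing
  states with a cyclic singleton predecessor (\<open>good_sink_pair\<close>);
  \<open>good_link\<close> carries goodness to the remaining states. A transient singleton j itself
  serves as predecessor of an absorbing state that it reaches.\<close>

lemma good_not_bad: assumes j: "cyclic P j" "\<not> bad P j" shows "good j"
proof (cases "singleton_class P j")
  case False
  then show ?thesis using good_class by (auto simp: singleton_class_def)
next
  case sj: True
  show ?thesis
  proof (cases "sink P j")
    case True
    then obtain i where i: "reach P i j" "cyclic P i" "i \<noteq> j" using j by (auto simp: bad_def)
    show ?thesis
    proof (cases "singleton_class P i")
      case True
      show ?thesis by (rule good_sink_pair[OF \<open>sink P j\<close> True i(2,1)]) (use i in auto)
    next
      case False
      then have "good i" using good_class by (auto simp: singleton_class_def)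
      then show ?thesis using good_link[OF i(2) j(1) i(1)] by simp
    qed
  next
    case False
    obtain l where l: "reach P j l" "recurrent P l" using p.recurrent_exists by blast
    have lj: "l \<noteq> j" using l False sj p.recurrent_singleton_sink by blast
    have cl: "cyclic P l" by (rule p.cyclic_recurrent[OF l(2)])
    have "good l"
    proof (cases "singleton_class P l")
      case True
      then show ?thesis using good_sink_pair[OF _ sj j(1) l(1) lj] p.recurrent_singleton_sink l(2) by blast
    next
      case False
      then show ?thesis using good_class by (auto simp: singleton_class_def)
    qed
    then show ?thesis using good_link[OF j(1) cl l(1)] by simp
  qed
qed

end

section \<open>Recovering the graph and the growth rates\<close>

context stoch
begin

text \<open>Every state on a path to j is acyclic, so the set of reachable states shrinks at each
  step.\<close>

lemma acyclic_path_length: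
  assumes "mpow P n i j > 0" "\<And>k. reach P k j \<Longrightarrow> \<not> cyclic P k"
  shows "n < card {w. reach P i w}"
  using assms(1)
proof (induction n arbitrary: i)
  case 0
  have "{w. reach P i w} \<noteq> {}" using reach_refl by blast
  then show ?case by (simp add: card_gt_0_iff)
next
  case (Suc n)
  then obtain k where k: "mpow P 1 i k > 0" "mpow P n k j > 0" using mpow_pos_split[of 1 n i j] by auto
  have "\<not> reach P k i"
  proof
    assume "reach P k i"
    then obtain m where "mpow P m k i > 0" by (auto simp: reach_def)
    from mpow_pos_add[OF k(1) this] have "cyclic P i" unfolding cyclic_def by (intro exI[of _ "1 + m"]) simp
    then show False using assms(2)[of i] Suc.prems by (auto intro: reachI)
  qed
  moreover have "reach P i k" using k(1) by (rule reachI)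
  ultimately have "{w. reach P k w} \<subset> {w. reach P i w}" using reach_trans by auto
  then have "card {w. reach P k w} < card {w. reach P i w}" by (simp add: psubset_card_mono)
  then show ?case using Suc.IH[OF k(2)] by simp
qed

lemma sink_edge: "sink P k \<Longrightarrow> P k j > 0 \<Longrightarrow> j = k"
  by (auto simp: sink_def dest: reach_edge)

end

lemma un_apply: "un i j f a b = (if a = i \<and> b = j then f else 0)"
  by (simp add: un_def)

lemma fps_cutoff_Suc: "fps_cutoff (Suc n) f = fps_cutoff n f + fps_const (f $ n) * (fps_X ^ n :: complex fps)"
  by (rule fps_ext) (auto simp: fps_X_power_nth less_Suc_eq)

section \<open>Preservation of the order of vanishing, and of the edges\<close>

context series_iso
begin

text \<open>The last edge is split off. If it is off-diagonal it adds order 1 because off-diagonal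
  entries have no constant term; if it is a loop, because its end point is good.\<close>

lemma monom_ordge: assumes "mpow P n i j > 0" "\<not> bad P j" shows "ordge n (\<psi> (un i j (fps_X ^ n)))"
  using assms
proof (induction n arbitrary: j)
  case (Suc n)
  obtain k where k: "mpow P n i k > 0" "mpow P 1 k j > 0"
    using p.mpow_pos_split[of n 1 i j] Suc.prems by auto
  have kj: "P k j > 0" using k(2) by simp
  \<comment> \<open>A bad state is absorbing, so a bad k with an edge to j would be j
    itself.\<close>
  have "\<not> bad P k" using p.sink_edge[OF _ kj] Suc.prems(2) by (auto simp: bad_def)
  then have IH: "ordge n (\<psi> (un i k (fps_X ^ n)))" by (rule Suc.IH[OF k(1)])
  have X: "un i k (fps_X ^ n) \<in> M" "un k j fps_X \<in> M" using k(1) kj by (auto intro: p.M_monom p.M_edge)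
  have 1: "ordge 1 (\<psi> (un k j fps_X))"
  proof (cases "k = j")
    case True
    have "cyclic P j" using kj True by (intro p.loop_cyclic) simp
    then have "good j" using Suc.prems(2) by (rule good_not_bad)
    then have "tz j (fps_X ^ 1) $ 0 = 0" using k(2) True unfolding good_def by blast
    then have "\<psi> (un j j fps_X) (sg j) (sg j) $ 0 = 0"
      using corner_mtrace_0[OF incorner_\<psi>[of j j fps_X]] X(2) True by (simp add: tz_def)
    then show ?thesis using X(2) unfolding True by (intro corner_ord[OF incorner_\<psi>]) auto
  qed (use offdiag_const X in auto)
  have "\<psi> (un i j (fps_X ^ Suc n)) = mm (\<psi> (un i k (fps_X ^ n))) (\<psi> (un k j fps_X))"
    using X by (simp add: \<psi>_mm[symmetric] mm_un_un mult.commute)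
  then show ?case using ordge_mm(1)[OF IH 1] by simp
qed simp

lemma cutoff_ordge:
  assumes "un i j h \<in> M" "\<not> bad P j" "\<And>m. m < n \<Longrightarrow> h $ m = 0"
  shows "ordge n (\<psi> (un i j (fps_cutoff L h)))"
proof (induction L)
  case 0
  have "un i j (fps_cutoff 0 h) = (\<lambda>_ _. 0)" by (auto simp: un_def fun_eq_iff fps_cutoff_def fps_eq_iff)
  then show ?case by (simp add: \<psi>_zero)
next
  case (Suc L)
  show ?case
  proof (cases "h $ L = 0")
    case True
    then show ?thesis using Suc by (simp add: fps_cutoff_Suc)
  next
    case False
    then have pos: "mpow P L i j > 0" using p.M_supp[OF assms(1), of i j L] by simp
    note X = p.M_monom[OF pos]
    have "n \<le> L" using False assms(3)[of L] by (rule_tac ccontr) auto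
    then have "ordge n (\<psi> (un i j (fps_X ^ L)))" using monom_ordge[OF pos assms(2)] ordge_mono by blast
    then have "ordge n (madd (\<psi> (un i j (fps_cutoff L h))) (mscale (h $ L) (\<psi> (un i j (fps_X ^ L)))))"
      using Suc by (intro ordge_madd ordge_mscale)
    also have "madd (\<psi> (un i j (fps_cutoff L h))) (mscale (h $ L) (\<psi> (un i j (fps_X ^ L))))
        = \<psi> (un i j (fps_cutoff (Suc L) h))"
      unfolding fps_cutoff_Suc madd_un[symmetric] mscale_un[symmetric]
      using X p.M_cutoff[OF assms(1)] p.M_mscale[OF X] by (simp add: \<psi>_madd \<psi>_mscale)
    finally show ?thesis .
  qed
qed

text \<open>A tail of high order becomes divisible by a high power of \<open>z\<^sup>D\<close> in the corner of a recurrent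
  state \<open>l\<close> after multiplication by a fixed monomial, and leading terms multiply.\<close>

lemma filtered:
  assumes h: "un i j h \<in> M" and j: "\<not> bad P j" and n: "\<And>m. m < n \<Longrightarrow> h $ m = 0"
  shows "ordge n (\<psi> (un i j h))"
proof (cases "\<exists>l. reach P j l \<and> recurrent P l \<and> \<not> bad P l")
  case True
  then obtain l where l: "reach P j l" "recurrent P l" "\<not> bad P l" by blast
  obtain D where D: "idem_exp P D" using p.idem_exp_exists by blast
  have D1: "D \<ge> 1" using D by (simp add: idem_exp_def)
  obtain s where s: "mpow P s j l > 0" using l(1) by (auto simp: reach_def)
  define Y where "Y = \<psi> (un j l (fps_X ^ s))"
  have Ys: "un j l (fps_X ^ s) \<in> M" by (rule p.M_monom[OF s])
  have Yc: "incorner j l Y" unfolding Y_def by (rule incorner_\<psi>[OF Ys])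
  obtain b where b: "ordge b Y" "Y (sg j) (sg l) $ b \<noteq> 0" unfolding Y_def by (rule monom_order[OF s])
  \<comment> \<open>A multiple of D that is at least n + b; multiplication by Y can raise the order
    by b, which is to be subtracted at the end.\<close>
  define K where "K = Suc (n + b) * D"
  \<comment> \<open>Removing L terms leaves only exponents from D on in the quotient G, where
    supports are D-periodic and division by z^K is admissible.\<close>
  define L where "L = K + D + n"
  define ht where "ht = h - fps_cutoff L h"
  have ht: "ht $ m = (if m < L then 0 else h $ m)" for m by (simp add: ht_def)
  have cM: "un i j (fps_cutoff L h) \<in> M" by (rule p.M_cutoff[OF h])
  have "un i j ht = madd (un i j h) (mscale (-1) (un i j (fps_cutoff L h)))"
    by (auto simp: ht_def madd_def mscale_def un_def fun_eq_iff fps_eq_iff)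
  then have htM: "un i j ht \<in> M" using h cM by (simp add: p.M_madd p.M_mscale)
  have "\<psi> (un i j h) = madd (\<psi> (un i j (fps_cutoff L h))) (\<psi> (un i j ht))"
    using cM htM by (simp add: \<psi>_madd[symmetric] madd_un ht_def)
  moreover have "ordge n (\<psi> (un i j (fps_cutoff L h)))" by (rule cutoff_ordge[OF h j n])
  moreover have "ordge n (\<psi> (un i j ht))"
  proof (cases "\<psi> (un i j ht) = (\<lambda>_ _. 0)")
    case False
    note hc = incorner_\<psi>[OF htM]
    obtain a where a: "ordge a (\<psi> (un i j ht))" "\<psi> (un i j ht) (sg i) (sg j) $ a \<noteq> 0"
      using corner_order_exists[OF hc False] by blast
    define G where "G = fps_shift K (ht * fps_X ^ s)"
    have low: "(ht * fps_X ^ s) $ m = 0" if "m < L" for m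
      using that by (auto simp: fps_X_power_mult_right_nth ht)
    have F: "ht * fps_X ^ s = fps_X ^ K * G"
    proof (rule fps_ext)
      fix m
      show "(ht * fps_X ^ s) $ m = (fps_X ^ K * G) $ m"
        unfolding fps_X_power_mult_nth G_def fps_shift_nth using low[of m] by (auto simp: L_def)
    qed
    have FM: "un i l (ht * fps_X ^ s) \<in> M" using p.M_mm[OF htM Ys] by (simp add: mm_un_un)
    have shift: "mpow P (m + K) i l > 0 \<longleftrightarrow> mpow P m i l > 0" if "m \<ge> D" for m
      unfolding K_def by (rule p.idem_exp_shift[OF D that])
    have GM: "un i l G \<in> M"
    proof (rule p.M_div[of i l K G i])
      show "un i l (fps_X ^ K * G) \<in> M" using FM F by simp
      show "mpow P m i l > 0" if "G $ m \<noteq> 0" for m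
      proof -
        have F0: "(ht * fps_X ^ s) $ (m + K) \<noteq> 0" using that by (simp add: G_def)
        then have "m + K \<ge> L" using low[of "m + K"] by (rule_tac ccontr) auto
        then have "m \<ge> D" by (simp add: L_def)
        then show ?thesis using shift p.M_supp[OF FM, of i l "m + K"] F0 by simp
      qed
      show "finite {m. mpow P (m + K) i l > 0 \<and> mpow P m i l = 0}"
      proof (rule finite_subset)
        show "{m. mpow P (m + K) i l > 0 \<and> mpow P m i l = 0} \<subseteq> {..<D}"
          using shift by (auto simp: not_less) (metis less_irrefl not_less)
      qed auto
    qed (rule l(2))
    have posK: "mpow P K l l > 0"
      using p.idem_exp_cyclic[OF D p.cyclic_recurrent[OF l(2)]] unfolding K_def by (rule p.mpow_pos_mult)
    have "\<psi> (un i l (ht * fps_X ^ s)) = mm (\<psi> (un i l G)) (\<psi> (un l l (fps_X ^ K)))"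
      unfolding F using GM p.M_monom[OF posK] by (simp add: \<psi>_mm[symmetric] mm_un_un mult.commute)
    moreover have "ordge (0 + K) (mm (\<psi> (un i l G)) (\<psi> (un l l (fps_X ^ K))))"
      by (rule ordge_mm(1)) (use monom_ordge[OF posK l(3)] in auto)
    moreover have "\<psi> (un i l (ht * fps_X ^ s)) = mm (\<psi> (un i j ht)) Y"
      unfolding Y_def using htM Ys by (simp add: \<psi>_mm[symmetric] mm_un_un)
    ultimately have oK: "ordge K (mm (\<psi> (un i j ht)) Y)" by simp
    have "mm (\<psi> (un i j ht)) Y (sg i) (sg l) $ (a + b) \<noteq> 0"
      using corner_lead_mm[OF hc a(1) Yc b(1)] a(2) b(2) by simp
    \<comment> \<open>The product has a nonzero coefficient at a + b, so a + b is at least K and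
      hence at least n + b.\<close>
    then have "\<not> a + b < K" using oK by (auto simp: ordge_def)
    moreover have "K \<ge> n + b" unfolding K_def using D1 mult_le_mono2[of 1 D "Suc (n + b)"] by simp
    ultimately show ?thesis using a(1) ordge_mono[of a _ n] by simp
  qed simp
  ultimately show ?thesis using ordge_madd by simp
next
  case False
  \<comment> \<open>All recurrent states beyond j are bad here. A bad state has no cyclic ancestor
    but itself, so no cyclic state reaches j and h is a polynomial.\<close>
  obtain l where l: "reach P j l" "recurrent P l" using p.recurrent_exists by blast
  with False have lb: "bad P l" by blast
  then have jl: "j \<noteq> l" using j by auto
  have acyc: "\<not> cyclic P k" if "reach P k j" for k
  proof
    assume "cyclic P k"
    then have "k = l" using lb that l(1) p.reach_trans unfolding bad_def by blast
    then have "j = l" using lb that by (auto simp: bad_def sink_def)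
    then show False using jl by simp
  qed
  define L where "L = card {w. reach P i w}"
  have "h $ m = 0" if "m \<ge> L" for m
    using p.acyclic_path_length[of m i j] acyc that p.M_supp[OF h, of i j m] unfolding L_def by fastforce
  then have "fps_cutoff L h = h" by (intro fps_ext) auto
  moreover have "ordge n (\<psi> (un i j (fps_cutoff L h)))" by (rule cutoff_ordge[OF h j n])
  ultimately show ?thesis by simp
qed

text \<open>Because the constant term is a matrix unit, the coefficient of z in
  \<open>e i = mm (e i) (e i)\<close> at this position reads x = 2 * x.\<close>

lemma e_first: "e i (sg i) (sg i) $ 1 = 0"
proof -
  have "e i (sg i) (sg i) $ 1 = mm (e i) (e i) (sg i) (sg i) $ 1" by (simp add: e_mult)
  also have "\<dots> = (\<Sum>k\<in>UNIV. e i (sg i) k $ 0 * e i k (sg i) $ 1 + e i (sg i) k $ 1 * e i k (sg i) $ 0)"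
    by (simp add: mm_def fps_sum_nth fps_mult_nth)
  also have "\<dots> = (\<Sum>k\<in>UNIV. if k = sg i then 2 * e i (sg i) (sg i) $ 1 else 0)"
    by (rule sum.cong) (auto simp: e_const)
  finally show ?thesis by simp
qed

text \<open>Serves bad l, which \<open>monom_ordge\<close> excludes. Since n steps cannot lead to l,
  the last edge comes from a different state k, which is therefore not absorbing and not
  bad.\<close>

lemma minimal_monom_order:
  assumes "mpow P (Suc n) i l > 0" "mpow P n i l = 0"
  shows "ordge (Suc n) (\<psi> (un i l (fps_X ^ Suc n)))"
proof -
  obtain k where k: "mpow P n i k > 0" "mpow P 1 k l > 0" using p.mpow_pos_split[of n 1 i l] assms by auto
  have kl: "P k l > 0" "k \<noteq> l" using k assms(2) by auto
  have "\<not> bad P k" using p.sink_edge[OF _ kl(1)] kl(2) by (auto simp: bad_def)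
  from monom_ordge[OF k(1) this] have "ordge n (\<psi> (un i k (fps_X ^ n)))" .
  moreover have "ordge 1 (\<psi> (un k l fps_X))" by (rule offdiag_const[OF p.M_edge[OF kl(1)] kl(2)])
  ultimately have "ordge (n + 1) (mm (\<psi> (un i k (fps_X ^ n))) (\<psi> (un k l fps_X)))" by (rule ordge_mm)
  then show ?thesis
    using p.M_monom[OF k(1)] p.M_edge[OF kl(1)] by (simp add: \<psi>_mm[symmetric] mm_un_un mult.commute)
qed

text \<open>For j not bad, h is a constant plus a part of order at least 2, to which
  \<open>filtered\<close> applies. For j bad, h is divisible by its shortest monomial z^s, and s is
  at least 2 because i differs from j and there is no edge.\<close>

lemma no_edge:
  assumes ij: "\<not> P i j > 0" and h: "un i j h \<in> M"
  shows "\<psi> (un i j h) (sg i) (sg j) $ 1 = 0"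
proof (cases "bad P j")
  case False
  have h1: "h $ 1 = 0" using p.M_supp[OF h, of i j 1] ij by auto
  define c where "c = h $ 0"
  define h' where "h' = h + fps_const (- c)"
  have c: "c = 0" if "i \<noteq> j" using p.M_supp0[OF h that] by (simp add: c_def)
  have cM: "un i j (fps_const x) \<in> M \<and> \<psi> (un i j (fps_const x)) (sg i) (sg j) $ 1 = 0" if "i = j \<or> x = 0" for x
  proof (cases "i = j")
    case True
    then show ?thesis using uc \<psi>_uc e_first by (simp add: mscale_def)
  next
    case False
    then have "un i j (fps_const x) = (\<lambda>_ _. 0)" using that by (auto simp: un_def)
    then show ?thesis by (simp add: p.M_zero \<psi>_zero)
  qed
  have cc: "i = j \<or> c = 0" "i = j \<or> - c = 0" using c by auto
  have h': "un i j h' \<in> M" unfolding h'_def madd_un[symmetric] using h cM[OF cc(2)] by (intro p.M_madd) auto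
  have "ordge 2 (\<psi> (un i j h'))"
  proof (rule filtered[OF h' False])
    fix m :: nat assume "m < 2"
    then show "h' $ m = 0" using h1 by (cases "m = 0") (auto simp: h'_def c_def less_2_cases_iff)
  qed
  moreover have "h' + fps_const c = h" by (rule fps_ext) (simp add: h'_def)
  then have "\<psi> (un i j h) = madd (\<psi> (un i j h')) (\<psi> (un i j (fps_const c)))"
    using h' cM[OF cc(1)] by (simp add: \<psi>_madd[symmetric] madd_un)
  ultimately show ?thesis using cM[OF cc(1)] by (simp add: madd_def ordge_def)
next
  case True
  then have sj: "sink P j" by (simp add: bad_def)
  have Pj: "mpow P n j j = 1" for n by (rule p.sink_mpow[OF sj])
  have ne: "i \<noteq> j" using ij Pj[of "Suc 0"] by auto
  show ?thesis
  proof (cases "h = 0")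
    case True
    then have "un i j h = (\<lambda>_ _. 0)" by (auto simp: un_def)
    then show ?thesis by (simp add: \<psi>_zero)
  next
    case False
    then obtain n where "h $ n \<noteq> 0" by (auto simp: fps_eq_iff)
    then have ex: "\<exists>n. mpow P n i j > 0" using p.M_supp[OF h, of i j n] by auto
    define s where "s = (LEAST n. mpow P n i j > 0)"
    have s: "mpow P s i j > 0" unfolding s_def using ex by (rule LeastI_ex)
    have smin: "\<not> mpow P m i j > 0" if "m < s" for m using that not_less_Least unfolding s_def by blast
    have "s \<noteq> 0" using s ne by (auto intro!: gr0I)
    moreover have "s \<noteq> 1" using s ij by auto
    ultimately obtain s' where s': "s = Suc s'" "s' \<ge> 1" by (cases s) auto
    define G where "G = fps_shift s h"
    have hG: "h = fps_X ^ s * G"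
    proof (rule fps_ext)
      fix m show "h $ m = (fps_X ^ s * G) $ m"
        using smin[of m] p.M_supp[OF h, of i j m] by (auto simp: G_def fps_X_power_mult_nth)
    qed
    \<comment> \<open>At an absorbing state every exponent is admissible, so the quotient stays in
      the algebra.\<close>
    have GM: "un j j G \<in> M"
      by (rule p.M_div[of i j s G]) (use h hG p.sink_recurrent[OF sj] Pj in auto)
    have o: "ordge s (\<psi> (un i j (fps_X ^ s)))"
      unfolding s'(1) by (rule minimal_monom_order) (use s smin[of s'] p.mpow_pos_iff s'(1) in auto)
    have "ordge (s + 0) (mm (\<psi> (un i j (fps_X ^ s))) (\<psi> (un j j G)))" by (rule ordge_mm(1)[OF o]) simp
    also have "mm (\<psi> (un i j (fps_X ^ s))) (\<psi> (un j j G)) = \<psi> (un i j h)"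
      using p.M_monom[OF s] GM by (simp add: \<psi>_mm[symmetric] mm_un_un hG[symmetric])
    finally show ?thesis using s' by (simp add: ordge_def)
  qed
qed

lemma edge_reflect: assumes "Q (sg i) (sg j) > 0" shows "P i j > 0"
proof (rule ccontr)
  assume no: "\<not> P i j > 0"
  obtain X where "X \<in> M" "\<psi> (un i j (X i j)) (sg i) (sg j) $ 1 = 1"
    using preimage_monom[of 1 i j] assms by auto
  then show False using no_edge[OF no p.M_corner[of X i j]] by simp
qed

lemma card_edges_le: "card {(a, b). Q a b > 0} \<le> card {(i, j). P i j > 0}"
proof (rule surj_card_le)
  show "{(a, b). Q a b > 0} \<subseteq> (\<lambda>(i, j). (sg i, sg j)) ` {(i, j). P i j > 0}"
  proof clarify
    fix a b assume ab: "Q a b > 0"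
    obtain i j where "a = sg i" "b = sg j" using sg_surj[of a] sg_surj[of b] by metis
    then show "(a, b) \<in> (\<lambda>(i, j). (sg i, sg j)) ` {(i, j). P i j > 0}" using edge_reflect ab by force
  qed
qed simp

text \<open>\<open>edge_reflect\<close> gives one inclusion, and the permutation of the inverse is
  not known to invert \<open>sg\<close>. The finite edge sets agree because their sizes are compared
  in both directions.\<close>

lemma edge_iff: "P i j > 0 \<longleftrightarrow> Q (sg i) (sg j) > 0"
proof -
  interpret inv: series_iso Q N P M "inv_into M \<psi>" by (rule inverse_iso)
  let ?E = "{(i, j). P i j > 0}" and ?F = "{(i, j). Q (sg i) (sg j) > 0}"
  have sub: "?F \<subseteq> ?E" using edge_reflect by auto
  have "bij_betw (\<lambda>(i, j). (sg i, sg j)) ?F {(a, b). Q a b > 0}"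
    unfolding bij_betw_def
  proof
    show "inj_on (\<lambda>(i, j). (sg i, sg j)) ?F" by (auto simp: inj_on_def)
    show "(\<lambda>(i, j). (sg i, sg j)) ` ?F = {(a, b). Q a b > 0}"
    proof (intro set_eqI iffI)
      fix x assume x: "x \<in> {(a, b). Q a b > 0}"
      obtain i j where "x = (sg i, sg j)" using sg_surj by (metis surj_pair)
      then show "x \<in> (\<lambda>(i, j). (sg i, sg j)) ` ?F" using x by (auto intro!: image_eqI[of _ _ "(i, j)"])
    qed auto
  qed
  then have "card ?F = card {(a, b). Q a b > 0}" by (rule bij_betw_same_card)
  moreover have "card ?F \<le> card ?E" by (rule card_mono[OF _ sub]) simp
  ultimately have "card ?F = card ?E" using inv.card_edges_le by linarith
  then have "?F = ?E" using sub by (intro card_subset_eq) auto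
  then show ?thesis by blast
qed

lemma mpow_iff: "mpow P n i j > 0 \<longleftrightarrow> mpow Q n (sg i) (sg j) > 0"
proof (induction n arbitrary: j)
  case (Suc n)
  have "mpow P (n + 1) i j > 0 \<longleftrightarrow> (\<exists>k. mpow P n i k > 0 \<and> mpow P 1 k j > 0)"
    using p.mpow_pos_add p.mpow_pos_split by blast
  moreover have "mpow Q (n + 1) (sg i) (sg j) > 0 \<longleftrightarrow> (\<exists>k. mpow Q n (sg i) (sg k) > 0 \<and> mpow Q 1 (sg k) (sg j) > 0)"
    using q.mpow_pos_add q.mpow_pos_split sg_surj by metis
  ultimately show ?case using Suc edge_iff by simp
qed simp

end

section \<open>Coefficient estimates and equality of the growth rates\<close>

lemma fps_cauchy_bound:
  assumes conv: "\<And>z. cmod z < R \<Longrightarrow> ereal (cmod z) < fps_conv_radius f"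
    and B: "\<And>z. cmod z < R \<Longrightarrow> cmod (eval_fps f z) \<le> B" and r: "0 < r" "r < R"
  shows "cmod (f $ n) * r ^ n \<le> B"
proof -
  have hol: "eval_fps f holomorphic_on ball 0 R" by (intro holomorphic_on_eval_fps) (use conv in auto)
  have sub: "cball 0 r \<subseteq> ball (0::complex) R" using r by auto
  have "0 < fps_conv_radius f" using conv[of 0] r by (simp add: zero_ereal_def)
  then have "f $ n = (deriv ^^ n) (eval_fps f) 0 / fact n" by (rule fps_nth_conv_deriv)
  moreover have "cmod ((deriv ^^ n) (eval_fps f) 0) \<le> fact n * B / r ^ n"
  proof (rule Cauchy_inequality)
    show "eval_fps f holomorphic_on ball 0 r" using hol by (rule holomorphic_on_subset) (use r in auto)
    show "continuous_on (cball 0 r) (eval_fps f)"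
      using holomorphic_on_imp_continuous_on[OF hol] sub by (rule continuous_on_subset)
    show "cmod (eval_fps f x) \<le> B" if "cmod (0 - x) = r" for x using B[of x] that r by simp
  qed (use r in auto)
  ultimately have "cmod (f $ n) \<le> B / r ^ n" by (simp add: norm_divide divide_le_eq mult.commute)
  then show ?thesis using r by (simp add: pos_le_divide_eq)
qed

context series_iso
begin

text \<open>Cauchy's estimate for the bound in \<open>tz_bound\<close>, squared to keep the rates
  free of roots.\<close>

lemma tz_coeff_bound:
  assumes d: "d \<ge> 1" "mpow P d i i > 0" and r: "0 < r" "r\<^sup>2 * rate Q (sg i) < 1"
  shows "(cmod (tz i (fps_X ^ d) $ n) * r ^ n)\<^sup>2 * rate P i ^ d \<le> 1"
proof -
  let ?f = "tz i (fps_X ^ d)"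
  have rP: "rate P i > 0" using d by (intro p.rate_cyclic) (auto simp: cyclic_def)
  have rQ: "rate Q (sg i) > 0" using d cyclic_iff[of i] q.rate_cyclic[of "sg i"] by (auto simp: cyclic_def)
  define R where "R = 1 / sqrt (rate Q (sg i))"
  have zR: "(cmod z)\<^sup>2 * rate Q (sg i) < 1" if "cmod z < R" for z
  proof -
    have "cmod z * sqrt (rate Q (sg i)) < 1" using that rQ by (simp add: R_def field_simps)
    then have "(cmod z * sqrt (rate Q (sg i)))\<^sup>2 < 1" using rQ by (simp add: abs_square_less_1)
    then show ?thesis using rQ by (simp add: power_mult_distrib)
  qed
  have rR: "r < R"
  proof -
    have "sqrt (r\<^sup>2 * rate Q (sg i)) < sqrt 1" using r(2) by (simp only: real_sqrt_less_iff)
    then show ?thesis using r rQ by (simp add: R_def real_sqrt_mult field_simps)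
  qed
  define B where "B = 1 / sqrt (rate P i ^ d)"
  have "cmod (?f $ n) * r ^ n \<le> B"
  proof (rule fps_cauchy_bound[OF _ _ r(1) rR])
    show "ereal (cmod z) < fps_conv_radius ?f" if "cmod z < R" for z
      by (rule tz_conv[OF p.M_monom[OF d(2)] zR[OF that]])
    show "cmod (eval_fps ?f z) \<le> B" if "cmod z < R" for z
    proof -
      have "sqrt ((cmod (eval_fps ?f z))\<^sup>2 * rate P i ^ d) \<le> sqrt 1"
        using tz_bound[OF d zR[OF that]] by (simp only: real_sqrt_le_iff)
      then show ?thesis using rP by (simp add: B_def real_sqrt_mult field_simps)
    qed
  qed
  then have "(cmod (?f $ n) * r ^ n)\<^sup>2 \<le> B\<^sup>2" using r by (intro power_mono) auto
  then show ?thesis using rP by (simp add: B_def power_divide field_simps)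
qed

lemma recurrent_coeff_le_1:
  assumes l: "recurrent P l" and d: "d \<ge> 1" "mpow P d l l > 0"
  shows "cmod (tz l (fps_X ^ d) $ n) \<le> 1"
proof (rule ccontr)
  let ?c = "cmod (tz l (fps_X ^ d) $ n)"
  assume neg: "\<not> ?c \<le> 1"
  have rates: "rate P l = 1" "rate Q (sg l) = 1"
    using p.rate_recurrent[OF l] q.rate_recurrent[of "sg l"] l recurrent_iff by auto
  have b: "?c * r ^ n \<le> 1" if "0 < r" "r < 1" for r
  proof -
    have "r\<^sup>2 * rate Q (sg l) < 1" using that by (simp add: rates power_less_one_iff abs_square_less_1)
    from tz_coeff_bound[OF d that(1) this, of n] have "(?c * r ^ n)\<^sup>2 \<le> 1" by (simp add: rates)
    then show ?thesis using that by (simp add: abs_square_le_1)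
  qed
  have "(\<lambda>k. ?c * (1 - inverse (real (Suc (Suc k)))) ^ n) \<longlonglongrightarrow> ?c * (1 - 0) ^ n"
    by (intro tendsto_intros LIMSEQ_Suc[OF LIMSEQ_inverse_real_of_nat])
  moreover have "?c * (1 - inverse (real (Suc (Suc k)))) ^ n \<le> 1" for k
    by (rule b) (auto simp: field_simps)
  ultimately have "?c * (1 - 0) ^ n \<le> 1" by (intro LIMSEQ_le_const2) auto
  then show False using neg by simp
qed

lemma tz_lead:
  assumes "mpow P D l l > 0" "\<not> bad P l"
  shows "\<psi> (un l l (fps_X ^ D)) a b $ D = (if a = sg l \<and> b = sg l then tz l (fps_X ^ D) $ D else 0)"
proof -
  let ?Z = "\<psi> (un l l (fps_X ^ D))"
  have c: "incorner l l ?Z" by (rule incorner_\<psi>[OF p.M_monom[OF assms(1)]])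
  have o: "ordge D ?Z" by (rule monom_ordge[OF assms])
  have z: "?Z x y $ D = 0" if "\<not> (x = sg l \<and> y = sg l)" for x y using corner_lead[OF c o, of x y] that by auto
  have "tz l (fps_X ^ D) $ D = (\<Sum>k\<in>UNIV. if k = sg l then ?Z (sg l) (sg l) $ D else 0)"
    unfolding tz_def mtrace_def fps_sum_nth by (rule sum.cong) (use z in auto)
  then show ?thesis using z[of a b] by auto
qed

text \<open>Subtracting ?c * z^d at sg l from the image of z^d leaves order above d. The inverse
  respects this order, so the coefficients of z^d after pulling back give 1 = ?c * c', where c' is
  the corresponding coefficient of the inverse and has modulus at most 1.\<close>

lemma recurrent_coeff_ge_1:
  assumes l: "recurrent P l" "\<not> bad P l" and d: "d \<ge> 1" "mpow P d l l > 0"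
  shows "cmod (tz l (fps_X ^ d) $ d) \<ge> 1"
proof -
  interpret inv: series_iso Q N P M "inv_into M \<psi>" by (rule inverse_iso)
  let ?s = "sg l" and ?c = "tz l (fps_X ^ d) $ d"
  let ?Z = "\<psi> (un l l (fps_X ^ d))" and ?W = "un (sg l) (sg l) (fps_X ^ d) :: 'a fpsmat"
  have Xl: "un l l (fps_X ^ d) \<in> M" by (rule p.M_monom[OF d(2)])
  have dQ: "mpow Q d ?s ?s > 0" using d(2) mpow_iff by simp
  have W: "?W \<in> N" by (rule q.M_monom[OF dQ])
  have Zc: "incorner l l ?Z" by (rule incorner_\<psi>[OF Xl])
  define X where "X = madd ?Z (mscale (- ?c) ?W)"
  have X: "X \<in> N" unfolding X_def by (intro q.M_madd q.M_mscale \<psi>_in Xl W)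
  have Xo: "X a b $ m = 0" if "m < Suc d" for a b m
  proof (cases "m = d")
    case True
    then show ?thesis by (simp add: X_def madd_def mscale_def tz_lead[OF d(2) l(2)] un_apply fps_X_power_nth)
  next
    case False
    then have "?Z a b $ m = 0" using monom_ordge[OF d(2) l(2)] that by (simp add: ordge_def)
    then show ?thesis using False by (simp add: X_def madd_def mscale_def un_apply fps_X_power_nth)
  qed
  \<comment> \<open>\<open>filtered\<close> for the inverse needs columns that are not bad. A
    nonzero column is reached from the recurrent state sg l, so a bad one could only be sg l
    itself.\<close>
  have Xb: "\<not> bad Q b" if "X a b \<noteq> 0" for a b
  proof
    assume bad: "bad Q b"
    have "(a = ?s \<and> b = ?s) \<or> e l a b \<noteq> 0"
      using that corner_mtrace[OF Zc, of a b] by (auto simp: X_def madd_def mscale_def un_apply split: if_splits)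
    then have "reach Q ?s b" using e_supp[of l a b] by auto
    moreover from this have "reach Q b ?s" using l(1) recurrent_iff by (auto simp: recurrent_def)
    ultimately have "b = ?s" using bad by (auto simp: bad_def sink_def)
    then show False using bad l(2) bad_iff by simp
  qed
  have "ordge (Suc d) (inv_into M \<psi> (un a b (X a b)))" for a b
  proof (cases "X a b = 0")
    case True
    then have "un a b (X a b) = (\<lambda>_ _. 0)" by (auto simp: un_def)
    then show ?thesis by (simp add: inv.\<psi>_zero)
  next
    case False
    show ?thesis by (rule inv.filtered[OF q.M_corner[OF X] Xb[OF False] Xo])
  qed
  moreover have "X = (\<lambda>x y. \<Sum>ab\<in>UNIV. un (fst ab) (snd ab) (X (fst ab) (snd ab)) x y)"
  proof (intro ext)
    fix x y
    have "(\<Sum>ab\<in>UNIV. un (fst ab) (snd ab) (X (fst ab) (snd ab)) x y)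
        = (\<Sum>ab\<in>UNIV. if ab = (x, y) then X x y else 0)"
      by (rule sum.cong) (auto simp: un_def)
    then show "X x y = (\<Sum>ab\<in>UNIV. un (fst ab) (snd ab) (X (fst ab) (snd ab)) x y)" by simp
  qed
  then have "inv_into M \<psi> X = (\<lambda>x y. \<Sum>ab\<in>UNIV. inv_into M \<psi> (un (fst ab) (snd ab) (X (fst ab) (snd ab))) x y)"
    using inv.\<psi>_sum[of UNIV "\<lambda>ab. un (fst ab) (snd ab) (X (fst ab) (snd ab))"] q.M_corner[OF X] by simp
  ultimately have oX: "inv_into M \<psi> X l l $ d = 0" by (simp add: ordge_def fps_sum_nth)
  have "?Z = madd X (mscale ?c ?W)" by (simp add: X_def madd_def mscale_def fun_eq_iff fps_eq_iff)
  then have "un l l (fps_X ^ d) = madd (inv_into M \<psi> X) (mscale ?c (inv_into M \<psi> ?W))"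
    using inv.\<psi>_madd[OF X q.M_mscale[OF W]] inv.\<psi>_mscale[OF W] inv_\<psi>[OF Xl] by metis
  then have "un l l (fps_X ^ d) l l $ d = inv_into M \<psi> X l l $ d + ?c * inv_into M \<psi> ?W l l $ d"
    by (simp add: madd_def mscale_def)
  then have 1: "1 = ?c * inv_into M \<psi> ?W l l $ d" using oX by (simp add: fps_X_power_nth)
  have sb: "\<not> bad Q ?s" using l(2) bad_iff by simp
  \<comment> \<open>The coefficient is nonzero, so \<open>inv.tz_lead\<close> can place it only at
    the position of the idempotent.\<close>
  have "inv_into M \<psi> ?W l l $ d = inv.tz ?s (fps_X ^ d) $ d"
    using 1 inv.tz_lead[OF dQ sb, of l l] by (auto split: if_splits)
  then have "cmod (inv_into M \<psi> ?W l l $ d) \<le> 1"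
    using inv.recurrent_coeff_le_1[OF _ d(1) dQ] l(1) recurrent_iff by simp
  moreover have "1 = cmod ?c * cmod (inv_into M \<psi> ?W l l $ d)" using 1 by (metis norm_mult norm_one)
  ultimately show ?thesis by (metis mult.commute mult_left_le norm_ge_zero)
qed

text \<open>At a recurrent state reached from i the coefficient of z^D has modulus at least 1, hence
  also at i by \<open>tz_link\<close>. Cauchy's estimate at i tolerates this only for the stated
  order of the rates.\<close>

lemma rate_le: "rate P i \<le> rate Q (sg i)"
proof (cases "cyclic P i \<and> \<not> recurrent P i")
  case True
  obtain l where l: "reach P i l" "recurrent P l" using p.recurrent_exists by blast
  have cl: "cyclic P l" by (rule p.cyclic_recurrent[OF l(2)])
  have nb: "\<not> bad P l" using True l by (auto simp: bad_def)
  obtain D where D: "idem_exp P D" using p.idem_exp_exists by blast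
  have D1: "D \<ge> 1" using D by (simp add: idem_exp_def)
  have pos: "mpow P D i i > 0" "mpow P D l l > 0" using p.idem_exp_cyclic[OF D] True cl by auto
  have tl: "tz i (fps_X ^ D) = tz l (fps_X ^ D)"
    by (rule tz_link[OF l(1)]) (use pos in \<open>auto intro: p.M_monom\<close>)
  have c: "cmod (tz i (fps_X ^ D) $ D) \<ge> 1" unfolding tl by (rule recurrent_coeff_ge_1[OF l(2) nb D1 pos(2)])
  have rP: "rate P i > 0" and rQ: "rate Q (sg i) > 0"
    using p.rate_cyclic q.rate_cyclic True cyclic_iff by auto
  show ?thesis
  proof (rule ccontr)
    assume neg: "\<not> ?thesis"
    then obtain x where x: "rate Q (sg i) < x" "x < rate P i" using dense by (metis not_le)
    have x0: "x > 0" using x rQ by simp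
    \<comment> \<open>This radius is admissible because x exceeds the rate of Q, and violates the
      estimate because x is below the rate of P.\<close>
    define r where "r = 1 / sqrt x"
    have r: "r > 0" "r\<^sup>2 * rate Q (sg i) < 1" "r\<^sup>2 = 1 / x" using x x0 by (auto simp: r_def power_divide)
    have "(r\<^sup>2 * rate P i) ^ D = (r ^ D)\<^sup>2 * rate P i ^ D" by (simp add: power_mult_distrib power_mult[symmetric] mult.commute)
    also have "\<dots> \<le> (cmod (tz i (fps_X ^ D) $ D) * r ^ D)\<^sup>2 * rate P i ^ D"
      using c r rP by (intro mult_right_mono power_mono) (auto simp: mult_le_cancel_right1)
    also have "\<dots> \<le> 1" by (rule tz_coeff_bound[OF D1 pos(1) r(1,2)])
    finally have "(r\<^sup>2 * rate P i) ^ D \<le> 1" .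
    moreover have "r\<^sup>2 * rate P i > 1" using r(3) x x0 by simp
    moreover have "D > 0" using D1 by simp
    ultimately show False by (meson not_le one_less_power)
  qed
next
  case False
  show ?thesis
  proof (cases "recurrent P i")
    case True
    then show ?thesis using p.rate_recurrent q.rate_recurrent recurrent_iff by simp
  next
    case nr: False
    then have "\<not> cyclic P i" using False by simp
    then have "mpow P n i i = 0" if "n \<ge> 1" for n using that p.mpow_pos_iff[of n i i] by (auto simp: cyclic_def)
    then have "rate P i \<le> 0" unfolding rate_def by (intro cSUP_least) auto
    then show ?thesis using q.rate_nonneg[of "sg i"] by simp
  qed
qed

text \<open>The inequality for the inverse, summed over all states, reverses the total, so no single
  inequality can be strict.\<close>

lemma rate_eq: "rate P i = rate Q (sg i)"
proof -
  interpret inv: series_iso Q N P M "inv_into M \<psi>" by (rule inverse_iso)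
  have 1: "(\<Sum>i\<in>UNIV. rate Q (sg i)) = (\<Sum>i\<in>UNIV. rate Q i)" using bij_sg by (rule sum.reindex_bij_betw)
  have 2: "(\<Sum>i\<in>UNIV. rate P (inv.sg i)) = (\<Sum>i\<in>UNIV. rate P i)" using inv.bij_sg by (rule sum.reindex_bij_betw)
  have "(\<Sum>i\<in>UNIV. rate Q i) \<le> (\<Sum>i\<in>UNIV. rate P i)" unfolding 2[symmetric] by (rule sum_mono) (rule inv.rate_le)
  then have "(\<Sum>i\<in>UNIV. rate Q (sg i) - rate P i) \<le> 0" using 1 by (simp add: sum_subtractf)
  moreover have "rate Q (sg i) - rate P i \<le> (\<Sum>i\<in>UNIV. rate Q (sg i) - rate P i)"
    by (rule member_le_sum) (use rate_le in auto)
  ultimately show ?thesis using rate_le[of i] by simp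
qed

end

section \<open>Operators on the Fock correspondence as matrices of power series\<close>

definition rt :: "('a::finite \<Rightarrow> 'a \<Rightarrow> real) \<Rightarrow> nat \<Rightarrow> 'a \<Rightarrow> 'a \<Rightarrow> complex" where
  "rt P n i j = complex_of_real (sqrt (mpow P n i j))"

text \<open>The denominator of U in degree n + m is the weight of that degree, so weighting the
  coefficients turns U into a Cauchy product.\<close>

definition fs :: "('a::finite \<Rightarrow> 'a \<Rightarrow> real) \<Rightarrow> 'a fock \<Rightarrow> 'a fpsmat" where
  "fs P \<xi> = (\<lambda>i j. Abs_fps (\<lambda>n. rt P n i j * \<xi> n i j))"

definition vac :: "('a::finite) fock" where
  "vac = (\<lambda>n i j. if n = 0 \<and> i = j then 1 else 0)"

text \<open>Outside the support the weight is 0 and division by 0 yields 0, so each component has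
  the support required by Arv(P)_n.\<close>

definition opof :: "('a::finite \<Rightarrow> 'a \<Rightarrow> real) \<Rightarrow> 'a fpsmat \<Rightarrow> 'a op" where
  "opof P X = (\<lambda>\<xi>. if inFock P \<xi> then (\<lambda>n i j. mm X (fs P \<xi>) i j $ n / rt P n i j) else fzero)"

definition supported :: "('a::finite \<Rightarrow> 'a \<Rightarrow> real) \<Rightarrow> 'a fpsmat \<Rightarrow> bool" where
  "supported P X \<longleftrightarrow> (\<forall>i j n. X i j $ n \<noteq> 0 \<longrightarrow> mpow P n i j > 0)"

definition colsum :: "('a::finite) fock \<Rightarrow> 'a \<Rightarrow> real" where
  "colsum \<xi> j = (\<Sum>n. \<Sum>i\<in>UNIV. (cmod (\<xi> n i j))\<^sup>2)"

definition wnorm :: "('a::finite \<Rightarrow> 'a \<Rightarrow> real) \<Rightarrow> 'a fpsmat \<Rightarrow> nat \<Rightarrow> real" where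
  "wnorm P X n = (\<Sum>i\<in>UNIV. \<Sum>j\<in>UNIV. cmod (X i j $ n) / sqrt (mpow P n i j))"

definition msub :: "('a::finite) fpsmat \<Rightarrow> 'a fpsmat \<Rightarrow> 'a fpsmat" where
  "msub X Y = (\<lambda>i j. X i j - Y i j)"

definition bnd :: "('a::finite \<Rightarrow> 'a \<Rightarrow> real) \<Rightarrow> 'a fpsmat \<Rightarrow> real \<Rightarrow> bool" where
  "bnd P X D \<longleftrightarrow> D \<ge> 0 \<and> supported P X \<and>
     (\<forall>\<xi>. inFock P \<xi> \<longrightarrow> inFock P (opof P X \<xi>) \<and> fock_norm (opof P X \<xi>) \<le> D * fock_norm \<xi>)"

definition polymat :: "('a::finite \<Rightarrow> 'a \<Rightarrow> real) \<Rightarrow> 'a fpsmat \<Rightarrow> bool" where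
  "polymat P X \<longleftrightarrow> supported P X \<and> (\<exists>N. \<forall>i j. \<forall>n\<ge>N. X i j $ n = 0)"

text \<open>The coefficient matrices of the operators in T_+(P), by \<open>Tplus_matrix\<close> and
  \<open>matrix_Tplus\<close>.\<close>

definition mat_Tplus :: "('a::finite \<Rightarrow> 'a \<Rightarrow> real) \<Rightarrow> 'a fpsmat set" where
  "mat_Tplus P = {X. supported P X \<and> (\<forall>e>0. \<exists>Y. polymat P Y \<and> bnd P (msub X Y) e)}"

section \<open>Norm estimates on the Fock module\<close>

lemma fock_norm_colsum: "fock_norm \<xi> = sqrt (Max (range (colsum \<xi>)))"
  by (simp add: fock_norm_def colsum_def[abs_def])

lemma inFock_summable: "inFock P \<xi> \<Longrightarrow> summable (\<lambda>n. \<Sum>i\<in>UNIV. (cmod (\<xi> n i j))\<^sup>2)"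
  by (simp add: inFock_def)

lemma inFock_arv: "inFock P \<xi> \<Longrightarrow> \<xi> n i j \<noteq> 0 \<Longrightarrow> mpow P n i j > 0"
  by (auto simp: inFock_def arv_def)

lemma colsum_nonneg: "inFock P \<xi> \<Longrightarrow> 0 \<le> colsum \<xi> j"
  unfolding colsum_def by (rule suminf_nonneg[OF inFock_summable]) (auto intro: sum_nonneg)

lemma colsum_le_norm: "inFock P \<xi> \<Longrightarrow> colsum \<xi> j \<le> (fock_norm \<xi>)\<^sup>2"
proof -
  assume f: "inFock P \<xi>"
  have "colsum \<xi> j \<le> Max (range (colsum \<xi>))" by (rule Max_ge) auto
  moreover have "0 \<le> Max (range (colsum \<xi>))" using calculation colsum_nonneg[OF f, of j] by linarith
  ultimately show ?thesis unfolding fock_norm_colsum by simp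
qed

lemma fock_norm_nonneg: "inFock P \<xi> \<Longrightarrow> 0 \<le> fock_norm \<xi>"
  unfolding fock_norm_colsum using colsum_nonneg[of P \<xi> undefined] by (auto intro!: order_trans[OF _ Max_ge])

lemma fock_norm_le: assumes "\<And>j. colsum \<xi> j \<le> D\<^sup>2" "D \<ge> 0" shows "fock_norm \<xi> \<le> D"
  unfolding fock_norm_colsum using assms by (intro real_le_lsqrt) auto

lemma comp_le_norm: assumes "inFock P \<xi>" shows "cmod (\<xi> n i j) \<le> fock_norm \<xi>"
proof -
  have "(cmod (\<xi> n i j))\<^sup>2 \<le> (\<Sum>i\<in>UNIV. (cmod (\<xi> n i j))\<^sup>2)" by (rule member_le_sum) auto
  also have "\<dots> = (\<Sum>n\<in>{n}. \<Sum>i\<in>UNIV. (cmod (\<xi> n i j))\<^sup>2)" by simp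
  also have "\<dots> \<le> colsum \<xi> j"
    unfolding colsum_def by (rule sum_le_suminf[OF inFock_summable[OF assms]]) (auto intro: sum_nonneg)
  also have "\<dots> \<le> (fock_norm \<xi>)\<^sup>2" by (rule colsum_le_norm[OF assms])
  finally show ?thesis by (rule power2_le_imp_le) (rule fock_norm_nonneg[OF assms])
qed

lemma inFock_bound:
  assumes "inFock P \<xi>" "\<And>n i j. \<zeta> n i j \<noteq> 0 \<Longrightarrow> mpow P n i j > 0"
    and le: "\<And>n j. (\<Sum>i\<in>UNIV. (cmod (\<zeta> n i j))\<^sup>2) \<le> C * (\<Sum>i\<in>UNIV. (cmod (\<xi> n i j))\<^sup>2)"
  shows "inFock P \<zeta>" "colsum \<zeta> j \<le> C * colsum \<xi> j"
proof -
  have s: "summable (\<lambda>n. C * (\<Sum>i\<in>UNIV. (cmod (\<xi> n i j))\<^sup>2))" for j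
    by (rule summable_mult[OF inFock_summable[OF assms(1)]])
  have z: "summable (\<lambda>n. \<Sum>i\<in>UNIV. (cmod (\<zeta> n i j))\<^sup>2)" for j
    by (rule summable_comparison_test[OF _ s[of j]]) (use le in \<open>auto simp: abs_of_nonneg sum_nonneg\<close>)
  then show "inFock P \<zeta>" using assms(2) by (auto simp: inFock_def arv_def)
  have "colsum \<zeta> j \<le> (\<Sum>n. C * (\<Sum>i\<in>UNIV. (cmod (\<xi> n i j))\<^sup>2))"
    unfolding colsum_def by (rule suminf_le[OF le z s])
  then show "colsum \<zeta> j \<le> C * colsum \<xi> j"
    unfolding colsum_def by (subst (asm) suminf_mult[OF inFock_summable[OF assms(1)]])
qed

text \<open>The factor 2 comes from |a + b|^2 <= 2 |a|^2 + 2 |b|^2; a constant factor is harmless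
  for norm closures.\<close>

lemma inFock_add:
  assumes "inFock P \<xi>" "inFock P \<eta>"
  shows "inFock P (\<lambda>n i j. \<xi> n i j + \<eta> n i j)"
    and "fock_norm (\<lambda>n i j. \<xi> n i j + \<eta> n i j) \<le> 2 * (fock_norm \<xi> + fock_norm \<eta>)"
proof -
  let ?s = "\<lambda>\<xi> n j. \<Sum>i\<in>UNIV. (cmod (\<xi> n i j))\<^sup>2"
  have sq: "(cmod (a + b))\<^sup>2 \<le> 2 * (cmod a)\<^sup>2 + 2 * (cmod b)\<^sup>2" for a b
  proof -
    have "(cmod (a + b))\<^sup>2 \<le> (cmod a + cmod b)\<^sup>2" by (intro power_mono norm_triangle_ineq) auto
    also have "\<dots> \<le> 2 * (cmod a)\<^sup>2 + 2 * (cmod b)\<^sup>2"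
      using zero_le_power2[of "cmod a - cmod b"] by (simp add: power2_eq_square algebra_simps)
    finally show ?thesis .
  qed
  have le: "?s (\<lambda>n i j. \<xi> n i j + \<eta> n i j) n j \<le> 2 * ?s \<xi> n j + 2 * ?s \<eta> n j" for n j
    unfolding sum_distrib_left sum.distrib[symmetric] by (rule sum_mono) (rule sq)
  have s: "summable (\<lambda>n. 2 * ?s \<xi> n j + 2 * ?s \<eta> n j)" for j
    by (intro summable_add summable_mult inFock_summable[OF assms(1)] inFock_summable[OF assms(2)])
  have z: "summable (\<lambda>n. ?s (\<lambda>n i j. \<xi> n i j + \<eta> n i j) n j)" for j
    by (rule summable_comparison_test[OF _ s[of j]]) (use le in \<open>auto simp: abs_of_nonneg sum_nonneg\<close>)
  have ar: "mpow P n i j > 0" if "\<xi> n i j + \<eta> n i j \<noteq> 0" for n i j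
    using that inFock_arv[OF assms(1), of n i j] inFock_arv[OF assms(2), of n i j] by fastforce
  show "inFock P (\<lambda>n i j. \<xi> n i j + \<eta> n i j)" using z ar by (auto simp: inFock_def arv_def)
  let ?x = "fock_norm \<xi>" and ?y = "fock_norm \<eta>"
  have nn: "0 \<le> ?x" "0 \<le> ?y" using assms fock_norm_nonneg by auto
  show "fock_norm (\<lambda>n i j. \<xi> n i j + \<eta> n i j) \<le> 2 * (?x + ?y)"
  proof (rule fock_norm_le)
    fix j
    have "colsum (\<lambda>n i j. \<xi> n i j + \<eta> n i j) j \<le> (\<Sum>n. 2 * ?s \<xi> n j + 2 * ?s \<eta> n j)"
      unfolding colsum_def by (rule suminf_le[OF le z s])
    also have "\<dots> = 2 * colsum \<xi> j + 2 * colsum \<eta> j"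
      unfolding colsum_def using assms
      by (simp add: suminf_add[symmetric] suminf_mult[symmetric] summable_mult inFock_summable[OF assms(1)] inFock_summable[OF assms(2)])
    also have "\<dots> \<le> 2 * ?x\<^sup>2 + 2 * ?y\<^sup>2" using assms colsum_le_norm by (intro add_mono) auto
    also have "\<dots> \<le> (2 * (?x + ?y))\<^sup>2" using nn by (simp add: power2_eq_square algebra_simps)
    finally show "colsum (\<lambda>n i j. \<xi> n i j + \<eta> n i j) j \<le> (2 * (?x + ?y))\<^sup>2" .
  qed (use nn in simp)
qed

lemma inFock_scale:
  assumes "inFock P \<xi>"
  shows "inFock P (\<lambda>n i j. c * \<xi> n i j)"
    and "fock_norm (\<lambda>n i j. c * \<xi> n i j) \<le> cmod c * fock_norm \<xi>"
proof -
  have le: "(\<Sum>i\<in>UNIV. (cmod (c * \<xi> n i j))\<^sup>2) \<le> (cmod c)\<^sup>2 * (\<Sum>i\<in>UNIV. (cmod (\<xi> n i j))\<^sup>2)" for n j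
    by (simp add: norm_mult power_mult_distrib sum_distrib_left)
  have ar: "c * \<xi> n i j \<noteq> 0 \<Longrightarrow> mpow P n i j > 0" for n i j using inFock_arv[OF assms, of n i j] by auto
  note b = inFock_bound[OF assms, of "\<lambda>n i j. c * \<xi> n i j" "(cmod c)\<^sup>2", OF ar le]
  show "inFock P (\<lambda>n i j. c * \<xi> n i j)" by (rule b(1))
  show "fock_norm (\<lambda>n i j. c * \<xi> n i j) \<le> cmod c * fock_norm \<xi>"
  proof (rule fock_norm_le)
    fix j
    have "colsum (\<lambda>n i j. c * \<xi> n i j) j \<le> (cmod c)\<^sup>2 * colsum \<xi> j" by (rule b(2))
    also have "\<dots> \<le> (cmod c)\<^sup>2 * (fock_norm \<xi>)\<^sup>2" by (intro mult_left_mono colsum_le_norm[OF assms]) auto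
    finally show "colsum (\<lambda>n i j. c * \<xi> n i j) j \<le> (cmod c * fock_norm \<xi>)\<^sup>2" by (simp add: power_mult_distrib)
  qed (use fock_norm_nonneg[OF assms] in auto)
qed

lemma inFock_fzero [simp]: "inFock P fzero"
  by (simp add: inFock_def fzero_def arv_def)

context stoch
begin

lemma rt_nz: "rt P n i j \<noteq> 0 \<longleftrightarrow> mpow P n i j > 0"
  using mpow_nonneg[of n i j] by (auto simp: rt_def)

lemma cmod_rt: "cmod (rt P n i j) = sqrt (mpow P n i j)"
  using mpow_nonneg[of n i j] by (simp add: rt_def)

lemma cmod_rt_le: "cmod (rt P n i j) \<le> 1"
  by (simp add: cmod_rt mpow_le_1)

lemma fs_supported: "supported P (fs P \<xi>)"
  using rt_nz by (auto simp: supported_def fs_def)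

lemma supported_mm: assumes "supported P X" "supported P Y" shows "supported P (mm X Y)"
  unfolding supported_def
proof (intro allI impI)
  fix i j n assume "mm X Y i j $ n \<noteq> 0"
  then have "(\<Sum>k\<in>UNIV. \<Sum>t=0..n. X i k $ t * Y k j $ (n - t)) \<noteq> 0"
    by (simp add: mm_def fps_sum_nth fps_mult_nth)
  then obtain k t where "t \<le> n" "X i k $ t * Y k j $ (n - t) \<noteq> 0"
    by (meson sum.neutral atLeastAtMost_iff)
  then show "mpow P n i j > 0" using assms mpow_pos_add[of t i k "n - t" j] by (auto simp: supported_def)
qed

lemma fs_vac: "fs P vac = (\<lambda>i j. if i = j then 1 else 0)"
  by (auto simp: fs_def vac_def rt_def fun_eq_iff fps_eq_iff)

lemma mm_vac: "mm X (fs P vac) = X"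
proof (intro ext)
  fix i j
  have "mm X (fs P vac) i j = (\<Sum>k\<in>UNIV. if k = j then X i j else 0)"
    unfolding mm_def fs_vac by (rule sum.cong) auto
  then show "mm X (fs P vac) i j = X i j" by simp
qed

lemma inFock_vac: "inFock P vac"
proof -
  have "summable (\<lambda>n. \<Sum>i\<in>UNIV. (cmod (vac n i j))\<^sup>2)" for j :: 'a
    by (rule summable_finite[of "{0}"]) (auto simp: vac_def)
  then show ?thesis by (auto simp: inFock_def arv_def vac_def)
qed

lemma norm_vac: "fock_norm (vac :: 'a fock) \<le> 1"
proof (rule fock_norm_le)
  fix j :: 'a
  have "(\<Sum>n. \<Sum>i\<in>UNIV. (cmod (vac n i j))\<^sup>2) = (\<Sum>n\<in>{0}. \<Sum>i\<in>UNIV. (cmod (vac n i j))\<^sup>2)"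
    by (rule suminf_finite) (auto simp: vac_def)
  also have "\<dots> = (\<Sum>i\<in>UNIV. if i = j then 1 else 0)" by (simp add: vac_def if_distrib[of "\<lambda>x. (cmod x)\<^sup>2"] cong: if_cong)
  finally show "colsum vac j \<le> 1\<^sup>2" by (simp add: colsum_def)
qed simp

lemma fs_opof: assumes "supported P X" "inFock P \<xi>" shows "fs P (opof P X \<xi>) = mm X (fs P \<xi>)"
proof (intro ext fps_ext)
  fix i j n
  show "fs P (opof P X \<xi>) i j $ n = mm X (fs P \<xi>) i j $ n"
    using supported_mm[OF assms(1) fs_supported, of \<xi>] rt_nz[of n i j] assms(2)
    unfolding fs_def[of P "opof P X \<xi>"] supported_def by (auto simp: opof_def)
qed

lemma co_opof: "supported P X \<Longrightarrow> fs P (opof P X vac) = X"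
  by (simp add: fs_opof inFock_vac mm_vac)

lemma fs_inj: assumes "inFock P \<xi>" shows "\<xi> n i j = fs P \<xi> i j $ n / rt P n i j"
  using inFock_arv[OF assms, of n i j] rt_nz[of n i j] by (cases "rt P n i j = 0") (auto simp: fs_def)

lemma opof_eq: "inFock P \<xi> \<Longrightarrow> opof P X \<xi> n i j = mm X (fs P \<xi>) i j $ n / rt P n i j"
  by (simp add: opof_def)

lemma opof_out: "\<not> inFock P \<xi> \<Longrightarrow> opof P X \<xi> = fzero"
  by (simp add: opof_def)

lemma opof_madd: "op_add (opof P X) (opof P Y) = opof P (madd X Y)"
  unfolding op_add_def opof_def mm_madd_left by (auto simp: madd_def fun_eq_iff fzero_def add_divide_distrib)

lemma opof_mscale: "op_scale c (opof P X) = opof P (mscale c X)"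
  unfolding op_scale_def opof_def mm_mscale_left by (auto simp: mscale_def fun_eq_iff fzero_def)

lemma msub_mm: "mm (msub X Y) Z i j = mm X Z i j - mm Y Z i j"
  by (simp add: mm_def msub_def left_diff_distrib sum_subtractf)

lemma opof_msub: "op_diff (opof P X) (opof P Y) = opof P (msub X Y)"
  by (auto simp: op_diff_def opof_def msub_mm fun_eq_iff fzero_def diff_divide_distrib)

lemma opof_mm: assumes "supported P Y" "\<And>\<xi>. inFock P \<xi> \<Longrightarrow> inFock P (opof P Y \<xi>)"
  shows "opof P X \<circ> opof P Y = opof P (mm X Y)"
proof
  fix \<xi>
  show "(opof P X \<circ> opof P Y) \<xi> = opof P (mm X Y) \<xi>"
  proof (cases "inFock P \<xi>")
    case True
    then show ?thesis using assms by (simp add: opof_def[of P X] opof_def[of P "mm X Y"] fs_opof mm_assoc)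
  next
    case False
    have "fs P fzero = (\<lambda>_ _. 0)" by (auto simp: fs_def fzero_def fun_eq_iff fps_eq_iff)
    then have "opof P X fzero = fzero" by (simp add: opof_def fzero_def)
    then show ?thesis using False by (simp add: opof_out)
  qed
qed

lemma wnorm_nonneg: "0 \<le> wnorm P X n"
  unfolding wnorm_def by (intro sum_nonneg divide_nonneg_nonneg) (auto simp: mpow_nonneg)

text \<open>Young's inequality \<open>\<ell>\<^sup>1 * \<ell>\<^sup>2 \<subseteq> \<ell>\<^sup>2\<close>; the monomial \<open>z\<^sup>n E\<^sub>i\<^sub>j\<close> acts with norm at most \<open>(P\<^sup>n\<^sub>i\<^sub>j)\<^sup>-\<^sup>1\<^sup>/\<^sup>2\<close>.\<close>

lemma bnd_young:
  assumes X: "supported P X" and sm: "summable (wnorm P X)"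
  shows "bnd P X (real CARD('a) * suminf (wnorm P X))"
proof -
  let ?c = "real CARD('a)" and ?w = "wnorm P X"
  define W where "W = suminf ?w"
  have W: "W \<ge> 0" unfolding W_def by (rule suminf_nonneg[OF sm wnorm_nonneg])
  have partial: "(\<Sum>n\<le>N. ?w n) \<le> W" for N
    unfolding W_def by (rule sum_le_suminf[OF sm]) (auto simp: wnorm_nonneg)
  have main: "inFock P (opof P X \<xi>) \<and> (\<forall>k. colsum (opof P X \<xi>) k \<le> (?c * W)\<^sup>2 * colsum \<xi> k)" if \<xi>: "inFock P \<xi>" for \<xi>
  proof -
    define v where "v = (\<lambda>k m. \<Sum>l\<in>UNIV. cmod (\<xi> m l k))"
    define s where "s = (\<lambda>k m. \<Sum>l\<in>UNIV. (cmod (\<xi> m l k))\<^sup>2)"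
    have v0: "0 \<le> v k m" for k m by (auto simp: v_def sum_nonneg)
    have vs: "(v k m)\<^sup>2 \<le> ?c * s k m" for k m
    proof -
      have "(\<Sum>l\<in>UNIV. 1 * cmod (\<xi> m l k))\<^sup>2 \<le> (\<Sum>l\<in>(UNIV::'a set). 1\<^sup>2) * (\<Sum>l\<in>UNIV. (cmod (\<xi> m l k))\<^sup>2)"
        by (rule Cauchy_Schwarz_ineq_sum)
      then show ?thesis by (simp add: v_def s_def)
    qed
    have ss: "summable (s k)" for k unfolding s_def by (rule inFock_summable[OF \<xi>])
    have sv: "summable (\<lambda>m. (v k m)\<^sup>2)" for k
      by (rule summable_comparison_test[OF _ summable_mult[OF ss[of k], of ?c]]) (use vs in auto)
    define B where "B = (\<lambda>k n. \<Sum>t\<le>n. ?w t * v k (n - t))"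
    have opof_le: "cmod (opof P X \<xi> n i k) \<le> B k n" for n i k
    proof -
      \<comment> \<open>The product of the weights of the two parts of a path is at most the weight
        of the whole path.\<close>
      have t: "cmod (X i l $ t * fs P \<xi> l k $ (n - t)) / sqrt (mpow P n i k)
          \<le> cmod (X i l $ t) / sqrt (mpow P t i l) * cmod (\<xi> (n - t) l k)" if "t \<le> n" for t l
      proof (cases "X i l $ t = 0 \<or> \<xi> (n - t) l k = 0")
        case True
        then show ?thesis by (auto simp: fs_def)
      next
        case False
        then have pos: "mpow P t i l > 0" "mpow P (n - t) l k > 0"
          using X inFock_arv[OF \<xi>, of "n - t" l k] by (auto simp: supported_def)
        have ge: "sqrt (mpow P t i l) * sqrt (mpow P (n - t) l k) \<le> sqrt (mpow P n i k)"
          using mpow_add_ge[of t i l "n - t" k] that by (simp add: real_sqrt_mult[symmetric])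
        have "mpow P n i k > 0" using mpow_pos_add[OF pos] that by simp
        then have "sqrt (mpow P (n - t) l k) / sqrt (mpow P n i k) \<le> 1 / sqrt (mpow P t i l)"
          using ge pos by (simp add: field_simps)
        then have "(cmod (X i l $ t) * cmod (\<xi> (n - t) l k)) * (sqrt (mpow P (n - t) l k) / sqrt (mpow P n i k))
          \<le> (cmod (X i l $ t) * cmod (\<xi> (n - t) l k)) * (1 / sqrt (mpow P t i l))"
          by (intro mult_left_mono) auto
        then show ?thesis by (simp add: fs_def norm_mult cmod_rt mult_ac)
      qed
      have "cmod (opof P X \<xi> n i k) = cmod (\<Sum>l\<in>UNIV. \<Sum>t=0..n. X i l $ t * fs P \<xi> l k $ (n - t)) / sqrt (mpow P n i k)"
        by (simp add: opof_eq[OF \<xi>] norm_divide cmod_rt mm_def fps_sum_nth fps_mult_nth)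
      also have "\<dots> \<le> (\<Sum>l\<in>UNIV. \<Sum>t=0..n. cmod (X i l $ t * fs P \<xi> l k $ (n - t))) / sqrt (mpow P n i k)"
        by (intro divide_right_mono order_trans[OF norm_sum] sum_mono norm_sum) (simp add: mpow_nonneg)
      also have "\<dots> = (\<Sum>l\<in>UNIV. \<Sum>t=0..n. cmod (X i l $ t * fs P \<xi> l k $ (n - t)) / sqrt (mpow P n i k))"
        by (simp add: sum_divide_distrib)
      also have "\<dots> \<le> (\<Sum>l\<in>UNIV. \<Sum>t=0..n. cmod (X i l $ t) / sqrt (mpow P t i l) * cmod (\<xi> (n - t) l k))"
        by (intro sum_mono t) auto
      also have "\<dots> = (\<Sum>t=0..n. \<Sum>l\<in>UNIV. cmod (X i l $ t) / sqrt (mpow P t i l) * cmod (\<xi> (n - t) l k))"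
        by (rule sum.swap)
      also have "\<dots> \<le> (\<Sum>t=0..n. ?w t * v k (n - t))"
      proof (rule sum_mono)
        fix t assume "t \<in> {0..n}"
        have "cmod (X i l $ t) / sqrt (mpow P t i l) \<le> ?w t" for l
        proof -
          have "cmod (X i l $ t) / sqrt (mpow P t i l) \<le> (\<Sum>j\<in>UNIV. cmod (X i j $ t) / sqrt (mpow P t i j))"
            by (rule member_le_sum) (auto simp: mpow_nonneg)
          also have "\<dots> \<le> ?w t" unfolding wnorm_def
            by (rule member_le_sum[where f="\<lambda>i. \<Sum>j\<in>UNIV. cmod (X i j $ t) / sqrt (mpow P t i j)"])
               (auto intro!: sum_nonneg simp: mpow_nonneg)
          finally show ?thesis .
        qed
        then show "(\<Sum>l\<in>UNIV. cmod (X i l $ t) / sqrt (mpow P t i l) * cmod (\<xi> (n - t) l k)) \<le> ?w t * v k (n - t)"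
          unfolding v_def sum_distrib_left by (intro sum_mono mult_right_mono) auto
      qed
      finally show ?thesis by (simp add: B_def atMost_atLeast0)
    qed
    \<comment> \<open>Cauchy-Schwarz with w split as sqrt w * sqrt w leaves the convolution of w
      with v^2, whose sum is a Cauchy product.\<close>
    have Bsq: "(B k n)\<^sup>2 \<le> W * (\<Sum>t\<le>n. ?w t * (v k (n - t))\<^sup>2)" for k n
    proof -
      have "B k n = (\<Sum>t\<le>n. sqrt (?w t) * (sqrt (?w t) * v k (n - t)))"
        unfolding B_def by (rule sum.cong) (auto simp: wnorm_nonneg mult.assoc[symmetric])
      then have "(B k n)\<^sup>2 \<le> (\<Sum>t\<le>n. (sqrt (?w t))\<^sup>2) * (\<Sum>t\<le>n. (sqrt (?w t) * v k (n - t))\<^sup>2)"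
        by (simp only: Cauchy_Schwarz_ineq_sum)
      also have "\<dots> = (\<Sum>t\<le>n. ?w t) * (\<Sum>t\<le>n. ?w t * (v k (n - t))\<^sup>2)"
        by (simp add: wnorm_nonneg power_mult_distrib)
      also have "\<dots> \<le> W * (\<Sum>t\<le>n. ?w t * (v k (n - t))\<^sup>2)"
        by (rule mult_right_mono[OF partial]) (auto intro!: sum_nonneg simp: wnorm_nonneg)
      finally show ?thesis .
    qed
    define C where "C = (\<lambda>k n. \<Sum>t\<le>n. ?w t * (v k (n - t))\<^sup>2)"
    have nw: "summable (\<lambda>n. norm (?w n))" using sm by (simp add: wnorm_nonneg)
    have nv: "summable (\<lambda>n. norm ((v k n)\<^sup>2))" for k using sv[of k] by simp
    have Cs: "summable (C k)" for k unfolding C_def by (rule summable_Cauchy_product[OF nw nv])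
    have Csum: "suminf (C k) = W * (\<Sum>m. (v k m)\<^sup>2)" for k
      unfolding C_def W_def using Cauchy_product[OF nw nv[of k]] by simp
    have le: "(\<Sum>i\<in>UNIV. (cmod (opof P X \<xi> n i k))\<^sup>2) \<le> ?c * W * C k n" for n k
    proof -
      have "(\<Sum>i\<in>UNIV. (cmod (opof P X \<xi> n i k))\<^sup>2) \<le> (\<Sum>i\<in>(UNIV::'a set). (B k n)\<^sup>2)"
        by (intro sum_mono power_mono opof_le) auto
      also have "\<dots> = ?c * (B k n)\<^sup>2" by simp
      also have "\<dots> \<le> ?c * (W * C k n)" using Bsq unfolding C_def by (intro mult_left_mono) auto
      finally show ?thesis by (simp add: mult.assoc)
    qed
    have sumC: "summable (\<lambda>n. ?c * W * C k n)" for k by (rule summable_mult[OF Cs])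
    have so: "summable (\<lambda>n. \<Sum>i\<in>UNIV. (cmod (opof P X \<xi> n i k))\<^sup>2)" for k
      by (rule summable_comparison_test[OF _ sumC[of k]]) (use le in \<open>auto simp: abs_of_nonneg sum_nonneg\<close>)
    have ar: "mpow P n i j > 0" if "opof P X \<xi> n i j \<noteq> 0" for n i j
      using that rt_nz by (auto simp: opof_eq[OF \<xi>])
    have "colsum (opof P X \<xi>) k \<le> (?c * W)\<^sup>2 * colsum \<xi> k" for k
    proof -
      have "colsum (opof P X \<xi>) k \<le> (\<Sum>n. ?c * W * C k n)"
        unfolding colsum_def by (rule suminf_le[OF le so sumC])
      also have "\<dots> = ?c * W * (W * (\<Sum>m. (v k m)\<^sup>2))" by (simp add: suminf_mult[OF Cs] Csum)
      also have "\<dots> \<le> ?c * W * (W * (?c * colsum \<xi> k))"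
      proof -
        have "(\<Sum>m. (v k m)\<^sup>2) \<le> (\<Sum>m. ?c * s k m)" by (rule suminf_le[OF vs sv summable_mult[OF ss]])
        also have "\<dots> = ?c * colsum \<xi> k" using suminf_mult[OF ss[of k], of ?c] by (simp add: colsum_def s_def)
        finally show ?thesis using W by (intro mult_left_mono) auto
      qed
      finally show ?thesis by (simp add: power2_eq_square mult_ac)
    qed
    then show ?thesis using so ar by (auto simp: inFock_def arv_def)
  qed
  have "fock_norm (opof P X \<xi>) \<le> ?c * W * fock_norm \<xi>" if \<xi>: "inFock P \<xi>" for \<xi>
  proof (rule fock_norm_le)
    fix j
    have "colsum (opof P X \<xi>) j \<le> (?c * W)\<^sup>2 * colsum \<xi> j" using main[OF \<xi>] by blast
    also have "\<dots> \<le> (?c * W)\<^sup>2 * (fock_norm \<xi>)\<^sup>2" by (intro mult_left_mono colsum_le_norm[OF \<xi>]) auto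
    finally show "colsum (opof P X \<xi>) j \<le> (?c * W * fock_norm \<xi>)\<^sup>2" by (simp add: power_mult_distrib)
  qed (use W fock_norm_nonneg[OF \<xi>] in auto)
  then show ?thesis unfolding bnd_def using X main W by (auto simp: W_def)
qed

lemma bndD: assumes "bnd P X D" shows "D \<ge> 0" "supported P X" "inFock P \<xi> \<Longrightarrow> inFock P (opof P X \<xi>)"
    "inFock P \<xi> \<Longrightarrow> fock_norm (opof P X \<xi>) \<le> D * fock_norm \<xi>"
  using assms by (auto simp: bnd_def)

lemma supported_madd: "supported P X \<Longrightarrow> supported P Y \<Longrightarrow> supported P (madd X Y)"
  unfolding supported_def madd_def by (metis add.right_neutral fps_add_nth)

lemma supported_msub: "supported P X \<Longrightarrow> supported P Y \<Longrightarrow> supported P (msub X Y)"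
  unfolding supported_def msub_def by (metis diff_zero fps_sub_nth)

lemma supported_mscale: "supported P X \<Longrightarrow> supported P (mscale c X)"
  unfolding supported_def mscale_def by auto

lemma bnd_madd: assumes "bnd P X D" "bnd P Y E" shows "bnd P (madd X Y) (2 * (D + E))"
  unfolding bnd_def
proof (intro conjI allI impI)
  show "0 \<le> 2 * (D + E)" using bndD(1)[OF assms(1)] bndD(1)[OF assms(2)] by simp
  show "supported P (madd X Y)" using assms by (intro supported_madd bndD(2))
  fix \<xi> assume \<xi>: "inFock P \<xi>"
  have eq: "opof P (madd X Y) \<xi> = (\<lambda>n i j. opof P X \<xi> n i j + opof P Y \<xi> n i j)"
    by (simp add: opof_madd[symmetric] op_add_def)
  note f = inFock_add[OF bndD(3)[OF assms(1) \<xi>] bndD(3)[OF assms(2) \<xi>]]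
  show "inFock P (opof P (madd X Y) \<xi>)" unfolding eq by (rule f(1))
  show "fock_norm (opof P (madd X Y) \<xi>) \<le> 2 * (D + E) * fock_norm \<xi>"
    unfolding eq using f(2) bndD(4)[OF assms(1) \<xi>] bndD(4)[OF assms(2) \<xi>] by (simp add: algebra_simps)
qed

lemma bnd_mscale: assumes "bnd P X D" shows "bnd P (mscale c X) (cmod c * D)"
  unfolding bnd_def
proof (intro conjI allI impI)
  show "0 \<le> cmod c * D" using bndD(1)[OF assms] by simp
  show "supported P (mscale c X)" by (rule supported_mscale[OF bndD(2)[OF assms]])
  fix \<xi> assume \<xi>: "inFock P \<xi>"
  have eq: "opof P (mscale c X) \<xi> = (\<lambda>n i j. c * opof P X \<xi> n i j)"
    by (simp add: opof_mscale[symmetric] op_scale_def)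
  note f = inFock_scale[OF bndD(3)[OF assms \<xi>], of c]
  show "inFock P (opof P (mscale c X) \<xi>)" unfolding eq by (rule f(1))
  show "fock_norm (opof P (mscale c X) \<xi>) \<le> cmod c * D * fock_norm \<xi>"
    unfolding eq using order_trans[OF f(2) mult_left_mono[OF bndD(4)[OF assms \<xi>]]] by (simp add: mult.assoc)
qed

lemma bnd_mm: assumes "bnd P X D" "bnd P Y E" shows "bnd P (mm X Y) (D * E)"
  unfolding bnd_def
proof (intro conjI allI impI)
  show "0 \<le> D * E" using bndD(1)[OF assms(1)] bndD(1)[OF assms(2)] by simp
  show "supported P (mm X Y)" using assms by (intro supported_mm bndD(2))
  fix \<xi> assume \<xi>: "inFock P \<xi>"
  have "opof P X \<circ> opof P Y = opof P (mm X Y)" by (rule opof_mm) (use bndD[OF assms(2)] in auto)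
  then have eq: "opof P (mm X Y) \<xi> = opof P X (opof P Y \<xi>)" by (metis comp_apply)
  note Y\<xi> = bndD(3)[OF assms(2) \<xi>]
  show "inFock P (opof P (mm X Y) \<xi>)" unfolding eq by (rule bndD(3)[OF assms(1) Y\<xi>])
  have "fock_norm (opof P X (opof P Y \<xi>)) \<le> D * fock_norm (opof P Y \<xi>)" by (rule bndD(4)[OF assms(1) Y\<xi>])
  also have "\<dots> \<le> D * (E * fock_norm \<xi>)" by (rule mult_left_mono[OF bndD(4)[OF assms(2) \<xi>] bndD(1)[OF assms(1)]])
  finally show "fock_norm (opof P (mm X Y) \<xi>) \<le> D * E * fock_norm \<xi>" unfolding eq by (simp add: mult.assoc)
qed

lemma bnd_mono: "bnd P X D \<Longrightarrow> D \<le> E \<Longrightarrow> bnd P X E"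
  unfolding bnd_def by (meson fock_norm_nonneg mult_right_mono order_trans)

text \<open>Applied to the vacuum, the operator returns its own coefficients up to the
  weights.\<close>

lemma bnd_coeff: assumes "bnd P X D" shows "cmod (X i j $ n) \<le> D * sqrt (mpow P n i j)"
proof -
  have f: "inFock P (opof P X vac)" by (rule bndD(3)[OF assms inFock_vac])
  have "cmod (opof P X vac n i j) \<le> fock_norm (opof P X vac)" by (rule comp_le_norm[OF f])
  also have "\<dots> \<le> D * fock_norm (vac :: 'a fock)" by (rule bndD(4)[OF assms inFock_vac])
  also have "\<dots> \<le> D * 1" by (rule mult_left_mono[OF norm_vac bndD(1)[OF assms]])
  finally have le: "cmod (opof P X vac n i j) \<le> D" by simp
  have "X i j $ n = rt P n i j * opof P X vac n i j"
    using arg_cong[OF co_opof[OF bndD(2)[OF assms]], of "\<lambda>Z. Z i j $ n"] by (simp add: fs_def)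
  then have "cmod (X i j $ n) = sqrt (mpow P n i j) * cmod (opof P X vac n i j)" by (simp add: norm_mult cmod_rt)
  then show ?thesis using mult_left_mono[OF le, of "sqrt (mpow P n i j)"] mpow_nonneg[of n i j] by (simp add: mult.commute)
qed

lemma polymat_bnd: assumes "polymat P X" shows "\<exists>D. bnd P X D"
proof -
  obtain N where N: "\<And>i j n. n \<ge> N \<Longrightarrow> X i j $ n = 0" using assms by (auto simp: polymat_def)
  have "summable (wnorm P X)" by (rule summable_finite[of "{..<N}"]) (use N in \<open>auto simp: wnorm_def\<close>)
  then show ?thesis using bnd_young assms by (auto simp: polymat_def)
qed

lemma polymat_mm: assumes "polymat P X" "polymat P Y" shows "polymat P (mm X Y)"
proof -
  obtain N where N: "\<And>i j n. n \<ge> N \<Longrightarrow> X i j $ n = 0" using assms by (auto simp: polymat_def)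
  obtain L where L: "\<And>i j n. n \<ge> L \<Longrightarrow> Y i j $ n = 0" using assms by (auto simp: polymat_def)
  have "mm X Y i j $ n = 0" if "n \<ge> N + L" for i j n
  proof -
    have "X i k $ t * Y k j $ (n - t) = 0" for k t
      using N[of t] L[of "n - t"] that by (cases "t \<ge> N") auto
    then show ?thesis unfolding mm_def fps_sum_nth fps_mult_nth by (intro sum.neutral ballI)
  qed
  then show ?thesis using assms supported_mm unfolding polymat_def by blast
qed

lemma polymat_madd: assumes "polymat P X" "polymat P Y" shows "polymat P (madd X Y)"
proof -
  obtain N where N: "\<And>i j n. n \<ge> N \<Longrightarrow> X i j $ n = 0" using assms by (auto simp: polymat_def)
  obtain L where L: "\<And>i j n. n \<ge> L \<Longrightarrow> Y i j $ n = 0" using assms by (auto simp: polymat_def)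
  have "madd X Y i j $ n = 0" if "n \<ge> N + L" for i j n using that N[of n] L[of n] by (simp add: madd_def)
  then show ?thesis using assms supported_madd unfolding polymat_def by blast
qed

lemma polymat_mscale: "polymat P X \<Longrightarrow> polymat P (mscale c X)"
  unfolding polymat_def using supported_mscale by (auto simp: mscale_def) (metis mult_zero_right)

lemma shift_opof:
  "shift P n A = opof P (\<lambda>i j. fps_const (rt P n i j * A i j) * fps_X ^ n)"
proof (rule ext)
  fix \<xi>
  let ?X = "\<lambda>i j. fps_const (rt P n i j * A i j) * fps_X ^ n"
  show "shift P n A \<xi> = opof P ?X \<xi>"
  proof (cases "inFock P \<xi>")
    case True
    have "shift P n A \<xi> k i j = opof P ?X \<xi> k i j" for k i j
    proof (cases "k < n")
      case True
      have "mm ?X (fs P \<xi>) i j $ k = 0"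
        unfolding mm_def fps_sum_nth mult.assoc fps_mult_left_const_nth fps_X_power_mult_nth using True by simp
      then show ?thesis using True \<open>inFock P \<xi>\<close> by (simp add: shift_def opof_def)
    next
      case False
      have "mm ?X (fs P \<xi>) i j $ k = (\<Sum>l\<in>UNIV. (rt P n i l * A i l) * (rt P (k - n) l j * \<xi> (k - n) l j))"
        unfolding mm_def fps_sum_nth mult.assoc fps_mult_left_const_nth fps_X_power_mult_nth
        using False by (simp add: fs_def mult.assoc)
      moreover have "rt P k i j = 0" if "\<not> mpow P k i j > 0" using that rt_nz by blast
      ultimately show ?thesis using False \<open>inFock P \<xi>\<close> by (simp add: shift_def opof_def U_def rt_def)
    qed
    then show ?thesis by (simp add: fun_eq_iff)
  qed (simp add: shift_def opof_def)
qed

lemma monomat_polymat: "A \<in> arv P n \<Longrightarrow> polymat P (\<lambda>i j. fps_const (rt P n i j * A i j) * fps_X ^ n)"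
  unfolding polymat_def supported_def
  by (intro conjI exI[of _ "Suc n"]) (auto simp: arv_def fps_X_power_nth split: if_splits)

lemma alg_polymat: "S \<in> alg P \<Longrightarrow> \<exists>X. polymat P X \<and> S = opof P X"
proof (induction rule: alg.induct)
  case (gen A n)
  then show ?case using monomat_polymat shift_opof by blast
next
  case (add S T)
  then show ?case using polymat_madd opof_madd by metis
next
  case (scale T c)
  then show ?case using polymat_mscale opof_mscale by metis
next
  case (comp S T)
  then obtain X Y where XY: "polymat P X" "S = opof P X" "polymat P Y" "T = opof P Y" by blast
  obtain D where "bnd P Y D" using polymat_bnd[OF XY(3)] by blast
  then have "opof P X \<circ> opof P Y = opof P (mm X Y)" by (intro opof_mm) (auto dest: bndD)
  then show ?case using XY polymat_mm by blast
qed

lemma polymat_alg: assumes "polymat P X" shows "opof P X \<in> alg P"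
proof -
  have "opof P X \<in> alg P" if "supported P X" "\<And>i j n. n \<ge> N \<Longrightarrow> X i j $ n = 0" for N X
    using that
  proof (induction N arbitrary: X)
    case 0
    \<comment> \<open>\<open>alg\<close> has no constructor for the zero operator; it is the shift
      by the zero diagonal.\<close>
    have "opof P X = shift P 0 (\<lambda>_ _. 0)"
      unfolding shift_opof by (rule arg_cong[of _ _ "opof P"]) (use 0 in \<open>auto simp: fun_eq_iff fps_eq_iff\<close>)
    then show ?case by (simp add: alg.gen arv_def)
  next
    case (Suc N)
    define Y where "Y = (\<lambda>i j. fps_cutoff N (X i j))"
    define A where "A = (\<lambda>i j. X i j $ N / rt P N i j)"
    have A: "A \<in> arv P N" using rt_nz by (auto simp: A_def arv_def)
    have sA: "rt P N i j * A i j = X i j $ N" for i j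
      using Suc.prems(1) rt_nz[of N i j] by (auto simp: A_def supported_def)
    have "opof P Y \<in> alg P"
      by (rule Suc.IH) (use Suc.prems in \<open>auto simp: Y_def supported_def split: if_splits\<close>)
    moreover have "madd Y (\<lambda>i j. fps_const (rt P N i j * A i j) * fps_X ^ N) = X"
    proof (intro ext fps_ext)
      fix i j n
      show "madd Y (\<lambda>i j. fps_const (rt P N i j * A i j) * fps_X ^ N) i j $ n = X i j $ n"
        using Suc.prems(2)[of n i j] by (auto simp: madd_def Y_def sA fps_X_power_nth)
    qed
    ultimately show ?case using alg.add[OF _ alg.gen[OF A], of "opof P Y"] by (simp add: shift_opof opof_madd)
  qed
  then show ?thesis using assms unfolding polymat_def by blast
qed

end

lemma inFock_diff:
  assumes "inFock P \<xi>" "inFock P \<eta>" shows "inFock P (\<lambda>n i j. \<xi> n i j - \<eta> n i j)"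
  using inFock_add(1)[OF assms(1) inFock_scale(1)[OF assms(2), of "-1"]] by simp

lemma norm_le_mult_eps:
  fixes x :: complex
  assumes "\<And>e. e > 0 \<Longrightarrow> cmod x \<le> e * C" shows "x = 0"
proof -
  have C: "C \<ge> 0" using order_trans[OF norm_ge_zero assms[of 1]] by simp
  have "cmod x \<le> 0"
  proof (rule field_le_epsilon)
    fix e :: real assume e: "e > 0"
    have "cmod x \<le> e / (C + 1) * C" using e C by (intro assms) simp
    also have "\<dots> \<le> e" using e C by (simp add: field_simps)
    finally show "cmod x \<le> 0 + e" by simp
  qed
  then show ?thesis by simp
qed

section \<open>The operator algebra as a norm closure of polynomial matrices\<close>

context stoch
begin

lemma mat_Tplus_bnd: assumes "X \<in> mat_Tplus P" shows "\<exists>D. bnd P X D"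
proof -
  have "\<forall>e>0. \<exists>Y. polymat P Y \<and> bnd P (msub X Y) e" using assms by (simp add: mat_Tplus_def)
  then obtain Y where Y: "polymat P Y" "bnd P (msub X Y) 1" using zero_less_one by blast
  obtain D where D: "bnd P Y D" using polymat_bnd[OF Y(1)] by blast
  have "madd Y (msub X Y) = X" by (simp add: madd_def msub_def)
  then show ?thesis using bnd_madd[OF D Y(2)] by auto
qed

lemma mat_Tplus_supported: "X \<in> mat_Tplus P \<Longrightarrow> supported P X"
  by (simp add: mat_Tplus_def)

lemma mat_TplusI:
  assumes "supported P X" "\<And>e. e > 0 \<Longrightarrow> \<exists>Y d. polymat P Y \<and> bnd P (msub X Y) d \<and> d \<le> e"
  shows "X \<in> mat_Tplus P"
proof -
  have "\<exists>Y. polymat P Y \<and> bnd P (msub X Y) e" if e: "e > 0" for e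
  proof -
    obtain Y d where "polymat P Y" "bnd P (msub X Y) d" "d \<le> e" using assms(2)[OF e] by blast
    then show ?thesis using bnd_mono[of "msub X Y" d e] by blast
  qed
  then show ?thesis using assms(1) by (simp add: mat_Tplus_def)
qed

lemma mat_TplusD: "X \<in> mat_Tplus P \<Longrightarrow> e > 0 \<Longrightarrow> \<exists>Y. polymat P Y \<and> bnd P (msub X Y) e"
  by (simp add: mat_Tplus_def)

text \<open>For operators given by polynomial matrices the identity is \<open>co_opof\<close>. Each
  coefficient of both sides is controlled by the operator norm, so the identity passes to norm
  limits.\<close>

lemma Tplus_matrix:
  assumes "T \<in> Tplus P"
  shows "T = opof P (fs P (T vac))" and "fs P (T vac) \<in> mat_Tplus P"
proof -
  define X where "X = fs P (T vac)"
  have T: "\<And>\<xi>. \<not> inFock P \<xi> \<Longrightarrow> T \<xi> = fzero" "\<And>\<xi>. inFock P \<xi> \<Longrightarrow> inFock P (T \<xi>)"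
    "\<And>e. e > 0 \<Longrightarrow> \<exists>S\<in>alg P. op_bound P (op_diff T S) e"
    using assms by (auto simp: Tplus_def)
  have approx: "\<exists>Y. polymat P Y \<and> (\<forall>\<xi>. inFock P \<xi> \<longrightarrow> inFock P (op_diff T (opof P Y) \<xi>) \<and>
      fock_norm (op_diff T (opof P Y) \<xi>) \<le> e * fock_norm \<xi>)" if "e > 0" for e
  proof -
    obtain S where S: "S \<in> alg P" "op_bound P (op_diff T S) e" using T(3)[OF \<open>e > 0\<close>] by blast
    obtain Y where Y: "polymat P Y" "S = opof P Y" using alg_polymat[OF S(1)] by blast
    obtain D where D: "bnd P Y D" using polymat_bnd[OF Y(1)] by blast
    show ?thesis
      using Y S(2) inFock_diff[OF T(2) bndD(3)[OF D]] unfolding op_bound_def op_diff_def by blast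
  qed
  have sX: "supported P X" unfolding X_def by (rule fs_supported)
  have key: "rt P n i j * T \<xi> n i j = mm X (fs P \<xi>) i j $ n" if \<xi>: "inFock P \<xi>" for \<xi> n i j
  proof -
    \<comment> \<open>Collects both errors: that of the operator applied to \<xi>, and that of the
      matrix coefficients times those of \<xi>.\<close>
    define C where "C = fock_norm \<xi> + (\<Sum>k\<in>UNIV. \<Sum>t=0..n. cmod (fs P \<xi> k j $ (n - t)))"
    have "cmod (rt P n i j * T \<xi> n i j - mm X (fs P \<xi>) i j $ n) \<le> e * C" if e: "e > 0" for e
    proof -
      obtain Y where Y: "polymat P Y" and d: "\<And>\<xi>. inFock P \<xi> \<Longrightarrow> inFock P (op_diff T (opof P Y) \<xi>)"
        "\<And>\<xi>. inFock P \<xi> \<Longrightarrow> fock_norm (op_diff T (opof P Y) \<xi>) \<le> e * fock_norm \<xi>"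
        using approx[OF e] by blast
      have sY: "supported P Y" using Y by (simp add: polymat_def)
      have coeff: "cmod (msub X Y i k $ t) \<le> e" for k t
      proof -
        have "Y i k $ t = rt P t i k * opof P Y vac t i k"
          using arg_cong[OF co_opof[OF sY], of "\<lambda>Z. Z i k $ t"] by (simp add: fs_def)
        then have "msub X Y i k $ t = rt P t i k * op_diff T (opof P Y) vac t i k"
          by (simp add: msub_def X_def fs_def op_diff_def right_diff_distrib)
        then have "cmod (msub X Y i k $ t) = cmod (rt P t i k) * cmod (op_diff T (opof P Y) vac t i k)"
          by (simp only: norm_mult)
        also have "\<dots> \<le> 1 * fock_norm (op_diff T (opof P Y) vac)"
          by (intro mult_mono cmod_rt_le comp_le_norm[OF d(1)[OF inFock_vac]]) auto
        also have "\<dots> \<le> e * fock_norm (vac :: 'a fock)" using d(2)[OF inFock_vac] by simp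
        also have "\<dots> \<le> e" using mult_left_mono[OF norm_vac, of e] e by simp
        finally show ?thesis .
      qed
      have "rt P n i j * opof P Y \<xi> n i j = mm Y (fs P \<xi>) i j $ n"
        using arg_cong[OF fs_opof[OF sY \<xi>], of "\<lambda>Z. Z i j $ n"] by (simp add: fs_def)
      then have "rt P n i j * T \<xi> n i j - mm X (fs P \<xi>) i j $ n
          = rt P n i j * op_diff T (opof P Y) \<xi> n i j - mm (msub X Y) (fs P \<xi>) i j $ n"
        by (simp add: op_diff_def right_diff_distrib msub_mm)
      then have "cmod (rt P n i j * T \<xi> n i j - mm X (fs P \<xi>) i j $ n)
          \<le> cmod (rt P n i j * op_diff T (opof P Y) \<xi> n i j) + cmod (mm (msub X Y) (fs P \<xi>) i j $ n)"
        by (simp only: norm_triangle_ineq4)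
      moreover have "cmod (rt P n i j * op_diff T (opof P Y) \<xi> n i j) \<le> 1 * (e * fock_norm \<xi>)"
        unfolding norm_mult
        by (rule mult_mono[OF cmod_rt_le order_trans[OF comp_le_norm[OF d(1)[OF \<xi>]] d(2)[OF \<xi>]]]) auto
      moreover have "cmod (mm (msub X Y) (fs P \<xi>) i j $ n) \<le> e * (\<Sum>k\<in>UNIV. \<Sum>t=0..n. cmod (fs P \<xi> k j $ (n - t)))"
        unfolding mm_def fps_sum_nth fps_mult_nth sum_distrib_left
      proof (rule sum_norm_le, rule sum_norm_le)
        fix k t
        show "cmod (msub X Y i k $ t * fs P \<xi> k j $ (n - t)) \<le> e * cmod (fs P \<xi> k j $ (n - t))"
          unfolding norm_mult by (rule mult_right_mono[OF coeff]) simp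
      qed
      ultimately show ?thesis unfolding C_def by (simp add: distrib_left)
    qed
    then have "rt P n i j * T \<xi> n i j - mm X (fs P \<xi>) i j $ n = 0" by (rule norm_le_mult_eps)
    then show ?thesis by simp
  qed
  have TX: "T = opof P X"
  proof
    fix \<xi>
    show "T \<xi> = opof P X \<xi>"
    proof (cases "inFock P \<xi>")
      case True
      have "T \<xi> n i j = opof P X \<xi> n i j" for n i j
        using fs_inj[OF T(2)[OF True], of n i j] key[OF True, of n i j] by (simp add: opof_eq[OF True] fs_def)
      then show ?thesis by (simp add: fun_eq_iff)
    qed (simp add: T(1) opof_out)
  qed
  then show "T = opof P (fs P (T vac))" by (simp add: X_def)
  have "\<exists>Y. polymat P Y \<and> bnd P (msub X Y) e" if e: "e > 0" for e
  proof -
    obtain Y where Y: "polymat P Y" and d: "\<And>\<xi>. inFock P \<xi> \<Longrightarrow> inFock P (op_diff T (opof P Y) \<xi>)"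
        "\<And>\<xi>. inFock P \<xi> \<Longrightarrow> fock_norm (op_diff T (opof P Y) \<xi>) \<le> e * fock_norm \<xi>"
      using approx[OF e] by blast
    have "op_diff T (opof P Y) = opof P (msub X Y)" by (simp add: TX opof_msub)
    then have "bnd P (msub X Y) e"
      unfolding bnd_def using d e supported_msub[OF sX] Y by (auto simp: polymat_def)
    then show ?thesis using Y by blast
  qed
  then show "fs P (T vac) \<in> mat_Tplus P" using sX by (simp add: mat_Tplus_def X_def)
qed

lemma matrix_Tplus: assumes "X \<in> mat_Tplus P" shows "opof P X \<in> Tplus P"
proof -
  obtain D where D: "bnd P X D" using mat_Tplus_bnd[OF assms] by blast
  have "\<exists>S\<in>alg P. op_bound P (op_diff (opof P X) S) e" if "e > 0" for e
  proof -
    obtain Y where Y: "polymat P Y" "bnd P (msub X Y) e" using mat_TplusD[OF assms \<open>e > 0\<close>] by blast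
    have "op_bound P (op_diff (opof P X) (opof P Y)) e"
      unfolding op_bound_def opof_msub using bndD(4)[OF Y(2)] by blast
    then show ?thesis using polymat_alg[OF Y(1)] by blast
  qed
  then show ?thesis using bndD(3)[OF D] opof_out by (auto simp: Tplus_def)
qed

lemma mat_Tplus_opof_mm:
  assumes "Y \<in> mat_Tplus P" shows "opof P X \<circ> opof P Y = opof P (mm X Y)"
proof -
  obtain D where "bnd P Y D" using mat_Tplus_bnd[OF assms] by blast
  then show ?thesis by (intro opof_mm) (auto dest: bndD)
qed

lemma mat_Tplus_madd: assumes "X \<in> mat_Tplus P" "X' \<in> mat_Tplus P" shows "madd X X' \<in> mat_Tplus P"
proof (rule mat_TplusI)
  show "supported P (madd X X')" using assms by (intro supported_madd mat_Tplus_supported)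
  fix e :: real assume e: "e > 0"
  obtain Y where Y: "polymat P Y" "bnd P (msub X Y) (e / 4)" using mat_TplusD[OF assms(1), of "e / 4"] e by auto
  obtain Y' where Y': "polymat P Y'" "bnd P (msub X' Y') (e / 4)" using mat_TplusD[OF assms(2), of "e / 4"] e by auto
  have "msub (madd X X') (madd Y Y') = madd (msub X Y) (msub X' Y')" by (simp add: msub_def madd_def fun_eq_iff)
  then have "bnd P (msub (madd X X') (madd Y Y')) (2 * (e / 4 + e / 4))" using bnd_madd[OF Y(2) Y'(2)] by simp
  then show "\<exists>Y d. polymat P Y \<and> bnd P (msub (madd X X') Y) d \<and> d \<le> e"
    using polymat_madd[OF Y(1) Y'(1)] by (intro exI[of _ "madd Y Y'"] exI[of _ "2 * (e / 4 + e / 4)"]) auto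
qed

lemma mat_Tplus_mscale: assumes "X \<in> mat_Tplus P" shows "mscale c X \<in> mat_Tplus P"
proof (rule mat_TplusI)
  show "supported P (mscale c X)" using assms by (intro supported_mscale mat_Tplus_supported)
  fix e :: real assume e: "e > 0"
  define d where "d = e / (cmod c + 1)"
  have cp: "cmod c + 1 > 0" by (rule add_nonneg_pos) auto
  have d: "d > 0" using e cp by (simp add: d_def)
  obtain Y where Y: "polymat P Y" "bnd P (msub X Y) d" using mat_TplusD[OF assms d] by blast
  have "msub (mscale c X) (mscale c Y) = mscale c (msub X Y)"
    by (simp add: msub_def mscale_def right_diff_distrib)
  then have "bnd P (msub (mscale c X) (mscale c Y)) (cmod c * d)" using bnd_mscale[OF Y(2)] by simp
  moreover have "cmod c * d \<le> e"
  proof -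
    have "cmod c * d \<le> (cmod c + 1) * d" using d by (intro mult_right_mono) auto
    then show ?thesis using cp by (simp add: d_def)
  qed
  ultimately show "\<exists>Y d. polymat P Y \<and> bnd P (msub (mscale c X) Y) d \<and> d \<le> e"
    using polymat_mscale[OF Y(1)] by blast
qed

lemma mat_Tplus_mm: assumes "X \<in> mat_Tplus P" "X' \<in> mat_Tplus P" shows "mm X X' \<in> mat_Tplus P"
proof (rule mat_TplusI)
  show "supported P (mm X X')" using assms by (intro supported_mm mat_Tplus_supported)
  fix e :: real assume e: "e > 0"
  obtain D where D: "bnd P X D" using mat_Tplus_bnd[OF assms(1)] by blast
  have D0: "D \<ge> 0" by (rule bndD(1)[OF D])
  define d' where "d' = e / (4 * (D + 1))"
  have d': "d' > 0" using e D0 by (simp add: d'_def)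
  obtain Y' where Y': "polymat P Y'" "bnd P (msub X' Y') d'" using mat_TplusD[OF assms(2) d'] by blast
  obtain E where E: "bnd P Y' E" using polymat_bnd[OF Y'(1)] by blast
  have E0: "E \<ge> 0" by (rule bndD(1)[OF E])
  \<comment> \<open>The tolerance for X depends on the norm of Y', so Y' is chosen before Y.\<close>
  define d where "d = e / (4 * (E + 1))"
  have d: "d > 0" using e E0 by (simp add: d_def)
  obtain Y where Y: "polymat P Y" "bnd P (msub X Y) d" using mat_TplusD[OF assms(1) d] by blast
  have "msub (mm X X') (mm Y Y') = madd (mm X (msub X' Y')) (mm (msub X Y) Y')"
    by (simp add: msub_def madd_def mm_def fun_eq_iff sum.distrib[symmetric] sum_subtractf[symmetric] algebra_simps)
  then have "bnd P (msub (mm X X') (mm Y Y')) (2 * (D * d' + d * E))"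
    using bnd_madd[OF bnd_mm[OF D Y'(2)] bnd_mm[OF Y(2) E]] by simp
  moreover have "2 * (D * d' + d * E) \<le> e"
  proof -
    have "D * d' \<le> e / 4" "d * E \<le> e / 4" using e D0 E0 by (auto simp: d'_def d_def field_simps)
    then show ?thesis by simp
  qed
  ultimately show "\<exists>Y d. polymat P Y \<and> bnd P (msub (mm X X') Y) d \<and> d \<le> e"
    using polymat_mm[OF Y(1) Y'(1)] by blast
qed

lemma wnorm_un: "wnorm P (un i j f) n = cmod (f $ n) / sqrt (mpow P n i j)"
proof -
  have "wnorm P (un i j f) n = (\<Sum>a\<in>UNIV. \<Sum>b\<in>UNIV. if b = j then if a = i then cmod (f $ n) / sqrt (mpow P n i j) else 0 else 0)"
    unfolding wnorm_def by (intro sum.cong) (auto simp: un_def)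
  then show ?thesis by simp
qed

lemma supported_un: "supported P (un i j f) \<longleftrightarrow> (\<forall>n. f $ n \<noteq> 0 \<longrightarrow> mpow P n i j > 0)"
  by (auto simp: supported_def un_def)

lemma polymat_un: "(\<And>n. f $ n \<noteq> 0 \<Longrightarrow> mpow P n i j > 0) \<Longrightarrow> (\<And>n. n \<ge> N \<Longrightarrow> f $ n = 0) \<Longrightarrow> polymat P (un i j f)"
  unfolding polymat_def supported_un by (auto simp: un_def)

lemma mat_Tplus_series:
  assumes supp: "\<And>n. f $ n \<noteq> 0 \<Longrightarrow> mpow P n i j > 0" and sm: "summable (\<lambda>n. cmod (f $ n) / sqrt (mpow P n i j))"
  shows "un i j f \<in> mat_Tplus P"
proof (rule mat_TplusI)
  show "supported P (un i j f)" using supp by (simp add: supported_un)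
  fix e :: real assume e: "e > 0"
  let ?c = "real CARD('a)" and ?a = "\<lambda>n. cmod (f $ n) / sqrt (mpow P n i j)"
  have c: "?c > 0" by simp
  obtain N where N: "norm (\<Sum>n. ?a (n + N)) < e / ?c" using suminf_exist_split[OF _ sm, of "e / ?c"] e c by auto
  let ?Y = "un i j (fps_cutoff N f)"
  have Y: "polymat P ?Y" by (rule polymat_un[of _ _ _ N]) (use supp in \<open>auto split: if_splits\<close>)
  have d: "msub (un i j f) ?Y = un i j (f - fps_cutoff N f)" by (auto simp: msub_def un_def fun_eq_iff)
  have w: "wnorm P (un i j (f - fps_cutoff N f)) = (\<lambda>n. if n < N then 0 else ?a n)"
    by (auto simp: wnorm_un fun_eq_iff)
  have s: "summable (\<lambda>n. if n < N then 0 else ?a n)"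
    by (rule summable_comparison_test[OF _ sm]) (auto simp: mpow_nonneg)
  have "suminf (\<lambda>n. if n < N then 0 else ?a n) = (\<Sum>n. ?a (n + N))"
    using suminf_split_initial_segment[OF s, of N] by simp
  then have "?c * suminf (wnorm P (msub (un i j f) ?Y)) \<le> e" unfolding d w using N c by (simp add: field_simps abs_less_iff)
  moreover have "supported P (msub (un i j f) ?Y)"
    unfolding d supported_un using supp by (auto split: if_splits)
  then have "bnd P (msub (un i j f) ?Y) (?c * suminf (wnorm P (msub (un i j f) ?Y)))"
    by (rule bnd_young) (simp add: d w s)
  ultimately show "\<exists>Y d. polymat P Y \<and> bnd P (msub (un i j f) Y) d \<and> d \<le> e" using Y by blast
qed

text \<open>In a recurrent column the weights \<open>P\<^sup>n\<^sub>i\<^sub>b\<close> are bounded below, so the backward shift by \<open>K\<close> is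
  a bounded operator there; it sends \<open>z\<^sup>K H E\<^sub>i\<^sub>l\<close> to \<open>H E\<^sub>k\<^sub>l\<close>.\<close>

lemma bnd_backshift:
  assumes l: "recurrent P l" and \<delta>: "\<delta> > 0" "\<And>n i k. recurrent P k \<Longrightarrow> mpow P n i k > 0 \<Longrightarrow> \<delta> \<le> mpow P n i k"
    and b: "bnd P (un i l (fps_X ^ K * H)) D" and H: "\<And>n. H $ n \<noteq> 0 \<Longrightarrow> mpow P n k l > 0"
  shows "bnd P (un k l H) (D / sqrt \<delta>)"
  unfolding bnd_def
proof (intro conjI allI impI)
  let ?X = "un i l (fps_X ^ K * H)"
  have D: "D \<ge> 0" by (rule bndD(1)[OF b])
  then show "0 \<le> D / sqrt \<delta>" using \<delta> by simp
  show sH: "supported P (un k l H)" using H by (simp add: supported_un)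
  fix \<xi> assume \<xi>: "inFock P \<xi>"
  define \<zeta> where "\<zeta> = opof P ?X \<xi>"
  have \<zeta>: "inFock P \<zeta>" unfolding \<zeta>_def by (rule bndD(3)[OF b \<xi>])
  have ar: "mpow P n a b > 0" if "opof P (un k l H) \<xi> n a b \<noteq> 0" for n a b
    using that rt_nz by (auto simp: opof_eq[OF \<xi>])
  have comp: "cmod (opof P (un k l H) \<xi> n a c) \<le> (if a = k then cmod (\<zeta> (n + K) i c) / sqrt \<delta> else 0)" for n a c
  proof (cases "a = k \<and> opof P (un k l H) \<xi> n a c \<noteq> 0")
    case True
    then have pos: "mpow P n k c > 0" using ar by blast
    have eq: "mm (un k l H) (fs P \<xi>) k c = H * fs P \<xi> l c" "mm ?X (fs P \<xi>) i c = fps_X ^ K * (H * fs P \<xi> l c)"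
      by (simp_all add: mm_un_left mult.assoc)
    have "fs P \<xi> l c \<noteq> 0" using True by (auto simp: opof_eq[OF \<xi>] eq)
    then obtain m where "mpow P m l c > 0" using fs_supported[of \<xi>] unfolding supported_def
      by (metis fps_nonzero_nth)
    \<comment> \<open>Column c is reached from the recurrent state l, so its positive weights are at
      least \<delta>.\<close>
    then have rc: "recurrent P c" using recurrent_reach[OF l] reachI by blast
    have "opof P (un k l H) \<xi> n a c = rt P (n + K) i c * \<zeta> (n + K) i c / rt P n k c"
    proof -
      have "rt P (n + K) i c * \<zeta> (n + K) i c = mm ?X (fs P \<xi>) i c $ (n + K)"
        using arg_cong[OF fs_opof[OF bndD(2)[OF b] \<xi>], of "\<lambda>Z. Z i c $ (n + K)"] by (simp add: fs_def \<zeta>_def)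
      then show ?thesis using True by (simp add: opof_eq[OF \<xi>] eq fps_X_power_mult_nth)
    qed
    then have "cmod (opof P (un k l H) \<xi> n a c) = cmod (rt P (n + K) i c) * cmod (\<zeta> (n + K) i c) / sqrt (mpow P n k c)"
      by (simp add: norm_mult norm_divide cmod_rt)
    also have "\<dots> \<le> 1 * cmod (\<zeta> (n + K) i c) / sqrt (mpow P n k c)"
      by (intro divide_right_mono mult_right_mono cmod_rt_le) (auto simp: mpow_nonneg)
    also have "\<dots> \<le> cmod (\<zeta> (n + K) i c) / sqrt \<delta>"
      using \<delta>(2)[OF rc pos] \<delta>(1) pos by (simp add: divide_left_mono)
    finally show ?thesis using True by simp
  next
    case False
    then have "opof P (un k l H) \<xi> n a c = 0" by (auto simp: opof_eq[OF \<xi>] mm_un_left)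
    then show ?thesis using \<delta> by simp
  qed
  let ?s = "\<lambda>\<xi> n c. \<Sum>a\<in>UNIV. (cmod (\<xi> n a c))\<^sup>2"
  have le: "?s (opof P (un k l H) \<xi>) n c \<le> (1 / \<delta>) * ?s \<zeta> (n + K) c" for n c
  proof -
    have "?s (opof P (un k l H) \<xi>) n c \<le> (\<Sum>a\<in>UNIV. if a = k then (cmod (\<zeta> (n + K) i c) / sqrt \<delta>)\<^sup>2 else 0)"
    proof (rule sum_mono)
      fix a
      show "(cmod (opof P (un k l H) \<xi> n a c))\<^sup>2 \<le> (if a = k then (cmod (\<zeta> (n + K) i c) / sqrt \<delta>)\<^sup>2 else 0)"
        using comp[of n a c] power_mono[OF comp[of n a c] norm_ge_zero, of 2] by (cases "a = k") auto
    qed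
    also have "\<dots> = (1 / \<delta>) * (cmod (\<zeta> (n + K) i c))\<^sup>2" using \<delta> by (simp add: power_divide)
    also have "\<dots> \<le> (1 / \<delta>) * ?s \<zeta> (n + K) c"
      using \<delta> by (intro mult_left_mono member_le_sum[where f="\<lambda>a. (cmod (\<zeta> (n + K) a c))\<^sup>2"]) auto
    finally show ?thesis .
  qed
  have s0: "summable (\<lambda>n. ?s \<zeta> (n + K) c)" for c
    by (rule summable_ignore_initial_segment[OF inFock_summable[OF \<zeta>]])
  have s1: "summable (\<lambda>n. ?s (opof P (un k l H) \<xi>) n c)" for c
    by (rule summable_comparison_test[OF _ summable_mult[OF s0[of c], of "1 / \<delta>"]])
      (use le in \<open>auto simp: abs_of_nonneg sum_nonneg\<close>)
  show "inFock P (opof P (un k l H) \<xi>)" using s1 ar by (auto simp: inFock_def arv_def)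
  show "fock_norm (opof P (un k l H) \<xi>) \<le> D / sqrt \<delta> * fock_norm \<xi>"
  proof (rule fock_norm_le)
    fix c
    have "colsum (opof P (un k l H) \<xi>) c \<le> (\<Sum>n. (1 / \<delta>) * ?s \<zeta> (n + K) c)"
      unfolding colsum_def by (rule suminf_le[OF le s1 summable_mult[OF s0]])
    also have "\<dots> = (1 / \<delta>) * (\<Sum>n. ?s \<zeta> (n + K) c)" by (rule suminf_mult[OF s0])
    also have "\<dots> \<le> (1 / \<delta>) * colsum \<zeta> c"
    proof -
      have "(\<Sum>n. ?s \<zeta> (n + K) c) \<le> colsum \<zeta> c"
        unfolding colsum_def using suminf_split_initial_segment[OF inFock_summable[OF \<zeta>, of c], of K]
        by (simp add: sum_nonneg)
      then show ?thesis using \<delta> by (intro mult_left_mono) auto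
    qed
    also have "\<dots> \<le> (1 / \<delta>) * (D * fock_norm \<xi>)\<^sup>2"
    proof -
      have "colsum \<zeta> c \<le> (fock_norm \<zeta>)\<^sup>2" by (rule colsum_le_norm[OF \<zeta>])
      also have "\<dots> \<le> (D * fock_norm \<xi>)\<^sup>2"
        unfolding \<zeta>_def by (rule power_mono[OF bndD(4)[OF b \<xi>]]) (use fock_norm_nonneg[OF \<zeta>] in \<open>simp add: \<zeta>_def\<close>)
      finally show ?thesis using \<delta> by (intro mult_left_mono) auto
    qed
    also have "\<dots> = (D / sqrt \<delta> * fock_norm \<xi>)\<^sup>2" using \<delta> by (simp add: power_mult_distrib power_divide)
    finally show "colsum (opof P (un k l H) \<xi>) c \<le> (D / sqrt \<delta> * fock_norm \<xi>)\<^sup>2" .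
  qed (use D \<delta> fock_norm_nonneg[OF \<xi>] in auto)
qed

lemma bnd_unit: "bnd P (un i i 1) (real CARD('a))"
proof -
  have w: "wnorm P (un i i 1) = (\<lambda>n. if n = 0 then 1 else 0)" by (auto simp: wnorm_un fun_eq_iff)
  have "summable (wnorm P (un i i 1))" unfolding w by (rule summable_finite[of "{0}"]) auto
  moreover have "suminf (wnorm P (un i i 1)) = 1"
    unfolding w using suminf_finite[of "{0}" "\<lambda>n::nat. if n = 0 then 1 else (0::real)"] by simp
  moreover have "supported P (un i i 1)" by (auto simp: supported_un)
  ultimately show ?thesis using bnd_young[of "un i i 1"] by simp
qed

lemma mat_Tplus_div:
  assumes X: "un i l (fps_X ^ K * G) \<in> mat_Tplus P" and l: "recurrent P l"
    and G: "\<And>n. G $ n \<noteq> 0 \<Longrightarrow> mpow P n k l > 0"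
    and fin: "finite {n. mpow P (n + K) i l > 0 \<and> mpow P n k l = 0}"
  shows "un k l G \<in> mat_Tplus P"
proof (rule mat_TplusI)
  show "supported P (un k l G)" using G by (simp add: supported_un)
  fix e :: real assume e: "e > 0"
  let ?c = "real CARD('a)"
  obtain \<delta> where \<delta>: "\<delta> > 0" "\<And>n i k. recurrent P k \<Longrightarrow> mpow P n i k > 0 \<Longrightarrow> \<delta> \<le> mpow P n i k"
    using recurrent_lower by blast
  define F where "F = {..<K} \<union> (\<lambda>n. n + K) ` {n. mpow P (n + K) i l > 0 \<and> mpow P n k l = 0}"
  have F: "finite F" unfolding F_def using fin by simp
  \<comment> \<open>Accumulates the constants of compressing to one entry, of the dropped
    coefficients and of the backward shift, so that the final error is A * d.\<close>
  define A where "A = 2 * (?c * ?c + ?c * card F) / sqrt \<delta>"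
  have A: "A \<ge> 0" using \<delta> by (simp add: A_def)
  define d where "d = e / (A + 1)"
  have d: "d > 0" using e A by (simp add: d_def)
  obtain Z where Z: "polymat P Z" "bnd P (msub (un i l (fps_X ^ K * G)) Z) d" using mat_TplusD[OF X d] by blast
  define z where "z = Z i l"
  obtain N where N: "\<And>n. n \<ge> N \<Longrightarrow> z $ n = 0" using Z(1) by (auto simp: polymat_def z_def)
  have zs: "mpow P n i l > 0" if "z $ n \<noteq> 0" for n using Z(1) that by (auto simp: polymat_def supported_def z_def)
  define H where "H = Abs_fps (\<lambda>n. if mpow P n k l > 0 then z $ (n + K) else 0)"
  have Hp: "polymat P (un k l H)" by (rule polymat_un[of _ _ _ N]) (auto simp: H_def N split: if_splits)
  have zF: "(z - fps_X ^ K * H) $ n = (if n \<in> F then z $ n else 0)" for n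
  proof (cases "n < K")
    case False
    then obtain m where m: "n = m + K" by (metis le_add_diff_inverse2 not_less)
    show ?thesis unfolding m using zs[of "m + K"] mpow_pos_iff[of m k l]
      by (auto simp: fps_X_power_mult_nth H_def F_def)
  qed (auto simp: fps_X_power_mult_nth F_def)
  have XF: "(fps_X ^ K * G) $ n = 0" if "n \<in> F" for n
    using that G by (auto simp: F_def fps_X_power_mult_nth) (metis less_irrefl)
  have b1: "bnd P (un i l (fps_X ^ K * G - z)) (?c * (d * ?c))"
  proof -
    have "mm (un i i 1) (mm (msub (un i l (fps_X ^ K * G)) Z) (un l l 1)) = un i l (fps_X ^ K * G - z)"
      by (simp add: mm_un_both msub_def z_def)
    then show ?thesis using bnd_mm[OF bnd_unit[of i] bnd_mm[OF Z(2) bnd_unit[of l]]] by simp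
  qed
  have b2: "bnd P (un i l (z - fps_X ^ K * H)) (?c * (d * card F))"
  proof -
    let ?w = "wnorm P (un i l (z - fps_X ^ K * H))"
    have w: "?w n = (if n \<in> F then cmod (z $ n) / sqrt (mpow P n i l) else 0)" for n
      unfolding wnorm_un zF by simp
    have wd: "?w n \<le> d" if "n \<in> F" for n
    proof -
      have "cmod (un i l (fps_X ^ K * G - z) i l $ n) \<le> d * sqrt (mpow P n i l)"
        using bnd_coeff[OF Z(2), of i l n] by (simp add: msub_def z_def)
      then have "cmod (z $ n) \<le> d * sqrt (mpow P n i l)" using XF[OF that] by simp
      then show ?thesis unfolding w using that d mpow_nonneg[of n i l]
        by (cases "mpow P n i l = 0") (auto simp: divide_le_eq)
    qed
    have sm: "summable ?w" by (rule summable_finite[OF F]) (simp add: w)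
    have "suminf ?w = (\<Sum>n\<in>F. ?w n)" by (rule suminf_finite[OF F]) (simp add: w)
    also have "\<dots> \<le> (\<Sum>n\<in>F. d)" by (rule sum_mono) (rule wd)
    finally have "suminf ?w \<le> d * card F" by (simp add: mult.commute)
    moreover have "supported P (un i l (z - fps_X ^ K * H))"
      unfolding supported_un zF using zs by auto
    ultimately show ?thesis using bnd_mono[OF bnd_young[OF _ sm]] by (simp add: mult_left_mono)
  qed
  have "madd (un i l (fps_X ^ K * G - z)) (un i l (z - fps_X ^ K * H)) = un i l (fps_X ^ K * (G - H))"
    by (simp add: madd_un right_diff_distrib)
  then have b3: "bnd P (un i l (fps_X ^ K * (G - H))) (2 * (?c * (d * ?c) + ?c * (d * card F)))"
    using bnd_madd[OF b1 b2] by simp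
  have "bnd P (un k l (G - H)) (2 * (?c * (d * ?c) + ?c * (d * card F)) / sqrt \<delta>)"
    by (rule bnd_backshift[OF l \<delta> b3]) (use G in \<open>auto simp: H_def split: if_splits\<close>)
  moreover have "msub (un k l G) (un k l H) = un k l (G - H)" by (auto simp: msub_def un_def fun_eq_iff)
  moreover have "2 * (?c * (d * ?c) + ?c * (d * card F)) / sqrt \<delta> = A * d" by (simp add: A_def algebra_simps)
  moreover have "A * d \<le> e"
  proof -
    have "A * d \<le> (A + 1) * d" using d by simp
    then show ?thesis using A by (simp add: d_def)
  qed
  ultimately show "\<exists>Y d. polymat P Y \<and> bnd P (msub (un k l G) Y) d \<and> d \<le> e" using Hp by metis
qed

lemma mat_Tplus_series_alg: "series_alg P (mat_Tplus P)"
proof unfold_locales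
  fix X Y c assume X: "X \<in> mat_Tplus P"
  then obtain D where "bnd P X D" using mat_Tplus_bnd by blast
  then show "\<exists>K. \<forall>i j n. cmod (X i j $ n) \<le> K * sqrt (mpow P n i j)" using bnd_coeff by blast
  show "mscale c X \<in> mat_Tplus P" by (rule mat_Tplus_mscale[OF X])
  assume Y: "Y \<in> mat_Tplus P"
  show "madd X Y \<in> mat_Tplus P" by (rule mat_Tplus_madd[OF X Y])
  show "mm X Y \<in> mat_Tplus P" by (rule mat_Tplus_mm[OF X Y])
next
  fix f i j assume "\<And>n. f $ n \<noteq> 0 \<Longrightarrow> mpow P n i j > 0" "summable (\<lambda>n. cmod (f $ n) / sqrt (mpow P n i j))"
  then show "un i j f \<in> mat_Tplus P" by (rule mat_Tplus_series)
next
  fix i l K G k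
  assume "un i l (fps_X ^ K * G) \<in> mat_Tplus P" "recurrent P l" "\<And>n. G $ n \<noteq> 0 \<Longrightarrow> mpow P n k l > 0"
    "finite {n. mpow P (n + K) i l > 0 \<and> mpow P n k l = 0}"
  then show "un k l G \<in> mat_Tplus P" by (rule mat_Tplus_div)
qed

end

lemma alg_iso_series_iso:
  assumes P: "stochastic P" and Q: "stochastic Q" and \<phi>: "alg_iso P Q \<phi>"
  shows "series_iso P (mat_Tplus P) Q (mat_Tplus Q) (\<lambda>X. fs Q (\<phi> (opof P X) vac))"
proof -
  interpret p: stoch P by (rule stoch_I[OF P])
  interpret q: stoch Q by (rule stoch_I[OF Q])
  interpret p: series_alg P "mat_Tplus P" by (rule p.mat_Tplus_series_alg)
  interpret q: series_alg Q "mat_Tplus Q" by (rule q.mat_Tplus_series_alg)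
  let ?\<psi> = "\<lambda>X. fs Q (\<phi> (opof P X) vac)"
  have bij: "bij_betw \<phi> (Tplus P) (Tplus Q)"
    and hom: "\<And>S T. S \<in> Tplus P \<Longrightarrow> T \<in> Tplus P \<Longrightarrow> \<phi> (op_add S T) = op_add (\<phi> S) (\<phi> T) \<and> \<phi> (S \<circ> T) = \<phi> S \<circ> \<phi> T"
    and sc: "\<And>T c. T \<in> Tplus P \<Longrightarrow> \<phi> (op_scale c T) = op_scale c (\<phi> T)"
    using \<phi> unfolding alg_iso_def by auto
  have in_Q: "\<phi> T \<in> Tplus Q" if "T \<in> Tplus P" for T using bij that by (auto simp: bij_betw_def)
  have rep: "opof Q (?\<psi> X) = \<phi> (opof P X)" "?\<psi> X \<in> mat_Tplus Q" if "X \<in> mat_Tplus P" for X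
    using q.Tplus_matrix[OF in_Q[OF p.matrix_Tplus[OF that]]] by auto
  have uniq: "?\<psi> X = Y" if "\<phi> (opof P X) = opof Q Y" "Y \<in> mat_Tplus Q" for X Y
    using that q.co_opof q.mat_Tplus_supported by simp
  show ?thesis
  proof unfold_locales
    show "bij_betw ?\<psi> (mat_Tplus P) (mat_Tplus Q)"
      unfolding bij_betw_def
    proof
      show "inj_on ?\<psi> (mat_Tplus P)"
      proof (rule inj_onI)
        fix X Y assume XY: "X \<in> mat_Tplus P" "Y \<in> mat_Tplus P" "?\<psi> X = ?\<psi> Y"
        have "\<phi> (opof P X) = opof Q (?\<psi> X)" by (rule rep(1)[OF XY(1), symmetric])
        also have "\<dots> = opof Q (?\<psi> Y)" by (simp only: XY(3))
        also have "\<dots> = \<phi> (opof P Y)" by (rule rep(1)[OF XY(2)])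
        finally have "\<phi> (opof P X) = \<phi> (opof P Y)" .
        then have "opof P X = opof P Y"
          using bij p.matrix_Tplus[OF XY(1)] p.matrix_Tplus[OF XY(2)] by (auto simp: bij_betw_def inj_on_def)
        then show "X = Y" using p.co_opof p.mat_Tplus_supported XY(1,2) by metis
      qed
      show "?\<psi> ` mat_Tplus P = mat_Tplus Q"
      proof (intro set_eqI iffI)
        fix Y assume Y: "Y \<in> mat_Tplus Q"
        then have "opof Q Y \<in> \<phi> ` Tplus P" using bij q.matrix_Tplus by (auto simp: bij_betw_def)
        then obtain T where T: "T \<in> Tplus P" "\<phi> T = opof Q Y" by auto
        have "\<phi> (opof P (fs P (T vac))) = opof Q Y" using T(2) by (simp only: p.Tplus_matrix(1)[OF T(1), symmetric])
        then have "?\<psi> (fs P (T vac)) = Y" by (rule uniq[OF _ Y])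
        then show "Y \<in> ?\<psi> ` mat_Tplus P" using p.Tplus_matrix(2)[OF T(1)] by blast
      qed (use rep in auto)
    qed
    fix X Y c assume X: "X \<in> mat_Tplus P"
    show "?\<psi> (mscale c X) = mscale c (?\<psi> X)"
    proof (rule uniq)
      show "\<phi> (opof P (mscale c X)) = opof Q (mscale c (?\<psi> X))"
        by (simp only: p.opof_mscale[symmetric] sc[OF p.matrix_Tplus[OF X]] q.opof_mscale[symmetric] rep(1)[OF X])
    qed (rule q.M_mscale[OF rep(2)[OF X]])
    assume Y: "Y \<in> mat_Tplus P"
    note h = hom[OF p.matrix_Tplus[OF X] p.matrix_Tplus[OF Y]]
    show "?\<psi> (madd X Y) = madd (?\<psi> X) (?\<psi> Y)"
    proof (rule uniq)
      show "\<phi> (opof P (madd X Y)) = opof Q (madd (?\<psi> X) (?\<psi> Y))"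
        by (simp only: p.opof_madd[symmetric] h q.opof_madd[symmetric] rep(1)[OF X] rep(1)[OF Y])
    qed (rule q.M_madd[OF rep(2)[OF X] rep(2)[OF Y]])
    show "?\<psi> (mm X Y) = mm (?\<psi> X) (?\<psi> Y)"
    proof (rule uniq)
      show "\<phi> (opof P (mm X Y)) = opof Q (mm (?\<psi> X) (?\<psi> Y))"
        by (simp only: p.mat_Tplus_opof_mm[OF Y, symmetric] h q.mat_Tplus_opof_mm[OF rep(2)[OF Y], symmetric]
            rep(1)[OF X] rep(1)[OF Y])
    qed (rule q.M_mm[OF rep(2)[OF X] rep(2)[OF Y]])
  qed
qed

theorem alg_iso_graph_rate:
  assumes "stochastic P" "stochastic Q" "alg_iso P Q \<phi>"
  obtains \<sigma> where "bij \<sigma>" "\<And>i j. P i j > 0 \<longleftrightarrow> Q (\<sigma> i) (\<sigma> j) > 0" "\<And>i. rate P i = rate Q (\<sigma> i)"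
proof -
  interpret series_iso P "mat_Tplus P" Q "mat_Tplus Q" "\<lambda>X. fs Q (\<phi> (opof P X) vac)"
    by (rule alg_iso_series_iso[OF assms])
  show ?thesis using that[OF bij_sg edge_iff rate_eq] .
qed

section \<open>Weighted relabellings\<close>

lemma integral_cis: "integral {0..1::real} (\<lambda>t. cis (2 * pi * of_int m * t)) = (if m = 0 then 1 else 0)"
proof (cases "m = 0")
  case False
  define c where "c = \<i> * complex_of_real (2 * pi * of_int m)"
  have c: "c \<noteq> 0" using False by (simp add: c_def)
  have cis: "cis (2 * pi * of_int m * t) = exp (c * of_real t)" for t :: real
    by (simp add: c_def cis_conv_exp mult.assoc)
  have "((\<lambda>t. exp (c * of_real t)) has_integral (exp (c * of_real 1) / c - exp (c * of_real 0) / c)) {0..1::real}"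
  proof (rule fundamental_theorem_of_calculus)
    fix x :: real
    have "((\<lambda>z. exp (c * z) / c) has_field_derivative exp (c * of_real x)) (at (of_real x))"
      using c by (auto intro!: derivative_eq_intros)
    then show "((\<lambda>t. exp (c * of_real t) / c) has_vector_derivative exp (c * of_real x)) (at x within {0..1})"
      by (rule has_vector_derivative_real_field)
  qed simp
  moreover have "exp (c * of_real 1) = 1"
    using exp_integer_2pi[of "of_int m"] by (simp add: c_def mult_ac)
  ultimately have "integral {0..1::real} (\<lambda>t. exp (c * of_real t)) = 0" by (simp add: integral_unique)
  then show ?thesis using False by (simp add: cis)
qed simp

definition hompart :: "int \<Rightarrow> 'a fpsmat \<Rightarrow> 'a fpsmat" where
  "hompart n X = (\<lambda>i j. if n < 0 then 0 else fps_const (X i j $ nat n) * fps_X ^ nat n)"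

lemma hompart_nth: "hompart n X i j $ s = (if int s = n then X i j $ s else 0)"
  by (auto simp: hompart_def fps_X_power_nth)

lemma hompart_idem: "hompart n (hompart n X) = hompart n X"
  by (auto simp: fun_eq_iff fps_eq_iff hompart_nth)

lemma inFock_gauge: assumes "cmod z = 1" shows "inFock P (gauge z \<xi>) \<longleftrightarrow> inFock P \<xi>"
proof -
  have "z ^ n * x \<noteq> 0 \<longleftrightarrow> x \<noteq> 0" for n x using assms by auto
  then show ?thesis using assms by (simp add: inFock_def gauge_def arv_def norm_mult norm_power)
qed

text \<open>The gauge action multiplies the part of X of degree s by z^s, so the integral selects s
  = n.\<close>

lemma Phi_opof: "Phi n (opof P X) = opof P (hompart n X)"
proof (intro ext)
  fix \<xi> k i j
  show "Phi n (opof P X) \<xi> k i j = opof P (hompart n X) \<xi> k i j"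
  proof (cases "inFock P \<xi>")
    case False
    have "gauge_act (cis (2 * pi * t)) (opof P X) \<xi> = (\<lambda>_ _ _. 0)" for t
      using False inFock_gauge[of "cnj (cis (2 * pi * t))" P \<xi>]
      by (simp add: gauge_act_def opof_def) (simp add: gauge_def fzero_def)
    then show ?thesis using False by (simp add: Phi_def opof_def fzero_def)
  next
    case True
    define c where "c = (\<lambda>s. (\<Sum>l\<in>UNIV. X i l $ s * fs P \<xi> l j $ (k - s)) / rt P k i j)"
    have 1: "gauge_act (cis (2 * pi * t)) (opof P X) \<xi> k i j * cis (- 2 * pi * of_int n * t)
        = (\<Sum>s=0..k. c s * cis (2 * pi * of_int (int s - n) * t))" for t
    proof -
      let ?z = "cis (2 * pi * t)"
      have fsg: "fs P (gauge (cnj ?z) \<xi>) l j $ m = cnj ?z ^ m * fs P \<xi> l j $ m" for l m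
        by (simp add: fs_def gauge_def mult_ac)
      have "gauge_act ?z (opof P X) \<xi> k i j
          = ?z ^ k * ((\<Sum>l\<in>UNIV. \<Sum>s=0..k. X i l $ s * (cnj ?z ^ (k - s) * fs P \<xi> l j $ (k - s))) / rt P k i j)"
        using True by (simp add: gauge_act_def gauge_def[of ?z] opof_def inFock_gauge mm_def fps_sum_nth fps_mult_nth fsg)
      also have "\<dots> = (\<Sum>s=0..k. c s * (?z ^ k * cnj ?z ^ (k - s)))"
        by (subst sum.swap) (simp add: c_def sum_distrib_left sum_distrib_right sum_divide_distrib mult_ac)
      also have "\<dots> = (\<Sum>s=0..k. c s * cis (2 * pi * t * of_nat s))"
      proof (rule sum.cong[OF refl])
        fix s assume "s \<in> {0..k}"
        then have "?z ^ k = ?z ^ s * ?z ^ (k - s)" by (simp add: power_add[symmetric])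
        moreover have "?z ^ (k - s) * cnj ?z ^ (k - s) = 1"
          by (simp add: power_mult_distrib[symmetric] cis_cnj cis_mult)
        ultimately have "?z ^ k * cnj ?z ^ (k - s) = ?z ^ s" by (simp only: mult.assoc mult_1_right)
        also have "?z ^ s = cis (of_nat s * (2 * pi * t))" by (rule Complex.DeMoivre)
        finally show "c s * (?z ^ k * cnj ?z ^ (k - s)) = c s * cis (2 * pi * t * of_nat s)"
          by (simp only: mult.commute)
      qed
      finally have eq: "gauge_act ?z (opof P X) \<xi> k i j = (\<Sum>s=0..k. c s * cis (2 * pi * t * of_nat s))" .
      show ?thesis unfolding eq sum_distrib_right
        by (rule sum.cong) (simp_all add: mult.assoc cis_mult right_diff_distrib left_diff_distrib mult_ac)
    qed
    have "Phi n (opof P X) \<xi> k i j = (\<Sum>s=0..k. c s * integral {0..1::real} (\<lambda>t. cis (2 * pi * of_int (int s - n) * t)))"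
      unfolding Phi_def 1
      by (subst integral_sum) (auto intro!: integrable_continuous_interval continuous_intros)
    also have "\<dots> = (\<Sum>s=0..k. if int s = n then c s else 0)"
      unfolding integral_cis by (rule sum.cong) auto
    also have "\<dots> = opof P (hompart n X) \<xi> k i j"
    proof -
      have "opof P (hompart n X) \<xi> k i j = (\<Sum>l\<in>UNIV. \<Sum>s=0..k. (if int s = n then X i l $ s * fs P \<xi> l j $ (k - s) else 0)) / rt P k i j"
        using True by (auto simp: opof_def mm_def fps_sum_nth fps_mult_nth hompart_nth intro!: sum.cong arg_cong2[of _ _ _ _ "(/)"])
      also have "\<dots> = (\<Sum>s=0..k. if int s = n then c s else 0)"
        by (subst sum.swap) (auto simp: c_def sum_divide_distrib intro!: sum.cong)
      finally show ?thesis by simp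
    qed
    finally show ?thesis .
  qed
qed

text \<open>The normal form of a similarity: entries are relabelled by \<sigma> and multiplied by v.
  \<open>v_mult\<close> says that this respects U, and C bounds v and 1 / v. The weights are nonzero
  also off the support, so that V and W are invertible on all functions.\<close>

locale relabel = p: stoch P + q: stoch Q for P Q :: "'a::finite \<Rightarrow> 'a \<Rightarrow> real" +
  fixes \<sigma> :: "'a \<Rightarrow> 'a" and v :: "nat \<Rightarrow> 'a \<Rightarrow> 'a \<Rightarrow> complex" and C :: real
  assumes bij: "bij \<sigma>"
    and supp: "mpow P n i j > 0 \<longleftrightarrow> mpow Q n (\<sigma> i) (\<sigma> j) > 0"
    and v_nz: "v n i j \<noteq> 0"
    and v_le: "cmod (v n i j) \<le> C" and v_ge: "1 \<le> C * cmod (v n i j)"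
    and v_mult: "mpow P n i l > 0 \<Longrightarrow> mpow P m l k > 0 \<Longrightarrow>
       v (n + m) i k * (rt P n i l * rt P m l k / rt P (n + m) i k)
       = (rt Q n (\<sigma> i) (\<sigma> l) * rt Q m (\<sigma> l) (\<sigma> k) / rt Q (n + m) (\<sigma> i) (\<sigma> k)) * (v n i l * v m l k)"
begin

definition \<tau> :: "'a \<Rightarrow> 'a" where "\<tau> = inv \<sigma>"

lemma \<sigma>\<tau> [simp]: "\<sigma> (\<tau> a) = a" and \<tau>\<sigma> [simp]: "\<tau> (\<sigma> a) = a"
  using bij by (auto simp: \<tau>_def bij_def surj_f_inv_f inv_f_f)

lemma bij_\<tau>: "bij \<tau>"
  unfolding \<tau>_def by (rule bij_imp_bij_inv[OF bij])

lemma C_pos: "C > 0"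
  using v_le[of 0 undefined undefined] v_nz[of 0 undefined undefined]
  by (meson less_le_trans zero_less_norm_iff)

lemma inverse: "relabel Q P \<tau> (\<lambda>n a b. 1 / v n (\<tau> a) (\<tau> b)) C"
proof unfold_locales
  show "bij \<tau>" by (rule bij_\<tau>)
  show "mpow Q n i j > 0 \<longleftrightarrow> mpow P n (\<tau> i) (\<tau> j) > 0" for n i j by (simp add: supp)
  show "1 / v n (\<tau> i) (\<tau> j) \<noteq> 0" for n i j using v_nz by simp
  show "cmod (1 / v n (\<tau> i) (\<tau> j)) \<le> C" for n i j
    using v_ge[of n "\<tau> i" "\<tau> j"] v_nz[of n "\<tau> i" "\<tau> j"] by (simp add: norm_divide divide_le_eq)
  show "1 \<le> C * cmod (1 / v n (\<tau> i) (\<tau> j))" for n i j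
    using v_le[of n "\<tau> i" "\<tau> j"] v_nz[of n "\<tau> i" "\<tau> j"] by (simp add: norm_divide le_divide_eq)
  fix n m i l k assume a: "mpow Q n i l > 0" "mpow Q m l k > 0"
  then have b: "mpow P n (\<tau> i) (\<tau> l) > 0" "mpow P m (\<tau> l) (\<tau> k) > 0" by (auto simp: supp)
  have nz: "rt P n (\<tau> i) (\<tau> l) \<noteq> 0" "rt P m (\<tau> l) (\<tau> k) \<noteq> 0" "rt P (n + m) (\<tau> i) (\<tau> k) \<noteq> 0"
    "rt Q n i l \<noteq> 0" "rt Q m l k \<noteq> 0" "rt Q (n + m) i k \<noteq> 0"
    using a b p.mpow_pos_add[OF b] q.mpow_pos_add[OF a] by (auto simp: p.rt_nz q.rt_nz)
  show "1 / v (n + m) (\<tau> i) (\<tau> k) * (rt Q n i l * rt Q m l k / rt Q (n + m) i k) =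
      rt P n (\<tau> i) (\<tau> l) * rt P m (\<tau> l) (\<tau> k) / rt P (n + m) (\<tau> i) (\<tau> k) *
      (1 / v n (\<tau> i) (\<tau> l) * (1 / v m (\<tau> l) (\<tau> k)))"
    using v_mult[OF b] nz v_nz[of "n + m" "\<tau> i" "\<tau> k"] v_nz[of n "\<tau> i" "\<tau> l"] v_nz[of m "\<tau> l" "\<tau> k"]
    by (simp add: field_simps)
qed

definition V :: "nat \<Rightarrow> ('a \<Rightarrow> 'a \<Rightarrow> complex) \<Rightarrow> 'a \<Rightarrow> 'a \<Rightarrow> complex" where
  "V n A = (\<lambda>a b. v n (\<tau> a) (\<tau> b) * A (\<tau> a) (\<tau> b))"

definition V' :: "nat \<Rightarrow> ('a \<Rightarrow> 'a \<Rightarrow> complex) \<Rightarrow> 'a \<Rightarrow> 'a \<Rightarrow> complex" where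
  "V' n A = (\<lambda>i j. A (\<sigma> i) (\<sigma> j) / v n i j)"

definition W :: "'a fock \<Rightarrow> 'a fock" where "W \<xi> = (\<lambda>n. V n (\<xi> n))"

definition W' :: "'a fock \<Rightarrow> 'a fock" where "W' \<xi> = (\<lambda>n. V' n (\<xi> n))"

lemma V_V' [simp]: "V n (V' n A) = A" and V'_V [simp]: "V' n (V n A) = A"
  using v_nz by (auto simp: V_def V'_def fun_eq_iff)

lemma W_W' [simp]: "W (W' \<xi>) = \<xi>" and W'_W [simp]: "W' (W \<xi>) = \<xi>"
  by (auto simp: W_def W'_def)

lemma V_arv: "A \<in> arv P n \<Longrightarrow> V n A \<in> arv Q n"
  by (auto simp: arv_def V_def) (metis supp \<sigma>\<tau>)

lemma V'_arv: "A \<in> arv Q n \<Longrightarrow> V' n A \<in> arv P n"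
  using supp by (auto simp: arv_def V'_def)

lemma U_V: assumes A: "A \<in> arv P n" and B: "B \<in> arv P m"
  shows "V (n + m) (U P n m A B) = U Q n m (V n A) (V m B)"
proof (intro ext)
  fix a b
  let ?i = "\<tau> a" and ?k = "\<tau> b"
  show "V (n + m) (U P n m A B) a b = U Q n m (V n A) (V m B) a b"
  proof (cases "mpow P (n + m) ?i ?k > 0")
    case True
    then have Q: "mpow Q (n + m) a b > 0" using supp[of "n + m" ?i ?k] by simp
    have "U Q n m (V n A) (V m B) a b = (\<Sum>c\<in>UNIV. (rt Q n a c * V n A a c) * (rt Q m c b * V m B c b)) / rt Q (n + m) a b"
      using Q by (simp add: U_def rt_def)
    also have "(\<Sum>c\<in>UNIV. (rt Q n a c * V n A a c) * (rt Q m c b * V m B c b))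
        = (\<Sum>l\<in>UNIV. (rt Q n a (\<sigma> l) * V n A a (\<sigma> l)) * (rt Q m (\<sigma> l) b * V m B (\<sigma> l) b))"
      by (rule sum.reindex_bij_betw[symmetric]) (use bij in simp)
    also have "\<dots> / rt Q (n + m) a b = (\<Sum>l\<in>UNIV. v (n + m) ?i ?k * ((rt P n ?i l * A ?i l) * (rt P m l ?k * B l ?k)) / rt P (n + m) ?i ?k)"
      unfolding sum_divide_distrib
    proof (rule sum.cong[OF refl])
      fix l
      show "(rt Q n a (\<sigma> l) * V n A a (\<sigma> l)) * (rt Q m (\<sigma> l) b * V m B (\<sigma> l) b) / rt Q (n + m) a b
         = v (n + m) ?i ?k * ((rt P n ?i l * A ?i l) * (rt P m l ?k * B l ?k)) / rt P (n + m) ?i ?k"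
      proof (cases "A ?i l = 0 \<or> B l ?k = 0")
        case False
        then have pos: "mpow P n ?i l > 0" "mpow P m l ?k > 0" using A B by (auto simp: arv_def)
        have "v (n + m) ?i ?k * ((rt P n ?i l * A ?i l) * (rt P m l ?k * B l ?k)) / rt P (n + m) ?i ?k
           = (v (n + m) ?i ?k * (rt P n ?i l * rt P m l ?k / rt P (n + m) ?i ?k)) * (A ?i l * B l ?k)"
          by simp
        then show ?thesis unfolding v_mult[OF pos] by (simp add: V_def)
      qed (auto simp: V_def)
    qed
    also have "\<dots> = V (n + m) (U P n m A B) a b"
      using True by (simp add: V_def U_def rt_def sum_distrib_left sum_divide_distrib)
    finally show ?thesis by simp
  next
    case False
    then have "\<not> mpow Q (n + m) a b > 0" using supp[of "n + m" ?i ?k] by simp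
    then show ?thesis using False by (simp add: V_def U_def)
  qed
qed

lemma V_colsum: "(\<Sum>a\<in>UNIV. (cmod (V n A a b))\<^sup>2) \<le> C\<^sup>2 * (\<Sum>i\<in>UNIV. (cmod (A i (\<tau> b)))\<^sup>2)"
proof -
  have "(\<Sum>a\<in>UNIV. (cmod (V n A a b))\<^sup>2) = (\<Sum>i\<in>UNIV. (cmod (V n A (\<sigma> i) b))\<^sup>2)"
    by (rule sum.reindex_bij_betw[symmetric]) (use bij in simp)
  also have "\<dots> \<le> (\<Sum>i\<in>UNIV. C\<^sup>2 * (cmod (A i (\<tau> b)))\<^sup>2)"
    by (rule sum_mono) (simp add: V_def norm_mult power_mult_distrib mult_right_mono power_mono v_le)
  finally show ?thesis by (simp add: sum_distrib_left)
qed

lemma cnorm_V: "cnorm (V n A) \<le> C * cnorm A"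
proof -
  let ?f = "\<lambda>A b. \<Sum>i\<in>UNIV. (cmod (A i b))\<^sup>2"
  have "Max (range (?f (V n A))) \<le> C\<^sup>2 * Max (range (?f A))"
  proof (rule Max.boundedI)
    fix x assume "x \<in> range (?f (V n A))"
    then obtain b where "x = ?f (V n A) b" by blast
    also have "\<dots> \<le> C\<^sup>2 * ?f A (\<tau> b)" by (rule V_colsum)
    also have "\<dots> \<le> C\<^sup>2 * Max (range (?f A))" by (intro mult_left_mono Max_ge) auto
    finally show "x \<le> C\<^sup>2 * Max (range (?f A))" .
  qed auto
  then have "sqrt (Max (range (?f (V n A)))) \<le> sqrt (C\<^sup>2 * Max (range (?f A)))" by simp
  then show ?thesis using C_pos by (simp add: cnorm_def real_sqrt_mult)
qed

lemma W_inFock: assumes "inFock P \<xi>"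
  shows "inFock Q (W \<xi>)" "colsum (W \<xi>) b \<le> C\<^sup>2 * colsum \<xi> (\<tau> b)"
proof -
  have le: "(\<Sum>a\<in>UNIV. (cmod (W \<xi> n a b))\<^sup>2) \<le> C\<^sup>2 * (\<Sum>i\<in>UNIV. (cmod (\<xi> n i (\<tau> b)))\<^sup>2)" for n b
    unfolding W_def by (rule V_colsum)
  have s: "summable (\<lambda>n. C\<^sup>2 * (\<Sum>i\<in>UNIV. (cmod (\<xi> n i (\<tau> b)))\<^sup>2))" for b
    by (rule summable_mult[OF inFock_summable[OF assms]])
  have z: "summable (\<lambda>n. \<Sum>a\<in>UNIV. (cmod (W \<xi> n a b))\<^sup>2)" for b
    by (rule summable_comparison_test[OF _ s[of b]]) (use le in \<open>auto simp: abs_of_nonneg sum_nonneg\<close>)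
  show "inFock Q (W \<xi>)" unfolding inFock_def using z V_arv assms by (auto simp: inFock_def W_def)
  have "colsum (W \<xi>) b \<le> (\<Sum>n. C\<^sup>2 * (\<Sum>i\<in>UNIV. (cmod (\<xi> n i (\<tau> b)))\<^sup>2))"
    unfolding colsum_def by (rule suminf_le[OF le z s])
  then show "colsum (W \<xi>) b \<le> C\<^sup>2 * colsum \<xi> (\<tau> b)"
    unfolding colsum_def by (subst (asm) suminf_mult[OF inFock_summable[OF assms]])
qed

lemma fock_norm_W: assumes "inFock P \<xi>" shows "fock_norm (W \<xi>) \<le> C * fock_norm \<xi>"
proof (rule fock_norm_le)
  fix b
  have "colsum (W \<xi>) b \<le> C\<^sup>2 * (fock_norm \<xi>)\<^sup>2"
    by (rule order_trans[OF W_inFock(2)[OF assms] mult_left_mono[OF colsum_le_norm[OF assms]]]) simp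
  then show "colsum (W \<xi>) b \<le> (C * fock_norm \<xi>)\<^sup>2" by (simp add: power_mult_distrib)
qed (use C_pos fock_norm_nonneg[OF assms] in simp)

lemma tuple_norm_W: assumes "\<And>s. s < k \<Longrightarrow> inFock P (\<xi> s)"
  shows "tuple_norm k (\<lambda>s. W (\<xi> s)) \<le> C * tuple_norm k \<xi>"
proof -
  let ?f = "\<lambda>\<xi> b. \<Sum>s<k. colsum (\<xi> s) b"
  have "Max (range (?f (\<lambda>s. W (\<xi> s)))) \<le> C\<^sup>2 * Max (range (?f \<xi>))"
  proof (rule Max.boundedI)
    fix x assume "x \<in> range (?f (\<lambda>s. W (\<xi> s)))"
    then obtain b where "x = ?f (\<lambda>s. W (\<xi> s)) b" by blast
    also have "\<dots> \<le> C\<^sup>2 * ?f \<xi> (\<tau> b)"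
      unfolding sum_distrib_left by (rule sum_mono) (use W_inFock(2) assms in auto)
    also have "\<dots> \<le> C\<^sup>2 * Max (range (?f \<xi>))" by (intro mult_left_mono Max_ge) auto
    finally show "x \<le> C\<^sup>2 * Max (range (?f \<xi>))" .
  qed auto
  then have "sqrt (Max (range (?f (\<lambda>s. W (\<xi> s))))) \<le> sqrt (C\<^sup>2 * Max (range (?f \<xi>)))" by simp
  then show ?thesis using C_pos by (simp add: tuple_norm_def colsum_def real_sqrt_mult)
qed

definition \<phi> :: "'a op \<Rightarrow> 'a op" where "\<phi> T = W \<circ> T \<circ> W'"

definition \<phi>' :: "'a op \<Rightarrow> 'a op" where "\<phi>' T = W' \<circ> T \<circ> W"

lemma \<phi>_\<phi>' [simp]: "\<phi> (\<phi>' T) = T" and \<phi>'_\<phi> [simp]: "\<phi>' (\<phi> T) = T"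
  by (auto simp: \<phi>_def \<phi>'_def fun_eq_iff)

text \<open>Lets the estimates for W and \<phi> be reused for their inverses.\<close>

lemma inverse_defs:
  "relabel.V \<tau> (\<lambda>n a b. 1 / v n (\<tau> a) (\<tau> b)) = V'"
  "relabel.W \<tau> (\<lambda>n a b. 1 / v n (\<tau> a) (\<tau> b)) = W'"
  "relabel.W' \<tau> (\<lambda>n a b. 1 / v n (\<tau> a) (\<tau> b)) = W"
  "relabel.\<phi> \<tau> (\<lambda>n a b. 1 / v n (\<tau> a) (\<tau> b)) = \<phi>'"
proof -
  interpret i: relabel Q P \<tau> "\<lambda>n a b. 1 / v n (\<tau> a) (\<tau> b)" C by (rule inverse)
  have t: "i.\<tau> = \<sigma>" unfolding i.\<tau>_def unfolding \<tau>_def using bij by (rule inv_inv_eq)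
  show V: "i.V = V'" by (auto simp: fun_eq_iff i.V_def V'_def t)
  have V2: "i.V' = V" by (auto simp: fun_eq_iff i.V'_def V_def)
  show W: "i.W = W'" by (auto simp: fun_eq_iff i.W_def W'_def V)
  show W2: "i.W' = W" by (auto simp: fun_eq_iff i.W'_def W_def V2)
  show "i.\<phi> = \<phi>'" by (auto simp: fun_eq_iff i.\<phi>_def \<phi>'_def W W2)
qed

lemma W'_inFock: "inFock Q \<xi> \<Longrightarrow> inFock P (W' \<xi>)"
  and fock_norm_W': "inFock Q \<xi> \<Longrightarrow> fock_norm (W' \<xi>) \<le> C * fock_norm \<xi>"
  and tuple_norm_W': "(\<And>s. s < k \<Longrightarrow> inFock Q (\<zeta> s)) \<Longrightarrow> tuple_norm k (\<lambda>s. W' (\<zeta> s)) \<le> C * tuple_norm k \<zeta>"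
proof -
  interpret i: relabel Q P \<tau> "\<lambda>n a b. 1 / v n (\<tau> a) (\<tau> b)" C by (rule inverse)
  show "inFock Q \<xi> \<Longrightarrow> inFock P (W' \<xi>)" "inFock Q \<xi> \<Longrightarrow> fock_norm (W' \<xi>) \<le> C * fock_norm \<xi>"
    "(\<And>s. s < k \<Longrightarrow> inFock Q (\<zeta> s)) \<Longrightarrow> tuple_norm k (\<lambda>s. W' (\<zeta> s)) \<le> C * tuple_norm k \<zeta>"
    using i.W_inFock(1) i.fock_norm_W i.tuple_norm_W unfolding inverse_defs by blast+
qed

lemma W'_inFock_iff: "inFock P (W' \<xi>) \<longleftrightarrow> inFock Q \<xi>"
  using W'_inFock W_inFock(1)[of "W' \<xi>"] by auto

lemma W_fzero [simp]: "W fzero = fzero"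
  by (auto simp: W_def V_def fzero_def)

lemma \<phi>_add: "\<phi> (op_add S T) = op_add (\<phi> S) (\<phi> T)"
  by (auto simp: \<phi>_def op_add_def W_def V_def fun_eq_iff distrib_left)

lemma \<phi>_diff: "\<phi> (op_diff S T) = op_diff (\<phi> S) (\<phi> T)"
  by (auto simp: \<phi>_def op_diff_def W_def V_def fun_eq_iff right_diff_distrib)

lemma \<phi>_scale: "\<phi> (op_scale c T) = op_scale c (\<phi> T)"
  by (auto simp: \<phi>_def op_scale_def W_def V_def fun_eq_iff)

lemma \<phi>_comp: "\<phi> (S \<circ> T) = \<phi> S \<circ> \<phi> T"
  by (auto simp: \<phi>_def fun_eq_iff)

lemma \<phi>_shift: assumes "A \<in> arv P n" shows "\<phi> (shift P n A) = shift Q n (V n A)"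
proof (rule ext)
  fix \<xi>
  show "\<phi> (shift P n A) \<xi> = shift Q n (V n A) \<xi>"
  proof (cases "inFock Q \<xi>")
    case True
    then have P: "inFock P (W' \<xi>)" by (rule W'_inFock)
    have "W (shift P n A (W' \<xi>)) k = shift Q n (V n A) \<xi> k" for k
    proof (cases "k < n")
      case True
      then show ?thesis using P \<open>inFock Q \<xi>\<close> by (simp add: shift_def W_def V_def)
    next
      case False
      have "W (shift P n A (W' \<xi>)) k = V (n + (k - n)) (U P n (k - n) A (V' (k - n) (\<xi> (k - n))))"
        using False P by (simp add: shift_def W_def W'_def)
      also have "\<dots> = U Q n (k - n) (V n A) (V (k - n) (V' (k - n) (\<xi> (k - n))))"
        by (rule U_V[OF assms V'_arv]) (use True in \<open>simp add: inFock_def\<close>)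
      finally show ?thesis using False True by (simp add: shift_def)
    qed
    then show ?thesis by (simp add: \<phi>_def fun_eq_iff)
  next
    case False
    then show ?thesis using W'_inFock_iff by (simp add: \<phi>_def shift_def)
  qed
qed

lemma \<phi>_alg: "S \<in> alg P \<Longrightarrow> \<phi> S \<in> alg Q"
proof (induction rule: alg.induct)
  case (gen A n)
  then show ?case by (simp only: \<phi>_shift) (rule alg.gen[OF V_arv])
qed (simp_all only: \<phi>_add \<phi>_scale \<phi>_comp alg.intros)

lemma \<phi>_Tplus: assumes "T \<in> Tplus P" shows "\<phi> T \<in> Tplus Q"
proof -
  have T: "\<And>\<xi>. \<not> inFock P \<xi> \<Longrightarrow> T \<xi> = fzero" "\<And>\<xi>. inFock P \<xi> \<Longrightarrow> inFock P (T \<xi>)"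
    "\<And>e. e > 0 \<Longrightarrow> \<exists>S\<in>alg P. op_bound P (op_diff T S) e"
    using assms by (auto simp: Tplus_def)
  have "\<exists>S\<in>alg Q. op_bound Q (op_diff (\<phi> T) S) e" if e: "e > 0" for e
  proof -
    define d where "d = e / (C * C)"
    have d: "d > 0" using e C_pos by (simp add: d_def)
    obtain S where S: "S \<in> alg P" "op_bound P (op_diff T S) d" using T(3)[OF d] by blast
    obtain Y where Y: "polymat P Y" "S = opof P Y" using p.alg_polymat[OF S(1)] by blast
    obtain E where E: "bnd P Y E" using p.polymat_bnd[OF Y(1)] by blast
    have "fock_norm (op_diff (\<phi> T) (\<phi> S) \<xi>) \<le> e * fock_norm \<xi>" if \<xi>: "inFock Q \<xi>" for \<xi>
    proof -
      have \<xi>': "inFock P (W' \<xi>)" by (rule W'_inFock[OF \<xi>])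
      have d\<xi>: "inFock P (op_diff T S (W' \<xi>))"
        unfolding op_diff_def Y(2) by (rule inFock_diff[OF T(2)[OF \<xi>'] p.bndD(3)[OF E \<xi>']])
      have "fock_norm (op_diff (\<phi> T) (\<phi> S) \<xi>) = fock_norm (W (op_diff T S (W' \<xi>)))"
        unfolding \<phi>_diff[symmetric] by (simp add: \<phi>_def)
      also have "\<dots> \<le> C * fock_norm (op_diff T S (W' \<xi>))" by (rule fock_norm_W[OF d\<xi>])
      also have "\<dots> \<le> C * (d * fock_norm (W' \<xi>))"
        using S(2) \<xi>' C_pos unfolding op_bound_def by (intro mult_left_mono) auto
      also have "\<dots> \<le> C * (d * (C * fock_norm \<xi>))"
        using C_pos d fock_norm_W'[OF \<xi>] by (intro mult_left_mono) auto
      finally show ?thesis using C_pos by (simp add: d_def)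
    qed
    then show ?thesis using \<phi>_alg[OF S(1)] unfolding op_bound_def by blast
  qed
  moreover have "\<phi> T \<xi> = fzero" if "\<not> inFock Q \<xi>" for \<xi>
    using that T(1) W'_inFock_iff by (simp add: \<phi>_def)
  moreover have "inFock Q (\<phi> T \<xi>)" if "inFock Q \<xi>" for \<xi>
    using T(2)[OF W'_inFock[OF that]] W_inFock(1) by (simp add: \<phi>_def)
  ultimately show ?thesis by (simp add: Tplus_def)
qed

lemma tuple_norm_nonneg: assumes "\<And>s. s < k \<Longrightarrow> inFock P (\<xi> s)" shows "0 \<le> tuple_norm k \<xi>"
proof -
  let ?f = "\<lambda>b. \<Sum>s<k. colsum (\<xi> s) b"
  have "0 \<le> ?f undefined" by (rule sum_nonneg) (use colsum_nonneg assms in auto)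
  also have "\<dots> \<le> Max (range ?f)" by (rule Max_ge) auto
  finally show ?thesis by (simp add: tuple_norm_def colsum_def)
qed

lemma \<phi>_cb: "completely_bounded P Q \<phi>"
  unfolding completely_bounded_def
proof (intro exI[of _ "C * C"] allI impI)
  fix k :: nat and M D
  assume M: "\<forall>r<k. \<forall>s<k. M r s \<in> Tplus P" and b: "mat_bound P k M D"
  show "mat_bound Q k (\<lambda>r s. \<phi> (M r s)) (C * C * D)"
    unfolding mat_bound_def
  proof (intro allI impI)
    fix \<xi> assume \<xi>: "\<forall>s<k. inFock Q (\<xi> s)"
    define \<zeta> where "\<zeta> = (\<lambda>s. W' (\<xi> s))"
    have \<zeta>: "inFock P (\<zeta> s)" if "s < k" for s using that \<xi> W'_inFock by (simp add: \<zeta>_def)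
    define \<eta> where "\<eta> = (\<lambda>r n i j. \<Sum>s<k. M r s (\<zeta> s) n i j)"
    have \<eta>: "inFock P (\<eta> r)" if r: "r < k" for r
    proof -
      have "inFock P (\<lambda>n i j. \<Sum>s<m. M r s (\<zeta> s) n i j)" if "m \<le> k" for m
        using that
      proof (induction m)
        case 0
        then show ?case using inFock_fzero[of P] by (simp add: fzero_def)
      next
        case (Suc m)
        have "inFock P (M r m (\<zeta> m))" using M r Suc.prems \<zeta>[of m] by (auto simp: Tplus_def)
        then show ?case using inFock_add(1)[OF Suc.IH] Suc.prems by simp
      qed
      then show ?thesis by (simp add: \<eta>_def)
    qed
    have eq: "(\<lambda>r n i j. \<Sum>s<k. \<phi> (M r s) (\<xi> s) n i j) = (\<lambda>r. W (\<eta> r))"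
      by (auto simp: fun_eq_iff \<phi>_def W_def V_def \<eta>_def \<zeta>_def sum_distrib_left)
    have 1: "tuple_norm k (\<lambda>r. W (\<eta> r)) \<le> C * tuple_norm k \<eta>" by (rule tuple_norm_W[OF \<eta>])
    have 2: "tuple_norm k \<eta> \<le> D * tuple_norm k \<zeta>" using b \<zeta> unfolding mat_bound_def \<eta>_def by blast
    have 3: "tuple_norm k \<zeta> \<le> C * tuple_norm k \<xi>" unfolding \<zeta>_def by (rule tuple_norm_W') (use \<xi> in auto)
    have 4: "tuple_norm k \<xi> \<le> C * tuple_norm k \<zeta>" using tuple_norm_W[of k \<zeta>, OF \<zeta>] by (simp add: \<zeta>_def)
    have 5: "0 \<le> tuple_norm k \<zeta>" "0 \<le> tuple_norm k \<eta>" using \<zeta> \<eta> tuple_norm_nonneg by auto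
    have "tuple_norm k (\<lambda>r. W (\<eta> r)) \<le> C * (D * tuple_norm k \<zeta>)" using 1 2 C_pos by (meson less_imp_le mult_left_mono order_trans)
    moreover have "D * tuple_norm k \<zeta> \<le> D * (C * tuple_norm k \<xi>)"
    proof (cases "D \<ge> 0")
      \<comment> \<open>\<open>mat_bound\<close> admits every real D; a negative one forces the
        tuple norms of \<zeta> and \<xi> to be 0.\<close>
      case False
      then have "tuple_norm k \<zeta> = 0" using 2 5 by (smt (verit) mult_neg_pos)
      moreover from this have "tuple_norm k \<xi> = 0" using 3 4 C_pos by (simp add: zero_le_mult_iff)
      ultimately show ?thesis by simp
    qed (use 3 in \<open>rule mult_left_mono\<close>)
    ultimately have "tuple_norm k (\<lambda>r. W (\<eta> r)) \<le> C * (D * (C * tuple_norm k \<xi>))"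
      using C_pos by (meson less_imp_le mult_left_mono order_trans)
    then show "tuple_norm k (\<lambda>r n i j. \<Sum>s<k. \<phi> (M r s) (\<xi> s) n i j) \<le> C * C * D * tuple_norm k \<xi>"
      unfolding eq by (simp add: mult_ac)
  qed
qed

text \<open>W acts degree by degree, so it commutes with the gauge unitaries.\<close>

lemma Phi_\<phi>: "Phi n (\<phi> S) = \<phi> (Phi n S)"
proof (intro ext)
  fix \<xi> k a b
  have g: "W' (gauge z \<xi>) = gauge z (W' \<xi>)" for z by (auto simp: W'_def V'_def gauge_def fun_eq_iff)
  have "Phi n (\<phi> S) \<xi> k a b = integral {0..1} (\<lambda>t. v k (\<tau> a) (\<tau> b) *
      (gauge_act (cis (2 * pi * t)) S (W' \<xi>) k (\<tau> a) (\<tau> b) * cis (- 2 * pi * of_int n * t)))"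
    unfolding Phi_def gauge_act_def by (simp add: \<phi>_def g) (simp add: gauge_def W_def V_def mult_ac)
  then show "Phi n (\<phi> S) \<xi> k a b = \<phi> (Phi n S) \<xi> k a b"
    by (simp add: \<phi>_def W_def V_def Phi_def)
qed

theorem graded_cb_iso_\<phi>: "graded_cb_iso P Q \<phi>"
proof -
  interpret i: relabel Q P \<tau> "\<lambda>n a b. 1 / v n (\<tau> a) (\<tau> b)" C by (rule inverse)
  have Tp: "\<phi>' T \<in> Tplus P" if "T \<in> Tplus Q" for T using i.\<phi>_Tplus[OF that] unfolding inverse_defs .
  have bij: "bij_betw \<phi> (Tplus P) (Tplus Q)"
    by (rule bij_betw_byWitness[of _ \<phi>']) (use \<phi>_Tplus Tp in auto)
  have inv: "inv_into (Tplus P) \<phi> T = \<phi>' T" if "T \<in> Tplus Q" for T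
    using bij Tp[OF that] by (metis \<phi>_\<phi>' bij_betw_inv_into_left)
  have "completely_bounded Q P \<phi>'" using i.\<phi>_cb unfolding inverse_defs .
  then obtain c where c: "\<And>k M D. (\<forall>r<k. \<forall>s<k. M r s \<in> Tplus Q) \<Longrightarrow> mat_bound Q k M D \<Longrightarrow>
      mat_bound P k (\<lambda>r s. \<phi>' (M r s)) (c * D)"
    unfolding completely_bounded_def by blast
  have "mat_bound P k (\<lambda>r s. inv_into (Tplus P) \<phi> (M r s)) (c * D)"
    if M: "\<forall>r<k. \<forall>s<k. M r s \<in> Tplus Q" and b: "mat_bound Q k M D" for k M D
  proof -
    have "tuple_norm k (\<lambda>r n i j. \<Sum>s<k. inv_into (Tplus P) \<phi> (M r s) (\<xi> s) n i j)
        = tuple_norm k (\<lambda>r n i j. \<Sum>s<k. \<phi>' (M r s) (\<xi> s) n i j)" for \<xi>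
      unfolding tuple_norm_def using M by (simp add: inv)
    then show ?thesis using c[OF M b] unfolding mat_bound_def by simp
  qed
  then have cb': "completely_bounded Q P (inv_into (Tplus P) \<phi>)" unfolding completely_bounded_def by blast
  have "graded P \<phi>" unfolding graded_def
  proof (intro allI ballI)
    fix n T assume T: "T \<in> Tplus P"
    obtain X where "T = opof P X" using p.Tplus_matrix(1)[OF T] by blast
    then have "Phi n (Phi n T) = Phi n T" by (simp only: Phi_opof hompart_idem)
    then show "Phi n (\<phi> (Phi n T)) = \<phi> (Phi n T)" by (simp add: Phi_\<phi>)
  qed
  moreover have "alg_iso P Q \<phi>" unfolding alg_iso_def using bij \<phi>_add \<phi>_comp \<phi>_scale by blast
  ultimately show ?thesis unfolding graded_cb_iso_def using \<phi>_cb cb' by blast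
qed

theorem similarity_V: "star_aut (\<lambda>f. f \<circ> \<tau>)" "similarity P Q (\<lambda>f. f \<circ> \<tau>) V"
proof -
  interpret i: relabel Q P \<tau> "\<lambda>n a b. 1 / v n (\<tau> a) (\<tau> b)" C by (rule inverse)
  have "bij (\<lambda>f :: 'a \<Rightarrow> complex. f \<circ> \<tau>)"
    by (rule o_bij[of "\<lambda>f. f \<circ> \<sigma>"]) (auto simp: fun_eq_iff)
  then show "star_aut (\<lambda>f. f \<circ> \<tau>)" unfolding star_aut_def by (auto simp: fun_eq_iff)
  have bij: "bij_betw (V n) (arv P n) (arv Q n)" for n
    by (rule bij_betw_byWitness[of _ "V' n"]) (use V_arv V'_arv in auto)
  have c': "cnorm A \<le> C * cnorm (V n A)" for n A
    using i.cnorm_V[of n "V n A"] unfolding inverse_defs by simp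
  show "similarity P Q (\<lambda>f. f \<circ> \<tau>) V" unfolding similarity_def
    using bij cnorm_V c' U_V by (intro conjI exI[of _ C]) (auto simp: V_def fun_eq_iff distrib_left)
qed

end

text \<open>With v the quotient of the weights, \<open>v_mult\<close> is an identity between
  fractions. The rates enter through the bound C, obtained by comparing P with the relabelled Q in
  both directions.\<close>

lemma graph_rate_relabel:
  assumes P: "stochastic P" and Q: "stochastic Q" and bij: "bij \<sigma>"
    and edge: "\<And>i j. P i j > 0 \<longleftrightarrow> Q (\<sigma> i) (\<sigma> j) > 0" and rate: "\<And>i. rate P i = rate Q (\<sigma> i)"
  shows "\<exists>v C. relabel P Q \<sigma> v C"
proof -
  interpret p: stoch P by (rule stoch_I[OF P])
  interpret q: stoch Q by (rule stoch_I[OF Q])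
  define R where "R = (\<lambda>i j. Q (\<sigma> i) (\<sigma> j))"
  have b: "bij_betw \<sigma> UNIV UNIV" using bij by simp
  have mR: "mpow R n i j = mpow Q n (\<sigma> i) (\<sigma> j)" for n i j
  proof (induction n arbitrary: j)
    case 0
    then show ?case using bij by (simp add: bij_def inj_eq)
  next
    case (Suc n)
    have "mpow R (Suc n) i j = (\<Sum>k\<in>UNIV. mpow Q n (\<sigma> i) (\<sigma> k) * Q (\<sigma> k) (\<sigma> j))"
      by (simp add: mpow.simps(2) Suc) (simp add: R_def)
    also have "\<dots> = (\<Sum>k\<in>UNIV. mpow Q n (\<sigma> i) k * Q k (\<sigma> j))" by (rule sum.reindex_bij_betw[OF b])
    finally show ?case by (simp add: mpow.simps(2))
  qed
  have "(\<Sum>j\<in>UNIV. R i j) = (\<Sum>j\<in>UNIV. Q (\<sigma> i) j)" for i unfolding R_def by (rule sum.reindex_bij_betw[OF b])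
  then have R: "stochastic R" using q.P_nonneg q.P_row by (simp add: stochastic_def R_def)
  have rR: "rate R i = rate Q (\<sigma> i)" for i by (simp add: rate_def mR)
  have eR: "P i j > 0 \<longleftrightarrow> R i j > 0" for i j by (simp add: R_def edge)
  obtain C1 where C1: "C1 \<ge> 1" "\<And>n i j. mpow P n i j \<le> C1 * mpow R n i j"
    using mpow_comparison[OF P R eR] rate rR by auto
  obtain C2 where C2: "C2 \<ge> 1" "\<And>n i j. mpow R n i j \<le> C2 * mpow P n i j"
    using mpow_comparison[OF R P] eR rate rR by auto
  have supp: "mpow P n i j > 0 \<longleftrightarrow> mpow Q n (\<sigma> i) (\<sigma> j) > 0" for n i j
    using supp_pow_eq[OF P R eR, of n i j] by (simp add: mR)
  define v where "v = (\<lambda>n i j. if mpow P n i j > 0 then rt P n i j / rt Q n (\<sigma> i) (\<sigma> j) else 1)"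
  define C where "C = sqrt C1 * sqrt C2"
  have C: "sqrt C1 \<le> C" "sqrt C2 \<le> C" "1 \<le> C"
    unfolding C_def using C1(1) C2(1) by (auto simp: mult_le_cancel_left1 mult_le_cancel_right1 one_le_mult_iff intro: mult_ge1_I)
  have "relabel P Q \<sigma> v C"
  proof unfold_locales
    show "v n i j \<noteq> 0" for n i j using supp by (simp add: v_def p.rt_nz q.rt_nz)
    show "cmod (v n i j) \<le> C" for n i j
    proof (cases "mpow P n i j > 0")
      case True
      have "sqrt (mpow P n i j) \<le> sqrt (C1 * mpow Q n (\<sigma> i) (\<sigma> j))" using C1(2)[of n i j] by (simp add: mR)
      then have "cmod (v n i j) \<le> sqrt C1"
        using True supp by (simp add: v_def norm_divide p.cmod_rt q.cmod_rt real_sqrt_mult divide_le_eq)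
      then show ?thesis using C by simp
    qed (use C in \<open>simp add: v_def\<close>)
    show "1 \<le> C * cmod (v n i j)" for n i j
    proof (cases "mpow P n i j > 0")
      case True
      have Qp: "mpow Q n (\<sigma> i) (\<sigma> j) > 0" using True supp by simp
      have "sqrt (mpow Q n (\<sigma> i) (\<sigma> j)) \<le> sqrt (C2 * mpow P n i j)" using C2(2)[of n i j] by (simp add: mR)
      then have "1 \<le> sqrt C2 * (sqrt (mpow P n i j) / sqrt (mpow Q n (\<sigma> i) (\<sigma> j)))"
        using Qp by (simp add: real_sqrt_mult le_divide_eq)
      also have "\<dots> \<le> C * (sqrt (mpow P n i j) / sqrt (mpow Q n (\<sigma> i) (\<sigma> j)))"
        using C(2) by (rule mult_right_mono) (simp add: p.mpow_nonneg q.mpow_nonneg)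
      finally show ?thesis using True by (simp add: v_def norm_divide p.cmod_rt q.cmod_rt)
    qed (use C in \<open>simp add: v_def\<close>)
    fix n m i l k assume a: "mpow P n i l > 0" "mpow P m l k > 0"
    have ac: "mpow P (n + m) i k > 0" by (rule p.mpow_pos_add[OF a])
    show "v (n + m) i k * (rt P n i l * rt P m l k / rt P (n + m) i k) =
       rt Q n (\<sigma> i) (\<sigma> l) * rt Q m (\<sigma> l) (\<sigma> k) / rt Q (n + m) (\<sigma> i) (\<sigma> k) * (v n i l * v m l k)"
      using a ac supp by (simp add: v_def p.rt_nz q.rt_nz)
  qed (use bij supp in auto)
  then show ?thesis by blast
qed

section \<open>From a similarity back to a weighted relabelling\<close>

definition eu :: "'a \<Rightarrow> 'a \<Rightarrow> 'a \<Rightarrow> 'a \<Rightarrow> complex" where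
  "eu i j = (\<lambda>a b. if a = i \<and> b = j then 1 else 0)"

text \<open>Indicators of points go to nonzero orthogonal idempotents, as many as there are states;
  the counting is that of \<open>e_const_exists\<close>.\<close>

lemma star_aut_permutation:
  fixes \<rho> :: "('a::finite \<Rightarrow> complex) \<Rightarrow> 'a \<Rightarrow> complex"
  assumes "star_aut \<rho>"
  obtains \<sigma> where "bij \<sigma>" "\<And>i. \<rho> (\<lambda>x. if x = i then 1 else 0) = (\<lambda>x. if x = \<sigma> i then 1 else 0)"
proof -
  have \<rho>: "bij \<rho>" "\<And>f g. \<rho> (\<lambda>x. f x + g x) = (\<lambda>x. \<rho> f x + \<rho> g x)"
    "\<And>f g. \<rho> (\<lambda>x. f x * g x) = (\<lambda>x. \<rho> f x * \<rho> g x)"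
    using assms by (auto simp: star_aut_def)
  define d :: "'a \<Rightarrow> 'a \<Rightarrow> complex" where "d = (\<lambda>i x. if x = i then 1 else 0)"
  have r0: "\<rho> (\<lambda>x. 0) = (\<lambda>x. 0)" using \<rho>(2)[of "\<lambda>x. 0" "\<lambda>x. 0"] by (auto simp: fun_eq_iff)
  have prod: "\<rho> (d i) x * \<rho> (d j) x = (if i = j then \<rho> (d i) x else 0)" for i j x
  proof -
    have "(\<lambda>x. d i x * d j x) = (if i = j then d i else (\<lambda>x. 0))" by (auto simp: d_def)
    then show ?thesis using fun_cong[OF \<rho>(3)[of "d i" "d j"], of x] r0 by (auto split: if_splits)
  qed
  have "\<exists>x. \<rho> (d i) x = 1" for i
  proof (rule ccontr)
    assume no: "\<nexists>x. \<rho> (d i) x = 1"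
    have "\<rho> (d i) x = 0" for x using prod[of i x i] no by auto
    then have "\<rho> (d i) = \<rho> (\<lambda>x. 0)" using r0 by (simp add: fun_eq_iff)
    then have "d i = (\<lambda>x. 0)" using \<rho>(1) by (simp add: bij_def inj_eq)
    then show False by (metis d_def zero_neq_one)
  qed
  then obtain s where s: "\<And>i. \<rho> (d i) (s i) = 1" by metis
  have "inj s"
  proof (rule injI)
    fix i j assume "s i = s j"
    then show "i = j" using prod[of i "s i" j] s[of i] s[of j] by (auto split: if_splits)
  qed
  then have bij: "bij s" by (simp add: bij_def finite_UNIV_inj_surj)
  have "\<rho> (d i) x = (if x = s i then 1 else 0)" for i x
  proof -
    obtain j where j: "x = s j" using bij by (metis bij_pointE)
    show ?thesis using prod[of i x j] s j \<open>inj s\<close> by (auto simp: inj_eq)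
  qed
  then have "\<rho> (\<lambda>x. if x = i then 1 else 0) = (\<lambda>x. if x = s i then 1 else 0)" for i
    by (simp add: d_def fun_eq_iff)
  then show ?thesis using that bij by blast
qed

lemma cnorm_eu: "cnorm (\<lambda>a b. c * eu i j a b) = cmod c"
proof -
  have "(\<Sum>a\<in>UNIV. (cmod (c * eu i j a b))\<^sup>2) = (if b = j then (cmod c)\<^sup>2 else 0)" for b
  proof -
    have "(\<Sum>a\<in>UNIV. (cmod (c * eu i j a b))\<^sup>2) = (\<Sum>a\<in>UNIV. if a = i then (if b = j then (cmod c)\<^sup>2 else 0) else 0)"
      by (rule sum.cong) (auto simp: eu_def)
    then show ?thesis by simp
  qed
  then have "cnorm (\<lambda>a b. c * eu i j a b) = sqrt (Max (range (\<lambda>b. if b = j then (cmod c)\<^sup>2 else 0)))"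
    by (simp add: cnorm_def)
  also have "Max (range (\<lambda>b. if b = j then (cmod c)\<^sup>2 else 0)) = (cmod c)\<^sup>2"
    by (rule Max_eqI) (auto intro: image_eqI[of _ _ j])
  finally show ?thesis by simp
qed

text \<open>The bimodule property makes V_n compatible with cutting out single entries, so matrix
  units go to multiples of matrix units; these multiples are the weights.\<close>

lemma similarity_relabel:
  assumes P: "stochastic P" and Q: "stochastic Q" and \<rho>: "star_aut \<rho>" and V: "similarity P Q \<rho> V"
  shows "\<exists>\<sigma> v C. relabel P Q \<sigma> v C"
proof -
  interpret p: stoch P by (rule stoch_I[OF P])
  interpret q: stoch Q by (rule stoch_I[OF Q])
  obtain \<sigma> where bij: "bij \<sigma>" and \<sigma>: "\<And>i. \<rho> (\<lambda>x. if x = i then 1 else 0) = (\<lambda>x. if x = \<sigma> i then 1 else 0)"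
    using star_aut_permutation[OF \<rho>] by blast
  have Vb: "\<And>n. n \<ge> 1 \<Longrightarrow> bij_betw (V n) (arv P n) (arv Q n)"
    and Vs: "\<And>n A c. n \<ge> 1 \<Longrightarrow> A \<in> arv P n \<Longrightarrow> V n (\<lambda>i j. c * A i j) = (\<lambda>i j. c * V n A i j)"
    and Vm: "\<And>n A a b. n \<ge> 1 \<Longrightarrow> A \<in> arv P n \<Longrightarrow> V n (\<lambda>i j. a i * A i j * b j) = (\<lambda>i j. \<rho> a i * V n A i j * \<rho> b j)"
    and VU: "\<And>n m A B. n \<ge> 1 \<Longrightarrow> m \<ge> 1 \<Longrightarrow> A \<in> arv P n \<Longrightarrow> B \<in> arv P m \<Longrightarrow>
        V (n + m) (U P n m A B) = U Q n m (V n A) (V m B)"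
    using V unfolding similarity_def by auto
  obtain C0 where C0: "\<And>n A. n \<ge> 1 \<Longrightarrow> A \<in> arv P n \<Longrightarrow> cnorm (V n A) \<le> C0 * cnorm A \<and> cnorm A \<le> C0 * cnorm (V n A)"
    using V unfolding similarity_def by blast
  have eP: "eu i j \<in> arv P n \<longleftrightarrow> mpow P n i j > 0" for i j n by (auto simp: arv_def eu_def)
  have V0: "V n (\<lambda>i j. 0) = (\<lambda>i j. 0)" if "n \<ge> 1" for n
    using Vs[OF that, of "\<lambda>_ _. 0" 0] by (simp add: arv_def)
  have compress: "V n (\<lambda>a b. A i j * eu i j a b) = (\<lambda>a b. V n A (\<sigma> i) (\<sigma> j) * eu (\<sigma> i) (\<sigma> j) a b)"
    if "n \<ge> 1" "A \<in> arv P n" for n A i j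
  proof -
    have "(\<lambda>a b. A i j * eu i j a b) = (\<lambda>a b. (if a = i then 1 else 0) * A a b * (if b = j then 1 else 0))"
      by (auto simp: eu_def fun_eq_iff)
    then show ?thesis using Vm[OF that, of "\<lambda>x. if x = i then 1 else 0" "\<lambda>x. if x = j then 1 else 0"]
      unfolding \<sigma> by (auto simp: eu_def fun_eq_iff)
  qed
  have supp1: "mpow P n i j > 0 \<longleftrightarrow> mpow Q n (\<sigma> i) (\<sigma> j) > 0"
    and vn1: "mpow P n i j > 0 \<Longrightarrow> V n (eu i j) (\<sigma> i) (\<sigma> j) \<noteq> 0"
    and ve1: "mpow P n i j > 0 \<Longrightarrow> V n (eu i j) = (\<lambda>a b. V n (eu i j) (\<sigma> i) (\<sigma> j) * eu (\<sigma> i) (\<sigma> j) a b)"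
    if n: "n \<ge> 1" for n i j
  proof -
    show ve: "V n (eu i j) = (\<lambda>a b. V n (eu i j) (\<sigma> i) (\<sigma> j) * eu (\<sigma> i) (\<sigma> j) a b)" if "mpow P n i j > 0"
    proof -
      have "eu i j i j = 1" by (simp add: eu_def)
      then show ?thesis using compress[OF n, of "eu i j" i j] that eP by simp
    qed
    show vn: "V n (eu i j) (\<sigma> i) (\<sigma> j) \<noteq> 0" if "mpow P n i j > 0"
    proof
      assume z: "V n (eu i j) (\<sigma> i) (\<sigma> j) = 0"
      have "V n (eu i j) = V n (\<lambda>_ _. 0)" using ve[OF that] unfolding z V0[OF n] by simp
      then have "eu i j = (\<lambda>_ _. 0)"
        using Vb[OF n] that eP by (auto simp: bij_betw_def inj_on_def arv_def)
      then have "eu i j i j = 0" by simp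
      then show False by (simp add: eu_def)
    qed
    show "mpow P n i j > 0 \<longleftrightarrow> mpow Q n (\<sigma> i) (\<sigma> j) > 0"
    proof
      assume pos: "mpow P n i j > 0"
      then have "V n (eu i j) \<in> arv Q n" using Vb[OF n] eP by (auto simp: bij_betw_def)
      then show "mpow Q n (\<sigma> i) (\<sigma> j) > 0" using vn[OF pos] by (simp add: arv_def)
    next
      assume pos: "mpow Q n (\<sigma> i) (\<sigma> j) > 0"
      then have "eu (\<sigma> i) (\<sigma> j) \<in> arv Q n" by (auto simp: arv_def eu_def)
      then have "eu (\<sigma> i) (\<sigma> j) \<in> V n ` arv P n" using Vb[OF n] by (simp add: bij_betw_def)
      then obtain A where A: "A \<in> arv P n" "V n A = eu (\<sigma> i) (\<sigma> j)" by auto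
      have "A i j \<noteq> 0"
      proof
        assume "A i j = 0"
        then have "(\<lambda>a b. V n A (\<sigma> i) (\<sigma> j) * eu (\<sigma> i) (\<sigma> j) a b) = (\<lambda>_ _. 0)"
          using compress[OF n A(1), of i j] V0[OF n] by simp
        then have "V n A (\<sigma> i) (\<sigma> j) * eu (\<sigma> i) (\<sigma> j) (\<sigma> i) (\<sigma> j) = 0" by metis
        then show False by (simp add: A(2) eu_def)
      qed
      then show "mpow P n i j > 0" using A(1) by (simp add: arv_def)
    qed
  qed
  have supp: "mpow P n i j > 0 \<longleftrightarrow> mpow Q n (\<sigma> i) (\<sigma> j) > 0" for n i j
    using supp1[of n i j] bij by (cases "n = 0") (auto simp: bij_def inj_eq)
  \<comment> \<open>In degree 0 the similarity is \<rho> itself, hence weight 1 there; off the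
    support the value 1 keeps v nonzero.\<close>
  define v where "v = (\<lambda>n i j. if n \<ge> 1 \<and> mpow P n i j > 0 then V n (eu i j) (\<sigma> i) (\<sigma> j) else 1)"
  define C where "C = max 1 C0"
  have "relabel P Q \<sigma> v C"
  proof unfold_locales
    show v0: "v n i j \<noteq> 0" for n i j using vn1 by (simp add: v_def)
    have cn: "cnorm (V n (eu i j)) = cmod (v n i j)" "cnorm (eu i j) = 1" if "n \<ge> 1" "mpow P n i j > 0" for n i j
      using ve1[OF that] cnorm_eu[of "v n i j" "\<sigma> i" "\<sigma> j"] cnorm_eu[of 1 i j] that by (simp_all add: v_def)
    show "cmod (v n i j) \<le> C" for n i j
    proof (cases "n \<ge> 1 \<and> mpow P n i j > 0")
      case True
      then have "cmod (v n i j) \<le> C0" using C0[of n "eu i j"] cn[of n i j] eP by simp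
      then show ?thesis by (simp add: C_def)
    next
      case False
      then have "v n i j = 1" by (auto simp: v_def)
      then show ?thesis by (simp add: C_def)
    qed
    show "1 \<le> C * cmod (v n i j)" for n i j
    proof (cases "n \<ge> 1 \<and> mpow P n i j > 0")
      case True
      then have "1 \<le> C0 * cmod (v n i j)" using C0[of n "eu i j"] cn[of n i j] eP by simp
      also have "\<dots> \<le> C * cmod (v n i j)" by (rule mult_right_mono) (auto simp: C_def)
      finally show ?thesis .
    next
      case False
      then have "v n i j = 1" by (auto simp: v_def)
      then show ?thesis by (simp add: C_def)
    qed
    fix n m i l k assume a: "mpow P n i l > 0" "mpow P m l k > 0"
    have ac: "mpow P (n + m) i k > 0" by (rule p.mpow_pos_add[OF a])
    show "v (n + m) i k * (rt P n i l * rt P m l k / rt P (n + m) i k) =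
       rt Q n (\<sigma> i) (\<sigma> l) * rt Q m (\<sigma> l) (\<sigma> k) / rt Q (n + m) (\<sigma> i) (\<sigma> k) * (v n i l * v m l k)"
    proof (cases "n = 0 \<or> m = 0")
      case True
      have nz: "rt P (n + m) i k \<noteq> 0" "rt Q (n + m) (\<sigma> i) (\<sigma> k) \<noteq> 0" using ac supp by (auto simp: p.rt_nz q.rt_nz)
      have v1: "v 0 x y = 1" for x y by (simp add: v_def)
      have r1: "rt P 0 x x = 1" "rt Q 0 x x = 1" for x by (auto simp: rt_def)
      consider "n = 0" "i = l" | "m = 0" "l = k" using True a by (auto split: if_splits)
      then show ?thesis using nz by cases (auto simp: v1 r1)
    next
      case False
      then have n: "n \<ge> 1" "m \<ge> 1" "n + m \<ge> 1" by auto
      define x where "x = rt P n i l * rt P m l k / rt P (n + m) i k"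
      have UP: "U P n m (eu i l) (eu l k) = (\<lambda>a b. x * eu i k a b)"
      proof (intro ext)
        fix a b
        have "(\<Sum>c\<in>UNIV. (rt P n a c * eu i l a c) * (rt P m c b * eu l k c b))
            = (\<Sum>c\<in>UNIV. if c = l then (if a = i \<and> b = k then rt P n i l * rt P m l k else 0) else 0)"
          by (rule sum.cong) (auto simp: eu_def)
        then show "U P n m (eu i l) (eu l k) a b = x * eu i k a b"
          using ac by (auto simp: U_def x_def rt_def eu_def[of i k])
      qed
      have "V (n + m) (U P n m (eu i l) (eu l k)) (\<sigma> i) (\<sigma> k) = x * v (n + m) i k"
        unfolding UP using Vs[OF n(3), of "eu i k" x] eP ac n by (simp add: v_def)
      moreover have "U Q n m (V n (eu i l)) (V m (eu l k)) (\<sigma> i) (\<sigma> k)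
          = rt Q n (\<sigma> i) (\<sigma> l) * rt Q m (\<sigma> l) (\<sigma> k) / rt Q (n + m) (\<sigma> i) (\<sigma> k) * (v n i l * v m l k)"
      proof -
        have e1: "V n (eu i l) = (\<lambda>a b. v n i l * eu (\<sigma> i) (\<sigma> l) a b)" using ve1[OF n(1) a(1)] n a by (simp add: v_def)
        have e2: "V m (eu l k) = (\<lambda>a b. v m l k * eu (\<sigma> l) (\<sigma> k) a b)" using ve1[OF n(2) a(2)] n a by (simp add: v_def)
        have "(\<Sum>c\<in>UNIV. (rt Q n (\<sigma> i) c * V n (eu i l) (\<sigma> i) c) * (rt Q m c (\<sigma> k) * V m (eu l k) c (\<sigma> k)))
            = (\<Sum>c\<in>UNIV. if c = \<sigma> l then (rt Q n (\<sigma> i) (\<sigma> l) * rt Q m (\<sigma> l) (\<sigma> k)) * (v n i l * v m l k) else 0)"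
          unfolding e1 e2 by (rule sum.cong) (auto simp: eu_def)
        then show ?thesis using ac supp by (simp add: U_def rt_def)
      qed
      moreover have "V (n + m) (U P n m (eu i l) (eu l k)) = U Q n m (V n (eu i l)) (V m (eu l k))"
        by (rule VU[OF n(1,2)]) (use a eP in auto)
      ultimately show ?thesis by (simp add: x_def mult.commute)
    qed
  qed (use bij supp in auto)
  then show ?thesis by blast
qed

lemma essential_recurrent: assumes "stochastic P" "essential P" shows "recurrent P i"
  unfolding recurrent_def
proof (intro allI impI)
  interpret p: stoch P by (rule stoch_I[OF assms(1)])
  fix j assume "reach P i j"
  then obtain n where n: "mpow P n i j > 0" by (auto simp: reach_def)
  show "reach P j i"
  proof (cases "n = 0")
    case True
    then show ?thesis using n by (auto split: if_splits)
  next
    case False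
    then obtain m where "mpow P m j i \<noteq> 0" using assms(2) n unfolding essential_def by (metis One_nat_def Suc_le_eq not_gr0)
    then show ?thesis by (auto simp: p.mpow_pos_iff[symmetric] intro: p.reachI)
  qed
qed

theorem mainTheorem2:
  fixes P Q :: "'a::finite \<Rightarrow> 'a \<Rightarrow> real"
  assumes "stochastic P" and "stochastic Q"
  shows "((\<exists>\<rho> V. star_aut \<rho> \<and> similarity P Q \<rho> V) \<longleftrightarrow> (\<exists>\<phi>. graded_cb_iso P Q \<phi>))
       \<and> ((\<exists>\<phi>. graded_cb_iso P Q \<phi>) \<longleftrightarrow> (\<exists>\<phi>. alg_iso P Q \<phi>))
       \<and> (essential P \<and> essential Q \<longrightarrow>
            ((\<exists>\<phi>. alg_iso P Q \<phi>) \<longleftrightarrow>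
             (\<exists>\<sigma>. bij \<sigma> \<and> (\<forall>i j. P i j > 0 \<longleftrightarrow> Q (\<sigma> i) (\<sigma> j) > 0))))"
proof -
  have sim_cb: "\<exists>\<phi>. graded_cb_iso P Q \<phi>" if "star_aut \<rho>" "similarity P Q \<rho> V" for \<rho> V
    using similarity_relabel[OF assms that] relabel.graded_cb_iso_\<phi> by blast
  have cb_alg: "alg_iso P Q \<phi>" if "graded_cb_iso P Q \<phi>" for \<phi>
    using that by (simp add: graded_cb_iso_def)
  have rate_sim: "\<exists>\<rho> V. star_aut \<rho> \<and> similarity P Q \<rho> V"
    if "bij \<sigma>" "\<And>i j. P i j > 0 \<longleftrightarrow> Q (\<sigma> i) (\<sigma> j) > 0" "\<And>i. rate P i = rate Q (\<sigma> i)" for \<sigma>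
    using graph_rate_relabel[OF assms that] relabel.similarity_V by blast
  \<comment> \<open>This closes the cycle of implications: of the algebraic isomorphism only the
    graph and the rates are kept.\<close>
  have alg_sim: "\<exists>\<rho> V. star_aut \<rho> \<and> similarity P Q \<rho> V" if "alg_iso P Q \<phi>" for \<phi>
    using alg_iso_graph_rate[OF assms that] rate_sim by blast
  have alg_graph: "\<exists>\<sigma>. bij \<sigma> \<and> (\<forall>i j. P i j > 0 \<longleftrightarrow> Q (\<sigma> i) (\<sigma> j) > 0)" if "alg_iso P Q \<phi>" for \<phi>
    using alg_iso_graph_rate[OF assms that] by metis
  have graph_alg: "\<exists>\<phi>. alg_iso P Q \<phi>"
    if "essential P" "essential Q" "bij \<sigma>" "\<And>i j. P i j > 0 \<longleftrightarrow> Q (\<sigma> i) (\<sigma> j) > 0" for \<sigma>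
  proof -
    have "rate P i = rate Q (\<sigma> i)" for i
      using stoch.rate_recurrent[OF stoch_I[OF assms(1)] essential_recurrent[OF assms(1) that(1)]]
        stoch.rate_recurrent[OF stoch_I[OF assms(2)] essential_recurrent[OF assms(2) that(2)]] by simp
    then show ?thesis using rate_sim[OF that(3,4)] sim_cb cb_alg by blast
  qed
  show ?thesis using sim_cb cb_alg alg_sim alg_graph graph_alg by meson
qed

end
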